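(* Let $G=(V,E)$ be a connected, symmetric, locally finite weighted graph such that $\mu(x)\ge\mu_0>0$ for all $x\in V$ and $\sum_{y\sim x}\omega_{xy}<C$ for all $x\in V$, where $\mu_0,C$ are positive constants. Let $0<\gamma<1<q\le p<\alpha+1$; let $f,g:V\to\mathbb{R}$ with $f>0$, $g\ge 0$, $g\not\equiv 0$, $f\in L^1(V)\cap L^{\frac{p}{p-1+\gamma}}(V)\cap L^{\frac{q}{q-1+\gamma}}(V)$, $g\in L^1(V)\cap L^\infty(V)$; and let $a,b:V\to(0,\infty)$ satisfy $a(x)\ge a_0>0$ and $b(x)\ge b_0>0$ for all $x\in V$, for some constants $a_0,b_0$. Assume $0<\lambda<\Lambda_*$. Then the equation $$-\Delta_p u-\Delta_q u+a(x)u^{p-1}+b(x)u^{q-1}=f(x)u^{-\gamma}+\lambda g(x)u^{\alpha}\ \text{ in } V,\qquad u>0,\ u\in W:=W_a^{1,p}(V)\cap W_b^{1,q}(V),$$ has at least two positive solutions $u_\lambda$ and $v_\lambda$, with $u_\lambda\in\mathcal{D}_\lambda^+$ and $v_\lambda\in\mathcal{D}_\lambda^-$. Moreover, $$\|v_\lambda\|_{W_a^{1,p}(V)}>X(\lambda)>X_0>\|u_\lambda\|_{W_a^{1,p}(V)},\qquad \|v_\lambda\|_{\alpha+1}>S(\lambda)>S_0>\|u_\lambda\|_{\alpha+1},$$ and $\|v_\lambda\|_W>\|v_\lambda\|_{W_a^{1,p}(V)}>X(\lambda)$, where $X(\lambda)\to+\infty$ as $p\to\alpha+1$ (with $p<\alpha+1$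 and $0<\lambda<\Lambda_*$ maintained).
   Context: Graph setting. $V$ is the vertex set and $E$ the edge set; $y\sim x$ means $xy\in E$. Locally finite: each vertex has finitely many neighbours. Symmetric: edge weights satisfy $\omega_{xy}=\omega_{yx}>0$ for $xy\in E$. Vertex measure $\mu:V\to(0,\infty)$. $\int_V\psi\,d\mu=\sum_{x\in V}\mu(x)\psi(x)$. $\|u\|_\theta=(\int_V|u|^\theta d\mu)^{1/\theta}$ for $1\le\theta<\infty$, $\|u\|_\infty=\sup_V|u|$, and $L^\theta(V)$ is the set of functions $V\to\mathbb{R}$ with finite norm. Gradient and Laplacian. $\Gamma(u,v)(x)=\frac{1}{2\mu(x)}\sum_{y\sim x}\omega_{xy}(u(y)-u(x))(v(y)-v(x))$, $|\nabla u|(x)=\sqrt{\Gamma(u,u)(x)}$. For $s>1$, $$\Delta_s u(x)=\frac{1}{2\mu(x)}\sum_{y\sim x}\left(|\nabla u|^{s-2}(y)+|\nabla u|^{s-2}(x)\right)\omega_{xy}(u(y)-u(x)),$$ and, for $s<2$, terms $|\nabla u|^{s-2}(z)\,(u(y)-u(x))$ with $z\in\{x,y\}$, and $|\nabla u|^{s-2}\Gamma(u,\phi)$, are read as $0$ where $|\nabla u|=0$. Spaces. $W^{1,s}(V)=\{u:V\to\mathbb{R}:\int_V(|\nabla u|^s+|u|^s)d\mu<\infty\}$; $W_a^{1,p}(V)=\{u\in W^{1,p}(V):\int_V a|u|^pd\mu<\infty\}$ with norm $\|u\|_{W_a^{1,p}(V)}=(\int_V(|\nabla u|^p+a|u|^p)d\mu)^{1/p}$;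 $W_b^{1,q}(V)=\{u\in W^{1,q}(V):\int_V b|u|^qd\mu<\infty\}$ with norm $\|u\|_{W_b^{1,q}(V)}=(\int_V(|\nabla u|^q+b|u|^q)d\mu)^{1/q}$. $W=W_a^{1,p}(V)\cap W_b^{1,q}(V)$ with norm $\|u\|_W=\|u\|_{W_a^{1,p}(V)}+\|u\|_{W_b^{1,q}(V)}$. $W_+=\{u\in W:u\ge0\}$. Solutions. A positive solution is a weak solution: $u\in W$ with $u>0$ on $V$ and, for every $\phi\in W$, $$\int_V(|\nabla u|^{p-2}\Gamma(u,\phi)+a u^{p-1}\phi)d\mu+\int_V(|\nabla u|^{q-2}\Gamma(u,\phi)+b u^{q-1}\phi)d\mu=\int_V f u^{-\gamma}\phi\,d\mu+\lambda\int_V g u^\alpha\phi\,d\mu.$$ Nehari sets. For $u\in W_+$ and $t>0$, $$\varphi_u(t)=t^{p-1+\gamma}\|u\|^p_{W_a^{1,p}(V)}+t^{q-1+\gamma}\|u\|^q_{W_b^{1,q}(V)}-\int_V f u^{1-\gamma}d\mu-\lambda t^{\alpha+\gamma}\int_V g u^{\alpha+1}d\mu,$$ $\mathcal{D}_\lambda=\{v=tu:u\in W_+,\ t>0,\ \varphi_u(t)=0\}$. With $$N(v)=(p-1+\gamma)\|v\|^p_{W_a^{1,p}(V)}+(q-1+\gamma)\|v\|^q_{W_b^{1,q}(V)}-(\alpha+\gamma)\lambda\int_V g v^{\alpha+1}d\mu,$$ $\mathcal{D}_\lambda^+=\{v\in\mathcal{D}_\lambda:N(v)>0\}$ and $\mathcal{D}_\lambda^-=\{v\in\mathcal{D}_\lambda:N(v)<0\}$.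 Constants. $$X(\lambda)=\left(\frac{p-1+\gamma}{\lambda(\alpha+\gamma)\|g\|_\infty\mu_0^{\frac{p-1-\alpha}{p}}a_0^{-\frac{\alpha+1}{p}}}\right)^{\frac{1}{\alpha+1-p}},\quad X_0=\left(\frac{\alpha+\gamma}{\alpha+1-p}\right)^{\frac{1}{p-1+\gamma}}a_0^{-\frac{1-\gamma}{p(p-1+\gamma)}}\|f\|_{\frac{p}{p-1+\gamma}}^{\frac{1}{p-1+\gamma}},$$ $$S(\lambda)=\left(\frac{p-1+\gamma}{\lambda(\alpha+\gamma)}\right)^{\frac{1}{\alpha+1-p}}\left(\frac1{\mu_0}\right)^{-\frac{1}{\alpha+1}}a_0^{\frac{1}{\alpha+1-p}}\left(\frac{1}{\|g\|_\infty}\right)^{\frac{1}{\alpha+1-p}},$$ $$S_0=\left(\frac{\alpha+\gamma}{\alpha+1-p}\right)^{\frac{1}{p-1+\gamma}}\left(\frac1{\mu_0}\right)^{\frac{\alpha+1-p}{p(\alpha+1)}}a_0^{-\frac{1}{p-1+\gamma}}\|f\|_{\frac{p}{p-1+\gamma}}^{\frac{1}{p-1+\gamma}},$$ $$\Lambda_*=\left(\frac{p+\gamma-1}{\alpha+\gamma}\right)^{\frac{\alpha+\gamma}{p+\gamma-1}}\left(\frac{\alpha+1-p}{p-1+\gamma}\right)^{\frac{\alpha+1-p}{p+\gamma-1}}\frac{1}{\|g\|_\infty}\mu_0^{\frac{\alpha+1-p}{p}}a_0^{\frac{\alpha+\gamma}{p-1+\gamma}}\left(\frac{1}{\|f\|_{\frac{p}{p-1+\gamma}}}\right)^{\frac{\alpha+1-p}{p+\gamma-1}}.$$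 In the limit $p\to\alpha+1$ the quantities $\gamma,\alpha,f,g,a_0,\mu_0$ are held fixed. *)

theory Defs
  imports "HOL-Analysis.Analysis"
begin

text \<open>
  The vertex set is the type \<^typ>\<open>'v\<close>. Edges are a relation that \<open>weighted_graph\<close> makes
  symmetric; the weight matters only on edges. Loops are not excluded: they do not contribute to
  the gradient form.
\<close>

record 'v wgraph =
  edges :: "('v \<times> 'v) set"
  weight :: "'v \<Rightarrow> 'v \<Rightarrow> real"
  vmeas :: "'v \<Rightarrow> real"

definition nbrs :: "'v wgraph \<Rightarrow> 'v \<Rightarrow> 'v set" where
  "nbrs G x = edges G `` {x}"

definition weighted_graph :: "'v wgraph \<Rightarrow> bool" where
  "weighted_graph G \<longleftrightarrow> sym (edges G)
     \<and> (\<forall>x y. (x, y) \<in> edges G \<longrightarrow> weight G x y = weight G y x \<and> 0 < weight G x y)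
     \<and> (\<forall>x. 0 < vmeas G x)"

definition locally_finite :: "'v wgraph \<Rightarrow> bool" where
  "locally_finite G \<longleftrightarrow> (\<forall>x. finite (nbrs G x))"

definition connected_graph :: "'v wgraph \<Rightarrow> bool" where
  "connected_graph G \<longleftrightarrow> (\<forall>x y. (x, y) \<in> (edges G)\<^sup>*)"

text \<open>
  Real-valued unconditional summability is absolute summability, so \<open>integrable_V\<close> is
  \<open>\<psi> \<in> L\<^sup>1\<close>; for \<open>\<psi> \<ge> 0\<close> it says that the integral is finite. Since \<^const>\<open>infsum\<close> is 0 on
  non-summable functions, \<open>integral_V\<close> and the norms below carry their usual meaning only
  under the respective integrability or membership condition.
\<close>

definition integrable_V :: "'v wgraph \<Rightarrow> ('v \<Rightarrow> real) \<Rightarrow> bool" where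
  "integrable_V G \<psi> \<longleftrightarrow> (\<lambda>x. vmeas G x * \<psi> x) summable_on UNIV"

definition integral_V :: "'v wgraph \<Rightarrow> ('v \<Rightarrow> real) \<Rightarrow> real" where
  "integral_V G \<psi> = (\<Sum>\<^sub>\<infinity>x. vmeas G x * \<psi> x)"

definition L_space :: "'v wgraph \<Rightarrow> real \<Rightarrow> ('v \<Rightarrow> real) set" where
  "L_space G \<theta> = {u. integrable_V G (\<lambda>x. \<bar>u x\<bar> powr \<theta>)}"

definition L_norm :: "'v wgraph \<Rightarrow> real \<Rightarrow> ('v \<Rightarrow> real) \<Rightarrow> real" where
  "L_norm G \<theta> u = integral_V G (\<lambda>x. \<bar>u x\<bar> powr \<theta>) powr (1 / \<theta>)"

definition Linf_space :: "('v \<Rightarrow> real) set" where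
  "Linf_space = {u. bdd_above (range (\<lambda>x. \<bar>u x\<bar>))}"

definition Linf_norm :: "('v \<Rightarrow> real) \<Rightarrow> real" where
  "Linf_norm u = (SUP x. \<bar>u x\<bar>)"

definition gradient_form :: "'v wgraph \<Rightarrow> ('v \<Rightarrow> real) \<Rightarrow> ('v \<Rightarrow> real) \<Rightarrow> 'v \<Rightarrow> real" where
  "gradient_form G u v x =
     1 / (2 * vmeas G x) * (\<Sum>y\<in>nbrs G x. weight G x y * (u y - u x) * (v y - v x))"

definition grad_norm :: "'v wgraph \<Rightarrow> ('v \<Rightarrow> real) \<Rightarrow> 'v \<Rightarrow> real" where
  "grad_norm G u x = sqrt (gradient_form G u u x)"

definition W1 :: "'v wgraph \<Rightarrow> real \<Rightarrow> ('v \<Rightarrow> real) set" where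
  "W1 G s = {u. integrable_V G (\<lambda>x. grad_norm G u x powr s + \<bar>u x\<bar> powr s)}"

definition W1_weighted :: "'v wgraph \<Rightarrow> real \<Rightarrow> ('v \<Rightarrow> real) \<Rightarrow> ('v \<Rightarrow> real) set" where
  "W1_weighted G s c = {u \<in> W1 G s. integrable_V G (\<lambda>x. c x * \<bar>u x\<bar> powr s)}"

definition W1_norm :: "'v wgraph \<Rightarrow> real \<Rightarrow> ('v \<Rightarrow> real) \<Rightarrow> ('v \<Rightarrow> real) \<Rightarrow> real" where
  "W1_norm G s c u =
     integral_V G (\<lambda>x. grad_norm G u x powr s + c x * \<bar>u x\<bar> powr s) powr (1 / s)"

definition W_space ::
  "'v wgraph \<Rightarrow> real \<Rightarrow> real \<Rightarrow> ('v \<Rightarrow> real) \<Rightarrow> ('v \<Rightarrow> real) \<Rightarrow> ('v \<Rightarrow> real) set" where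
  "W_space G p q a b = W1_weighted G p a \<inter> W1_weighted G q b"

definition W_norm ::
  "'v wgraph \<Rightarrow> real \<Rightarrow> real \<Rightarrow> ('v \<Rightarrow> real) \<Rightarrow> ('v \<Rightarrow> real) \<Rightarrow> ('v \<Rightarrow> real) \<Rightarrow> real" where
  "W_norm G p q a b u = W1_norm G p a u + W1_norm G q b u"

definition W_plus ::
  "'v wgraph \<Rightarrow> real \<Rightarrow> real \<Rightarrow> ('v \<Rightarrow> real) \<Rightarrow> ('v \<Rightarrow> real) \<Rightarrow> ('v \<Rightarrow> real) set" where
  "W_plus G p q a b = {u \<in> W_space G p q a b. \<forall>x. 0 \<le> u x}"

text \<open>
  The integrand of the weak form of \<open>-\<Delta>\<^sub>s u + c u\<^bsup>s-1\<^esup>\<close>. As \<open>0 powr r = 0\<close> for every \<open>r\<close>, the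
  first term vanishes where \<open>\<bar>\<nabla>u\<bar> = 0\<close>, as the convention for \<open>s < 2\<close> demands; for
  \<open>s \<ge> 2\<close> this is no convention, because there \<open>\<Gamma>(u,\<phi>) = 0\<close>.
\<close>

definition weak_integrand ::
  "'v wgraph \<Rightarrow> real \<Rightarrow> ('v \<Rightarrow> real) \<Rightarrow> ('v \<Rightarrow> real) \<Rightarrow> ('v \<Rightarrow> real) \<Rightarrow> 'v \<Rightarrow> real" where
  "weak_integrand G s c u \<phi> x =
     grad_norm G u x powr (s - 2) * gradient_form G u \<phi> x + c x * u x powr (s - 1) * \<phi> x"

text \<open>
  Positive weak solutions of
  \<open>-\<Delta>\<^sub>p u - \<Delta>\<^sub>q u + a u\<^bsup>p-1\<^esup> + b u\<^bsup>q-1\<^esup> = f u\<^bsup>-\<gamma>\<^esup> + lam g u\<^bsup>\<alpha>\<^esup>\<close>; the convergence of the integrals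
  in the weak equation is part of the notion.
\<close>

definition positive_solution ::
  "'v wgraph \<Rightarrow> real \<Rightarrow> real \<Rightarrow> ('v \<Rightarrow> real) \<Rightarrow> ('v \<Rightarrow> real) \<Rightarrow> ('v \<Rightarrow> real) \<Rightarrow> ('v \<Rightarrow> real)
     \<Rightarrow> real \<Rightarrow> real \<Rightarrow> real \<Rightarrow> ('v \<Rightarrow> real) \<Rightarrow> bool" where
  "positive_solution G p q a b f g \<gamma> \<alpha> lam u \<longleftrightarrow>
     u \<in> W_space G p q a b \<and> (\<forall>x. 0 < u x) \<and>
     (\<forall>\<phi> \<in> W_space G p q a b.
        integrable_V G (weak_integrand G p a u \<phi>) \<and>
        integrable_V G (weak_integrand G q b u \<phi>) \<and>
        integrable_V G (\<lambda>x. f x * u x powr (- \<gamma>) * \<phi> x) \<and>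
        integrable_V G (\<lambda>x. g x * u x powr \<alpha> * \<phi> x) \<and>
        integral_V G (weak_integrand G p a u \<phi>) + integral_V G (weak_integrand G q b u \<phi>)
          = integral_V G (\<lambda>x. f x * u x powr (- \<gamma>) * \<phi> x)
            + lam * integral_V G (\<lambda>x. g x * u x powr \<alpha> * \<phi> x))"

definition fibering ::
  "'v wgraph \<Rightarrow> real \<Rightarrow> real \<Rightarrow> ('v \<Rightarrow> real) \<Rightarrow> ('v \<Rightarrow> real) \<Rightarrow> ('v \<Rightarrow> real) \<Rightarrow> ('v \<Rightarrow> real)
     \<Rightarrow> real \<Rightarrow> real \<Rightarrow> real \<Rightarrow> ('v \<Rightarrow> real) \<Rightarrow> real \<Rightarrow> real" where
  "fibering G p q a b f g \<gamma> \<alpha> lam u t =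
     t powr (p - 1 + \<gamma>) * W1_norm G p a u powr p
     + t powr (q - 1 + \<gamma>) * W1_norm G q b u powr q
     - integral_V G (\<lambda>x. f x * u x powr (1 - \<gamma>))
     - lam * t powr (\<alpha> + \<gamma>) * integral_V G (\<lambda>x. g x * u x powr (\<alpha> + 1))"

definition nehari ::
  "'v wgraph \<Rightarrow> real \<Rightarrow> real \<Rightarrow> ('v \<Rightarrow> real) \<Rightarrow> ('v \<Rightarrow> real) \<Rightarrow> ('v \<Rightarrow> real) \<Rightarrow> ('v \<Rightarrow> real)
     \<Rightarrow> real \<Rightarrow> real \<Rightarrow> real \<Rightarrow> ('v \<Rightarrow> real) set" where
  "nehari G p q a b f g \<gamma> \<alpha> lam =
     {v. \<exists>u t. u \<in> W_plus G p q a b \<and> 0 < t \<and> fibering G p q a b f g \<gamma> \<alpha> lam u t = 0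
           \<and> v = (\<lambda>x. t * u x)}"

definition nehari_N ::
  "'v wgraph \<Rightarrow> real \<Rightarrow> real \<Rightarrow> ('v \<Rightarrow> real) \<Rightarrow> ('v \<Rightarrow> real) \<Rightarrow> ('v \<Rightarrow> real)
     \<Rightarrow> real \<Rightarrow> real \<Rightarrow> real \<Rightarrow> ('v \<Rightarrow> real) \<Rightarrow> real" where
  "nehari_N G p q a b g \<gamma> \<alpha> lam v =
     (p - 1 + \<gamma>) * W1_norm G p a v powr p + (q - 1 + \<gamma>) * W1_norm G q b v powr q
     - (\<alpha> + \<gamma>) * lam * integral_V G (\<lambda>x. g x * v x powr (\<alpha> + 1))"

definition nehari_plus ::
  "'v wgraph \<Rightarrow> real \<Rightarrow> real \<Rightarrow> ('v \<Rightarrow> real) \<Rightarrow> ('v \<Rightarrow> real) \<Rightarrow> ('v \<Rightarrow> real) \<Rightarrow> ('v \<Rightarrow> real)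
     \<Rightarrow> real \<Rightarrow> real \<Rightarrow> real \<Rightarrow> ('v \<Rightarrow> real) set" where
  "nehari_plus G p q a b f g \<gamma> \<alpha> lam =
     {v \<in> nehari G p q a b f g \<gamma> \<alpha> lam. nehari_N G p q a b g \<gamma> \<alpha> lam v > 0}"

definition nehari_minus ::
  "'v wgraph \<Rightarrow> real \<Rightarrow> real \<Rightarrow> ('v \<Rightarrow> real) \<Rightarrow> ('v \<Rightarrow> real) \<Rightarrow> ('v \<Rightarrow> real) \<Rightarrow> ('v \<Rightarrow> real)
     \<Rightarrow> real \<Rightarrow> real \<Rightarrow> real \<Rightarrow> ('v \<Rightarrow> real) set" where
  "nehari_minus G p q a b f g \<gamma> \<alpha> lam =
     {v \<in> nehari G p q a b f g \<gamma> \<alpha> lam. nehari_N G p q a b g \<gamma> \<alpha> lam v < 0}"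

definition X_lam :: "real \<Rightarrow> real \<Rightarrow> ('v \<Rightarrow> real) \<Rightarrow> real \<Rightarrow> real \<Rightarrow> real \<Rightarrow> real \<Rightarrow> real" where
  "X_lam \<mu>0 a0 g \<gamma> \<alpha> p lam =
     ((p - 1 + \<gamma>)
       / (lam * (\<alpha> + \<gamma>) * Linf_norm g * \<mu>0 powr ((p - 1 - \<alpha>) / p) * a0 powr (- ((\<alpha> + 1) / p))))
     powr (1 / (\<alpha> + 1 - p))"

definition X_0 :: "'v wgraph \<Rightarrow> real \<Rightarrow> ('v \<Rightarrow> real) \<Rightarrow> real \<Rightarrow> real \<Rightarrow> real \<Rightarrow> real" where
  "X_0 G a0 f \<gamma> \<alpha> p =
     ((\<alpha> + \<gamma>) / (\<alpha> + 1 - p)) powr (1 / (p - 1 + \<gamma>))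
     * a0 powr (- ((1 - \<gamma>) / (p * (p - 1 + \<gamma>))))
     * L_norm G (p / (p - 1 + \<gamma>)) f powr (1 / (p - 1 + \<gamma>))"

definition S_lam :: "real \<Rightarrow> real \<Rightarrow> ('v \<Rightarrow> real) \<Rightarrow> real \<Rightarrow> real \<Rightarrow> real \<Rightarrow> real \<Rightarrow> real" where
  "S_lam \<mu>0 a0 g \<gamma> \<alpha> p lam =
     ((p - 1 + \<gamma>) / (lam * (\<alpha> + \<gamma>))) powr (1 / (\<alpha> + 1 - p))
     * (1 / \<mu>0) powr (- (1 / (\<alpha> + 1)))
     * a0 powr (1 / (\<alpha> + 1 - p))
     * (1 / Linf_norm g) powr (1 / (\<alpha> + 1 - p))"

definition S_0 :: "'v wgraph \<Rightarrow> real \<Rightarrow> real \<Rightarrow> ('v \<Rightarrow> real) \<Rightarrow> real \<Rightarrow> real \<Rightarrow> real \<Rightarrow> real" where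
  "S_0 G \<mu>0 a0 f \<gamma> \<alpha> p =
     ((\<alpha> + \<gamma>) / (\<alpha> + 1 - p)) powr (1 / (p - 1 + \<gamma>))
     * (1 / \<mu>0) powr ((\<alpha> + 1 - p) / (p * (\<alpha> + 1)))
     * a0 powr (- (1 / (p - 1 + \<gamma>)))
     * L_norm G (p / (p - 1 + \<gamma>)) f powr (1 / (p - 1 + \<gamma>))"

definition Lambda_star ::
  "'v wgraph \<Rightarrow> real \<Rightarrow> real \<Rightarrow> ('v \<Rightarrow> real) \<Rightarrow> ('v \<Rightarrow> real) \<Rightarrow> real \<Rightarrow> real \<Rightarrow> real \<Rightarrow> real" where
  "Lambda_star G \<mu>0 a0 f g \<gamma> \<alpha> p =
     ((p + \<gamma> - 1) / (\<alpha> + \<gamma>)) powr ((\<alpha> + \<gamma>) / (p + \<gamma> - 1))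
     * ((\<alpha> + 1 - p) / (p - 1 + \<gamma>)) powr ((\<alpha> + 1 - p) / (p + \<gamma> - 1))
     * (1 / Linf_norm g)
     * \<mu>0 powr ((\<alpha> + 1 - p) / p)
     * a0 powr ((\<alpha> + \<gamma>) / (p - 1 + \<gamma>))
     * (1 / L_norm G (p / (p - 1 + \<gamma>)) f) powr ((\<alpha> + 1 - p) / (p + \<gamma> - 1))"

end

theory Submission
  imports Defs "HOL-Complex_Analysis.Great_Picard"
begin

text \<open>
  Write \<open>A\<close>, \<open>B\<close> for the \<open>p\<close>-th and \<open>q\<close>-th powers of the two norms of \<open>u\<close>, and \<open>F\<close>, \<open>L\<close> for the
  integrals of \<open>f u\<^bsup>1-\<gamma>\<^esup>\<close> and \<open>\<lambda> g u\<^bsup>\<alpha>+1\<^esup>\<close>. Hoelder's inequality bounds \<open>F\<close> and \<open>L\<close> by powers of \<open>A\<close>, and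
  \<open>\<lambda> < \<Lambda>\<^sub>*\<close> says precisely that \<open>X\<^sub>0 < X(\<lambda>)\<close>. The bounds give \<open>A + B > F + L\<close> whenever the first norm lies in
  \<open>[X\<^sub>0, X(\<lambda>)]\<close>, so no Nehari point lies there, and along every ray the fibering map has at most one
  zero beyond \<open>X\<^sub>0\<close>, where it changes sign from plus to minus. The first solution minimises the energy over the ball
  of radius \<open>X\<^sub>0\<close>, the second one over the Nehari points outside of it. Minimisers exist since \<open>A\<close>, \<open>B\<close>
  are lower semicontinuous and \<open>F\<close>, \<open>L\<close> continuous under pointwise convergence of bounded sequences: these
  are bounded uniformly because \<open>\<mu> \<ge> \<mu>\<^sub>0\<close>, and \<open>f\<close>, \<open>g\<close> are integrable. One-sided variations, which allow for the
  singular term, show that both minimisers are positive and satisfy the weak inequality for non-negative test functions;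
  truncated test functions extend it to all test functions, hence to an equality.
\<close>

section \<open>Integration and gradients on a graph\<close>

text \<open>The two radii come from two forms of \<open>N\<close>:
  \<open>(p-1+\<gamma>) A + (q-1+\<gamma>) B - (\<alpha>+\<gamma>) L\<close> and, on the Nehari set,
  \<open>(\<alpha>+\<gamma>) F - (\<alpha>+1-p) A - (\<alpha>+1-q) B\<close>. At the radius
  \<open>X0\<close> the Hoelder bound of \<open>(\<alpha>+\<gamma>) F\<close> equals
  \<open>(\<alpha>+1-p) A\<close>; at \<open>X(\<lambda>)\<close> that of
  \<open>(\<alpha>+\<gamma>) L\<close> equals \<open>(p-1+\<gamma>) A\<close>. The two coefficients
  add up to \<open>\<alpha>+\<gamma>\<close>, so between the radii \<open>F + L \<le> A\<close>, and
  \<open>B > 0\<close> adds strictness. The obstacle is the singular term: its slope is infinite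
  where \<open>u = 0\<close>, so the energy cannot simply be differentiated on a constraint.
  \<open>one_sided_critical\<close> isolates what survives: for \<open>\<phi> \<ge> 0\<close> the
  energy does not drop from \<open>u\<close> to \<open>u + e \<phi>\<close> when both are scaled by
  the same factor \<open>t\<close>, with \<open>e\<close> tending to 0 and \<open>t\<close> to 1.
  For the second minimiser \<open>t\<close> projects the perturbed function back to the Nehari set.
  How \<open>t\<close> depends on \<open>e\<close> is irrelevant, because \<open>u\<close> has
  maximal energy on the outer part of its own ray.\<close>

lemma powr_add_le:
  fixes x y s :: real
  assumes "0 \<le> x" "0 \<le> y" "0 \<le> s"
  shows "(x + y) powr s \<le> 2 powr s * (x powr s + y powr s)"
proof -
  have "(x + y) powr s \<le> (2 * max x y) powr s"
    using assms by (intro powr_mono2) auto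
  also have "\<dots> = 2 powr s * max x y powr s"
    using assms by (simp add: powr_mult)
  also have "max x y powr s \<le> x powr s + y powr s"
    by (cases "x \<le> y") (auto simp: max_def)
  finally show ?thesis by simp
qed

text \<open>Mean value theorem; for \<open>s \<ge> 1\<close> the derivative of the power is
  monotone, so its value at the common upper bound \<open>z\<close> serves throughout.\<close>

lemma powr_diff_le:
  fixes x y z s :: real
  assumes "0 \<le> x" "0 \<le> y" "x \<le> z" "y \<le> z" "1 \<le> s"
  shows "\<bar>x powr s - y powr s\<bar> \<le> s * z powr (s - 1) * \<bar>x - y\<bar>"
proof -
  have main: "b powr s - a powr s \<le> s * z powr (s - 1) * (b - a)"
    if ab: "0 \<le> a" "a < b" "b \<le> z" for a b
  proof -
    have cont: "continuous_on {a..b} (\<lambda>x. x powr s)"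
      using assms(5) ab by (intro continuous_on_powr' continuous_intros) auto
    have der: "((\<lambda>x. x powr s) has_real_derivative s * x powr (s - 1)) (at x)" if "a < x" "x < b" for x
      using that ab by (auto intro!: derivative_eq_intros)
    obtain \<xi> where \<xi>: "a < \<xi>" "\<xi> < b" "b powr s - a powr s = (b - a) * (s * \<xi> powr (s - 1))"
    proof -
      have "\<exists>l \<xi>. a < \<xi> \<and> \<xi> < b \<and> DERIV (\<lambda>x. x powr s) \<xi> :> l \<and> b powr s - a powr s = (b - a) * l"
        by (rule MVT[OF ab(2) cont]) (use der in \<open>auto simp: real_differentiable_def\<close>)
      then obtain l \<xi> where "a < \<xi>" "\<xi> < b" "DERIV (\<lambda>x. x powr s) \<xi> :> l" "b powr s - a powr s = (b - a) * l"
        by blast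
      moreover from this have "l = s * \<xi> powr (s - 1)"
        using der DERIV_unique by blast
      ultimately show ?thesis using that by blast
    qed
    have "\<xi> powr (s - 1) \<le> z powr (s - 1)"
      using \<xi> ab assms(5) by (intro powr_mono2) auto
    hence "(b - a) * (s * \<xi> powr (s - 1)) \<le> (b - a) * (s * z powr (s - 1))"
      using \<xi> ab assms(5) by (intro mult_left_mono) auto
    thus ?thesis using \<xi>(3) by (simp add: mult_ac)
  qed
  show ?thesis
  proof (cases x y rule: linorder_cases)
    case less
    then have "x powr s \<le> y powr s" using assms by (intro powr_mono2) auto
    then show ?thesis using main[of x y] less assms by simp
  next
    case greater
    then have "y powr s \<le> x powr s" using assms by (intro powr_mono2) auto
    then show ?thesis using main[of y x] greater assms by simp
  qed auto
qed

text \<open>Young's inequality with wasteful constants: both factors are replaced by the larger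
  number, which is enough for deducing integrability.\<close>

lemma powr_mult_le:
  fixes x y s :: real
  assumes "0 \<le> x" "0 \<le> y" "1 \<le> s"
  shows "x powr (s - 1) * y \<le> x powr s + y powr s"
proof (cases "x = 0 \<or> y = 0")
  case False
  then have xy: "x > 0" "y > 0" using assms by auto
  have "x powr (s - 1) * y \<le> max x y powr (s - 1) * max x y powr 1"
    using xy assms by (intro mult_mono powr_mono2) auto
  also have "\<dots> = max x y powr s"
    by (subst powr_add[symmetric]) simp
  also have "\<dots> \<le> x powr s + y powr s"
    by (cases "x \<le> y") (auto simp: max_def)
  finally show ?thesis .
qed (auto simp: assms)

text \<open>Concavity: the graph of the power lies below its tangent at 1. Comparing powers of
  \<open>t\<close> through this line decides the sign of the fibering maps, and it absorbs
  \<open>F\<close> in the coercivity estimate.\<close>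

lemma powr_le_Bernoulli:
  fixes y r :: real
  assumes "0 < y" "0 \<le> r" "r \<le> 1"
  shows "y powr r \<le> 1 + r * (y - 1)"
  using Youngs_inequality_0[of r "1 - r" y 1] assms by (simp add: algebra_simps)

text \<open>Bridge to the Lebesgue integral over counting measure, from which dominated convergence
  is taken.\<close>

lemma infsum_eq_lebesgue_integral_count_space:
  fixes h :: "'a \<Rightarrow> real"
  assumes "h summable_on UNIV"
  shows "integrable (count_space UNIV) h"
    and "infsum h UNIV = integral\<^sup>L (count_space UNIV) h"
proof -
  have *: "Infinite_Set_Sum.abs_summable_on h UNIV"
    by (rule abs_summable_equivalent[THEN iffD1], rule summable_on_iff_abs_summable_on_real[THEN iffD1])
      (rule assms)
  show "integrable (count_space UNIV) h"
    using * by (simp add: abs_summable_on_def)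
  show "infsum h UNIV = integral\<^sup>L (count_space UNIV) h"
    using infsetsum_infsum[OF *] by (simp add: infsetsum_def)
qed

section \<open>Integration against the vertex measure\<close>

locale lf_graph =
  fixes G :: "'v wgraph"
  assumes graph: "weighted_graph G" and loc_fin: "locally_finite G"
begin

lemma vmeas_pos [simp]: "0 < vmeas G x" and vmeas_nonneg [simp]: "0 \<le> vmeas G x"
  using graph by (auto simp: weighted_graph_def less_imp_le)

lemma weight_pos: "y \<in> nbrs G x \<Longrightarrow> 0 < weight G x y"
  using graph by (auto simp: weighted_graph_def nbrs_def)

lemma finite_nbrs [simp]: "finite (nbrs G x)"
  using loc_fin by (auto simp: locally_finite_def)

lemma nbrs_sym: "y \<in> nbrs G x \<Longrightarrow> x \<in> nbrs G y"
  using graph by (auto simp: weighted_graph_def nbrs_def sym_def)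

lemma integrable_V_comparison:
  assumes "integrable_V G h" "\<And>x. \<bar>\<psi> x\<bar> \<le> h x"
  shows "integrable_V G \<psi>"
proof -
  have "(\<lambda>x. vmeas G x * h x) summable_on UNIV"
    using assms(1) by (simp add: integrable_V_def)
  then have "(\<lambda>x. norm (vmeas G x * \<psi> x)) summable_on UNIV"
    by (rule summable_on_comparison_test) (auto simp: abs_mult intro!: mult_left_mono assms(2))
  then show ?thesis
    by (simp add: integrable_V_def abs_summable_summable)
qed

lemma integrable_V_cmult: "integrable_V G \<psi> \<Longrightarrow> integrable_V G (\<lambda>x. k * \<psi> x)"
  unfolding integrable_V_def using summable_on_cmult_right[of "\<lambda>x. vmeas G x * \<psi> x" UNIV k]
  by (simp add: mult_ac)

lemma integrable_V_add:
  "integrable_V G \<psi> \<Longrightarrow> integrable_V G \<eta> \<Longrightarrow> integrable_V G (\<lambda>x. \<psi> x + \<eta> x)"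
  unfolding integrable_V_def by (simp add: distrib_left summable_on_add)

lemma integrable_V_diff:
  "integrable_V G \<psi> \<Longrightarrow> integrable_V G \<eta> \<Longrightarrow> integrable_V G (\<lambda>x. \<psi> x - \<eta> x)"
  using integrable_V_add[of \<psi> "\<lambda>x. - 1 * \<eta> x"] integrable_V_cmult[of \<eta> "-1"] by simp

lemma integrable_V_finite_support:
  assumes "finite S" "\<And>x. x \<notin> S \<Longrightarrow> \<psi> x = 0"
  shows "integrable_V G \<psi>"
  unfolding integrable_V_def
  by (rule finite_nonzero_values_imp_summable_on, rule finite_subset[OF _ assms(1)])
    (use assms(2) in auto)

lemma integral_V_cmult: "integral_V G (\<lambda>x. k * \<psi> x) = k * integral_V G \<psi>"
  unfolding integral_V_def by (subst infsum_cmult_right'[symmetric]) (simp add: mult_ac)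

lemma integral_V_add:
  "integrable_V G \<psi> \<Longrightarrow> integrable_V G \<eta> \<Longrightarrow>
    integral_V G (\<lambda>x. \<psi> x + \<eta> x) = integral_V G \<psi> + integral_V G \<eta>"
  unfolding integrable_V_def integral_V_def by (simp add: distrib_left infsum_add)

lemma integral_V_diff:
  "integrable_V G \<psi> \<Longrightarrow> integrable_V G \<eta> \<Longrightarrow>
    integral_V G (\<lambda>x. \<psi> x - \<eta> x) = integral_V G \<psi> - integral_V G \<eta>"
  using integral_V_add[of \<psi> "\<lambda>x. - 1 * \<eta> x"] integrable_V_cmult[of \<eta> "-1"]
    integral_V_cmult[of "-1" \<eta>] by simp

lemma integral_V_mono:
  "integrable_V G \<psi> \<Longrightarrow> integrable_V G \<eta> \<Longrightarrow> (\<And>x. \<psi> x \<le> \<eta> x) \<Longrightarrow> integral_V G \<psi> \<le> integral_V G \<eta>"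
  unfolding integrable_V_def integral_V_def by (rule infsum_mono) (auto intro: mult_left_mono)

lemma integral_V_nonneg: "(\<And>x. 0 \<le> \<psi> x) \<Longrightarrow> 0 \<le> integral_V G \<psi>"
  unfolding integral_V_def by (rule infsum_nonneg) simp

lemma integral_V_ge_point:
  assumes "integrable_V G \<psi>" "\<And>x. 0 \<le> \<psi> x"
  shows "vmeas G x * \<psi> x \<le> integral_V G \<psi>"
  unfolding integral_V_def
  using finite_sum_le_infsum[of "\<lambda>x. vmeas G x * \<psi> x" UNIV "{x}"] assms
  by (simp add: integrable_V_def)

lemma integral_V_pos:
  assumes "integrable_V G \<psi>" "\<And>x. 0 \<le> \<psi> x" "0 < \<psi> z"
  shows "0 < integral_V G \<psi>"
  using integral_V_ge_point[OF assms(1,2), of z] assms(3) vmeas_pos[of z]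
  by (smt (verit) mult_pos_pos)

text \<open>On a discrete space it suffices to look at finite partial sums, where the limit can be
  taken termwise. The bounds \<open>M n\<close> replace the lower limit, so the integrals themselves
  need not converge.\<close>

lemma integral_V_Fatou:
  fixes \<psi> :: "nat \<Rightarrow> 'v \<Rightarrow> real"
  assumes nn: "\<And>n x. 0 \<le> \<psi> n x" and int: "\<And>n. integrable_V G (\<psi> n)"
    and lim: "\<And>x. (\<lambda>n. \<psi> n x) \<longlonglongrightarrow> \<eta> x"
    and le: "\<And>n. integral_V G (\<psi> n) \<le> M n" and M: "M \<longlonglongrightarrow> m"
  shows "integrable_V G \<eta>" and "integral_V G \<eta> \<le> m"
proof -
  have fin: "(\<Sum>x\<in>S. vmeas G x * \<eta> x) \<le> m" if "finite S" for S
  proof (rule LIMSEQ_le[OF _ M])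
    show "(\<lambda>n. \<Sum>x\<in>S. vmeas G x * \<psi> n x) \<longlonglongrightarrow> (\<Sum>x\<in>S. vmeas G x * \<eta> x)"
      by (intro tendsto_intros lim)
    have "(\<Sum>x\<in>S. vmeas G x * \<psi> n x) \<le> M n" for n
      using finite_sum_le_infsum[of "\<lambda>x. vmeas G x * \<psi> n x" UNIV S] int[of n] nn le[of n] that
      by (simp add: integrable_V_def integral_V_def)
    then show "\<exists>N. \<forall>n\<ge>N. (\<Sum>x\<in>S. vmeas G x * \<psi> n x) \<le> M n" by blast
  qed
  have "0 \<le> \<eta> x" for x
    using LIMSEQ_le_const[OF lim[of x], of 0] nn by blast
  then show int': "integrable_V G \<eta>"
    unfolding integrable_V_def
    by (intro nonneg_bdd_above_summable_on) (auto intro!: bdd_aboveI2[of _ _ m] fin)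
  show "integral_V G \<eta> \<le> m"
    unfolding integral_V_def
    by (rule infsum_le_finite_sums) (use int' fin in \<open>auto simp: integrable_V_def\<close>)
qed

lemma integral_V_dominated:
  fixes \<psi> :: "nat \<Rightarrow> 'v \<Rightarrow> real"
  assumes dom: "\<And>n x. \<bar>\<psi> n x\<bar> \<le> h x" and h: "integrable_V G h"
    and lim: "\<And>x. (\<lambda>n. \<psi> n x) \<longlonglongrightarrow> \<eta> x"
  shows "integrable_V G \<eta>" and "(\<lambda>n. integral_V G (\<psi> n)) \<longlonglongrightarrow> integral_V G \<eta>"
proof -
  have int: "integrable_V G (\<psi> n)" for n
    by (rule integrable_V_comparison[OF h dom])
  have "\<bar>\<eta> x\<bar> \<le> h x" for x
    using LIMSEQ_le_const2[OF tendsto_rabs[OF lim[of x]], of "h x"] dom by blast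
  then show int': "integrable_V G \<eta>"
    by (rule integrable_V_comparison[OF h])
  have "(\<lambda>n. integral\<^sup>L (count_space UNIV) (\<lambda>x. vmeas G x * \<psi> n x))
     \<longlonglongrightarrow> integral\<^sup>L (count_space UNIV) (\<lambda>x. vmeas G x * \<eta> x)"
    by (rule integral_dominated_convergence[where w="\<lambda>x. vmeas G x * h x"])
      (use h dom lim in \<open>auto simp: integrable_V_def abs_mult
         intro!: infsum_eq_lebesgue_integral_count_space AE_I2 tendsto_intros mult_left_mono\<close>)
  then show "(\<lambda>n. integral_V G (\<psi> n)) \<longlonglongrightarrow> integral_V G \<eta>"
    using int int' by (simp add: integral_V_def integrable_V_def infsum_eq_lebesgue_integral_count_space(2))
qed

section \<open>The gradient form as a local Euclidean product\<close>

lemma gradient_form_nonneg: "0 \<le> gradient_form G u u x"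
proof -
  have "0 \<le> weight G x y * (u y - u x) * (u y - u x)" if "y \<in> nbrs G x" for y
    unfolding mult.assoc using weight_pos[OF that] by (intro mult_nonneg_nonneg zero_le_square) simp
  then show ?thesis
    unfolding gradient_form_def by (intro mult_nonneg_nonneg[OF _ sum_nonneg]) auto
qed

lemma grad_norm_nonneg [simp]: "0 \<le> grad_norm G u x"
  by (simp add: grad_norm_def gradient_form_nonneg)

lemma grad_norm_square: "(grad_norm G u x)\<^sup>2 = gradient_form G u u x"
  by (simp add: grad_norm_def gradient_form_nonneg)

lemma grad_norm_powr: "grad_norm G u x powr s = gradient_form G u u x powr (s / 2)"
  using gradient_form_nonneg[of u x] by (simp add: grad_norm_def powr_half_sqrt[symmetric] powr_powr)

text \<open>Square root of the normalised weight: with it \<open>grad_norm\<close> is the Euclidean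
  length of the rescaled increments, and the triangle and Cauchy-Schwarz inequalities are those of
  \<open>L2_set\<close>.\<close>

definition edge_coeff :: "'v \<Rightarrow> 'v \<Rightarrow> real" where
  "edge_coeff x y = sqrt (weight G x y / (2 * vmeas G x))"

lemma edge_coeff_mult:
  "y \<in> nbrs G x \<Longrightarrow> edge_coeff x y * edge_coeff x y = weight G x y / (2 * vmeas G x)"
  unfolding edge_coeff_def
  by (rule real_sqrt_mult_self[THEN trans]) (simp add: weight_pos less_imp_le)

lemma gradient_form_edge_coeff:
  "gradient_form G u v x = (\<Sum>y\<in>nbrs G x. (edge_coeff x y * (u y - u x)) * (edge_coeff x y * (v y - v x)))"
proof -
  have "(\<Sum>y\<in>nbrs G x. (edge_coeff x y * (u y - u x)) * (edge_coeff x y * (v y - v x)))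
      = (\<Sum>y\<in>nbrs G x. (edge_coeff x y * edge_coeff x y) * ((u y - u x) * (v y - v x)))"
    by (simp add: mult_ac)
  also have "\<dots> = (\<Sum>y\<in>nbrs G x. weight G x y / (2 * vmeas G x) * ((u y - u x) * (v y - v x)))"
    by (intro sum.cong refl) (simp add: edge_coeff_mult)
  finally show ?thesis
    by (simp add: gradient_form_def sum_distrib_left mult.assoc)
qed

lemma grad_norm_L2_set:
  "grad_norm G u x = L2_set (\<lambda>y. edge_coeff x y * (u y - u x)) (nbrs G x)"
  by (simp add: grad_norm_def gradient_form_edge_coeff L2_set_def power2_eq_square)

lemma edge_coeff_nonneg: "y \<in> nbrs G x \<Longrightarrow> 0 \<le> edge_coeff x y"
  by (simp add: edge_coeff_def weight_pos less_imp_le)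

text \<open>Stated for dominated increments rather than for sums, so that absolute values and
  truncations are covered too.\<close>

lemma grad_norm_le_add:
  assumes "\<And>y. y \<in> nbrs G x \<Longrightarrow> \<bar>w y - w x\<bar> \<le> \<bar>u y - u x\<bar> + \<bar>v y - v x\<bar>"
  shows "grad_norm G w x \<le> grad_norm G u x + grad_norm G v x"
proof -
  let ?d = "\<lambda>u y. edge_coeff x y * (u y - u x)"
  have "grad_norm G w x = L2_set (\<lambda>y. \<bar>?d w y\<bar>) (nbrs G x)"
    by (simp add: grad_norm_L2_set L2_set_def)
  also have "\<dots> \<le> L2_set (\<lambda>y. \<bar>?d u y\<bar> + \<bar>?d v y\<bar>) (nbrs G x)"
    by (rule L2_set_mono)
      (auto simp: abs_mult edge_coeff_nonneg simp flip: distrib_left intro!: mult_left_mono assms)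
  also have "\<dots> \<le> L2_set (\<lambda>y. \<bar>?d u y\<bar>) (nbrs G x) + L2_set (\<lambda>y. \<bar>?d v y\<bar>) (nbrs G x)"
    by (rule L2_set_triangle_ineq)
  also have "\<dots> = grad_norm G u x + grad_norm G v x"
    by (simp add: grad_norm_L2_set L2_set_def)
  finally show ?thesis .
qed

lemma grad_norm_add: "grad_norm G (\<lambda>x. u x + v x) x \<le> grad_norm G u x + grad_norm G v x"
  by (rule grad_norm_le_add) auto

lemma gradient_form_cmult_left: "gradient_form G (\<lambda>x. k * u x) v x = k * gradient_form G u v x"
  by (simp add: gradient_form_def sum_distrib_left algebra_simps)

lemma gradient_form_cmult_right: "gradient_form G u (\<lambda>x. k * v x) x = k * gradient_form G u v x"
  by (simp add: gradient_form_def sum_distrib_left algebra_simps)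

lemma gradient_form_add_left:
  "gradient_form G (\<lambda>x. u x + w x) v x = gradient_form G u v x + gradient_form G w v x"
  unfolding gradient_form_def by (simp add: algebra_simps sum.distrib sum_subtractf)

lemma gradient_form_add_right:
  "gradient_form G u (\<lambda>x. v x + w x) x = gradient_form G u v x + gradient_form G u w x"
  unfolding gradient_form_def by (simp add: algebra_simps sum.distrib sum_subtractf)

lemma gradient_form_commute: "gradient_form G u v x = gradient_form G v u x"
  by (simp add: gradient_form_def mult_ac)

lemma grad_norm_cmult: "grad_norm G (\<lambda>x. k * u x) x = \<bar>k\<bar> * grad_norm G u x"
  unfolding grad_norm_def gradient_form_cmult_left gradient_form_cmult_right
  by (simp add: real_sqrt_mult flip: mult.assoc)

text \<open>The absolute values inside the sum matter: increments of truncated test functions are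
  controlled edge by edge, and only from one side.\<close>

lemma gradient_form_Cauchy_Schwarz_abs:
  "(\<Sum>y\<in>nbrs G x. \<bar>edge_coeff x y * (u y - u x)\<bar> * \<bar>edge_coeff x y * (v y - v x)\<bar>)
    \<le> grad_norm G u x * grad_norm G v x"
  using L2_set_mult_ineq[of "\<lambda>y. edge_coeff x y * (u y - u x)" "\<lambda>y. edge_coeff x y * (v y - v x)" "nbrs G x"]
  by (simp add: grad_norm_L2_set)

lemma gradient_form_Cauchy_Schwarz:
  "\<bar>gradient_form G u v x\<bar> \<le> grad_norm G u x * grad_norm G v x"
proof -
  have "\<bar>gradient_form G u v x\<bar>
      \<le> (\<Sum>y\<in>nbrs G x. \<bar>edge_coeff x y * (u y - u x)\<bar> * \<bar>edge_coeff x y * (v y - v x)\<bar>)"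
    unfolding gradient_form_edge_coeff abs_mult[symmetric] by (rule sum_abs)
  then show ?thesis
    using gradient_form_Cauchy_Schwarz_abs[of x u v] by linarith
qed

lemma tendsto_gradient_form:
  assumes "\<And>x. ((\<lambda>n. u n x) \<longlongrightarrow> u' x) F" "\<And>x. ((\<lambda>n. v n x) \<longlongrightarrow> v' x) F"
  shows "((\<lambda>n. gradient_form G (u n) (v n) x) \<longlongrightarrow> gradient_form G u' v' x) F"
  unfolding gradient_form_def by (intro tendsto_intros assms)

lemma tendsto_grad_norm:
  assumes "\<And>x. ((\<lambda>n. u n x) \<longlongrightarrow> u' x) F"
  shows "((\<lambda>n. grad_norm G (u n) x) \<longlongrightarrow> grad_norm G u' x) F"
  unfolding grad_norm_def by (intro tendsto_intros tendsto_gradient_form assms)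

end

section \<open>The weighted spaces\<close>

lemma DERIV_difference_quotient_seq:
  fixes h :: "real \<Rightarrow> real"
  assumes "(h has_real_derivative D) (at 0)" "e \<longlonglongrightarrow> 0" "\<And>n. 0 < e n"
  shows "(\<lambda>n. (h (e n) - h 0) / e n) \<longlonglongrightarrow> D"
proof -
  have "((\<lambda>t. (h t - h 0) / t) \<longlongrightarrow> D) (at 0)"
    using assms(1) by (simp add: has_field_derivative_iff)
  moreover have "filterlim e (at 0) sequentially"
    using assms(2,3) by (intro filterlim_atI) (auto simp: less_imp_neq[symmetric])
  ultimately show ?thesis by (rule filterlim_compose)
qed

text \<open>Since \<open>s > 1\<close>, a factor \<open>e powr (s - 1)\<close> remains and tends to
  0. This treats points where the base vanishes and the chain rule for \<open>powr\<close> does not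
  apply.\<close>

lemma powr_mult_quotient_tendsto:
  fixes s z :: real
  assumes "1 < s" "e \<longlonglongrightarrow> 0" "\<And>n. 0 < e n" "0 \<le> z"
  shows "(\<lambda>n. (e n * z) powr s / e n) \<longlonglongrightarrow> 0"
proof -
  have "(\<lambda>n. e n powr (s - 1) * z powr s) \<longlonglongrightarrow> 0 powr (s - 1) * z powr s"
    using assms by (intro tendsto_intros tendsto_powr') (auto simp: less_imp_le)
  moreover have "(e n * z) powr s / e n = e n powr (s - 1) * z powr s" for n
    using assms(3)[of n] assms(4) by (simp add: powr_mult powr_diff)
  ultimately show ?thesis by simp
qed

lemma powr_difference_quotient_tendsto:
  fixes x y s :: real
  assumes s: "1 < s" and e: "e \<longlonglongrightarrow> 0" "\<And>n. 0 < e n" and nn: "0 \<le> x" "0 \<le> y"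
  shows "(\<lambda>n. ((x + e n * y) powr s - x powr s) / e n) \<longlonglongrightarrow> s * (x powr (s - 1) * y)"
proof (cases "x = 0")
  case True
  \<comment> \<open>The claimed limit is 0 here, because \<open>0 powr (s - 1) = 0\<close>.\<close>
  then show ?thesis using powr_mult_quotient_tendsto[OF s e nn(2)] by simp
next
  case False
  then have "((\<lambda>t. (x + t * y) powr s) has_real_derivative
      (s * (x + 0 * y) powr (s - 1) * y)) (at 0)"
    using nn by (auto intro!: derivative_eq_intros)
  from DERIV_difference_quotient_seq[OF this e] show ?thesis
    by (simp add: mult_ac)
qed

text \<open>The majorant does not depend on \<open>e\<close>, as dominated convergence requires. It
  is the mean value bound on the interval up to \<open>y + z\<close>, which contains
  \<open>x\<close> because \<open>e \<le> 1\<close>.\<close>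

lemma powr_difference_quotient_bound:
  fixes x y z e s :: real
  assumes "0 \<le> x" "0 \<le> y" "0 \<le> z" "\<bar>x - y\<bar> \<le> e * z" "0 < e" "e \<le> 1" "1 \<le> s"
  shows "\<bar>(x powr s - y powr s) / e\<bar> \<le> s * 2 powr s * (y powr s + z powr s)"
proof -
  have ez: "e * z \<le> z" using assms by (simp add: mult_left_le_one_le)
  have "\<bar>x powr s - y powr s\<bar> \<le> s * (y + z) powr (s - 1) * \<bar>x - y\<bar>"
    using assms ez by (intro powr_diff_le) auto
  also have "\<dots> \<le> s * (y + z) powr (s - 1) * (e * (y + z))"
    using assms by (intro mult_left_mono) (auto simp: distrib_left intro: order_trans)
  also have "\<dots> = e * (s * ((y + z) powr (s - 1) * (y + z) powr 1))"
    using assms by (simp add: mult_ac)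
  also have "(y + z) powr (s - 1) * (y + z) powr 1 = (y + z) powr s"
    by (subst powr_add[symmetric]) simp
  finally have "\<bar>x powr s - y powr s\<bar> / e \<le> s * (y + z) powr s"
    using assms(5) by (simp add: divide_le_eq mult_ac)
  also have "\<dots> \<le> s * (2 powr s * (y powr s + z powr s))"
    using assms by (intro mult_left_mono powr_add_le) auto
  finally show ?thesis using assms(5) by (simp add: mult.assoc)
qed

text \<open>
  \<open>cutoff u \<phi> k + k u\<close> is a non-negative test function and \<open>cutoff u \<phi> k\<close> stabilises at \<open>\<phi>\<close>
  pointwise. Its increments lie between those of \<open>\<phi>\<close> and of \<open>- k u\<close>, so
  \<open>\<Gamma>(u, cutoff u \<phi> k) \<le> \<bar>\<nabla>u\<bar> \<bar>\<nabla>\<phi>\<bar>\<close> uniformly in \<open>k\<close>, although there is no such lower bound.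
\<close>

definition cutoff :: "('v \<Rightarrow> real) \<Rightarrow> ('v \<Rightarrow> real) \<Rightarrow> nat \<Rightarrow> 'v \<Rightarrow> real" where
  "cutoff u \<phi> k x = max (\<phi> x) (- (real k * u x))"

lemma abs_cutoff_le:
  assumes "0 \<le> u x"
  shows "\<bar>cutoff u \<phi> k x\<bar> \<le> \<bar>\<phi> x\<bar>"
proof -
  have "0 \<le> real k * u x" using assms by simp
  then show ?thesis by (auto simp: cutoff_def max_def abs_if)
qed

text \<open>To be used twice, with \<open>p\<close>, \<open>a\<close> and with \<open>q\<close>,
  \<open>b\<close>.\<close>

locale weighted_sobolev = lf_graph G for G :: "'v wgraph" +
  fixes s :: real and c :: "'v \<Rightarrow> real" and c0 :: real
  assumes s_gt_1: "1 < s" and c0_pos: "0 < c0" and c_ge: "\<And>x. c0 \<le> c x"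
begin

definition dens :: "('v \<Rightarrow> real) \<Rightarrow> 'v \<Rightarrow> real" where
  "dens u x = grad_norm G u x powr s + c x * \<bar>u x\<bar> powr s"

text \<open>The \<open>s\<close>-th power of the weighted norm, preferred to the norm because its
  density can be differentiated pointwise.\<close>

definition En :: "('v \<Rightarrow> real) \<Rightarrow> real" where
  "En u = integral_V G (dens u)"

lemma c_pos [simp]: "0 < c x" and c_nonneg [simp]: "0 \<le> c x"
  using c0_pos c_ge[of x] by linarith+

lemma dens_nonneg [simp]: "0 \<le> dens u x"
  by (simp add: dens_def)

lemma powr_le_dens: "c x * \<bar>u x\<bar> powr s \<le> dens u x"
  by (simp add: dens_def)

text \<open>The unweighted part of the condition comes for free, as
  \<open>c \<ge> c0 > 0\<close>.\<close>

lemma W1_weighted_iff: "u \<in> W1_weighted G s c \<longleftrightarrow> integrable_V G (dens u)"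
proof
  assume "u \<in> W1_weighted G s c"
  then have 1: "integrable_V G (\<lambda>x. grad_norm G u x powr s + \<bar>u x\<bar> powr s)"
    and 2: "integrable_V G (\<lambda>x. c x * \<bar>u x\<bar> powr s)"
    by (auto simp: W1_weighted_def W1_def)
  show "integrable_V G (dens u)"
    by (rule integrable_V_comparison[OF integrable_V_add[OF 1 2]]) (simp add: dens_def)
next
  assume i: "integrable_V G (dens u)"
  have 2: "integrable_V G (\<lambda>x. c x * \<bar>u x\<bar> powr s)"
    by (rule integrable_V_comparison[OF i]) (simp add: dens_def)
  have 1: "integrable_V G (\<lambda>x. grad_norm G u x powr s)"
    by (rule integrable_V_comparison[OF i]) (simp add: dens_def)
  have "\<bar>\<bar>u x\<bar> powr s\<bar> \<le> 1 / c0 * (c x * \<bar>u x\<bar> powr s)" for x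
    using mult_right_mono[OF c_ge[of x], of "\<bar>u x\<bar> powr s"] c0_pos
    by (simp add: pos_le_divide_eq mult_ac)
  then have "integrable_V G (\<lambda>x. \<bar>u x\<bar> powr s)"
    by (rule integrable_V_comparison[OF integrable_V_cmult[OF 2]])
  then show "u \<in> W1_weighted G s c"
    using 1 2 by (auto simp: W1_weighted_def W1_def intro: integrable_V_add)
qed

lemma En_nonneg [simp]: "0 \<le> En u"
  by (simp add: En_def integral_V_nonneg)

lemma W1_norm_eq: "W1_norm G s c u = En u powr (1 / s)"
  by (simp add: W1_norm_def En_def dens_def[abs_def])

lemma W1_norm_powr: "W1_norm G s c u powr s = En u"
  using s_gt_1 by (simp add: W1_norm_eq powr_powr)

text \<open>One criterion for sums, absolute values and truncations alike: values and increments are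
  dominated.\<close>

lemma W1_weighted_dominated:
  assumes "u \<in> W1_weighted G s c" "v \<in> W1_weighted G s c"
    and 1: "\<And>x. \<bar>w x\<bar> \<le> \<bar>u x\<bar> + \<bar>v x\<bar>"
    and 2: "\<And>x y. y \<in> nbrs G x \<Longrightarrow> \<bar>w y - w x\<bar> \<le> \<bar>u y - u x\<bar> + \<bar>v y - v x\<bar>"
  shows "w \<in> W1_weighted G s c"
proof -
  have "\<bar>dens w x\<bar> \<le> 2 powr s * (dens u x + dens v x)" for x
  proof -
    have "grad_norm G w x powr s \<le> (grad_norm G u x + grad_norm G v x) powr s"
      using s_gt_1 by (intro powr_mono2 grad_norm_le_add 2) auto
    also have "\<dots> \<le> 2 powr s * (grad_norm G u x powr s + grad_norm G v x powr s)"
      using s_gt_1 by (intro powr_add_le) auto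
    finally have a: "grad_norm G w x powr s \<le> 2 powr s * (grad_norm G u x powr s + grad_norm G v x powr s)" .
    have "\<bar>w x\<bar> powr s \<le> (\<bar>u x\<bar> + \<bar>v x\<bar>) powr s"
      using s_gt_1 by (intro powr_mono2 1) auto
    also have "\<dots> \<le> 2 powr s * (\<bar>u x\<bar> powr s + \<bar>v x\<bar> powr s)"
      using s_gt_1 by (intro powr_add_le) auto
    finally have "c x * \<bar>w x\<bar> powr s \<le> c x * (2 powr s * (\<bar>u x\<bar> powr s + \<bar>v x\<bar> powr s))"
      by (intro mult_left_mono) auto
    with a show ?thesis
      by (simp add: dens_def algebra_simps)
  qed
  moreover have "integrable_V G (\<lambda>x. 2 powr s * (dens u x + dens v x))"
    using assms(1,2) unfolding W1_weighted_iff by (intro integrable_V_cmult integrable_V_add)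
  ultimately show ?thesis
    unfolding W1_weighted_iff by (blast intro: integrable_V_comparison)
qed

lemma W1_weighted_add:
  "u \<in> W1_weighted G s c \<Longrightarrow> v \<in> W1_weighted G s c \<Longrightarrow> (\<lambda>x. u x + v x) \<in> W1_weighted G s c"
  by (rule W1_weighted_dominated[of u v]) auto

lemma dens_cmult: "dens (\<lambda>x. k * u x) x = \<bar>k\<bar> powr s * dens u x"
  by (simp add: dens_def grad_norm_cmult powr_mult abs_mult algebra_simps)

lemma En_cmult: "En (\<lambda>x. k * u x) = \<bar>k\<bar> powr s * En u"
  unfolding En_def by (subst integral_V_cmult[symmetric]) (simp add: dens_cmult[abs_def])

lemma W1_weighted_cmult:
  "u \<in> W1_weighted G s c \<Longrightarrow> (\<lambda>x. k * u x) \<in> W1_weighted G s c"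
  unfolding W1_weighted_iff using integrable_V_cmult[of "dens u" "\<bar>k\<bar> powr s"]
  by (simp add: dens_cmult[abs_def])

text \<open>By symmetry of the edges the gradient of a point mass lives on \<open>z\<close> and its
  neighbours, a finite set.\<close>

lemma indicator_in_W1_weighted: "(\<lambda>x. of_bool (x = z)) \<in> W1_weighted G s c"
  unfolding W1_weighted_iff
proof (rule integrable_V_finite_support)
  show "finite (insert z (nbrs G z))" by simp
  fix x assume x: "x \<notin> insert z (nbrs G z)"
  then have "y \<noteq> z" if "y \<in> nbrs G x" for y
    using nbrs_sym[OF that] by auto
  then have "grad_norm G (\<lambda>x. of_bool (x = z)) x = 0"
    using x by (simp add: grad_norm_def gradient_form_def)
  then show "dens (\<lambda>x. of_bool (x = z)) x = 0"
    using x by (simp add: dens_def)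
qed

lemma powr_le_En:
  assumes "u \<in> W1_weighted G s c"
  shows "vmeas G x * (c0 * \<bar>u x\<bar> powr s) \<le> En u"
proof -
  have "vmeas G x * (c0 * \<bar>u x\<bar> powr s) \<le> vmeas G x * dens u x"
    using powr_le_dens[of x u] mult_right_mono[OF c_ge[of x], of "\<bar>u x\<bar> powr s"]
    by (intro mult_left_mono) auto
  also have "\<dots> \<le> En u"
    unfolding En_def using assms by (intro integral_V_ge_point) (auto simp: W1_weighted_iff)
  finally show ?thesis .
qed

lemma En_pos:
  assumes "u \<in> W1_weighted G s c" "u x \<noteq> 0"
  shows "0 < En u"
proof -
  have "0 < vmeas G x * (c0 * \<bar>u x\<bar> powr s)"
    using assms(2) c0_pos by simp
  then show ?thesis using powr_le_En[OF assms(1), of x] by linarith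
qed

text \<open>The gradient at a vertex is a finite sum, so the densities converge pointwise and Fatou
  applies. Energy may be lost in the limit, hence only an inequality.\<close>

lemma W1_weighted_Fatou:
  assumes u: "\<And>n. u n \<in> W1_weighted G s c" and lim: "\<And>x. (\<lambda>n. u n x) \<longlonglongrightarrow> v x"
    and E: "(\<lambda>n. En (u n)) \<longlonglongrightarrow> m"
  shows "v \<in> W1_weighted G s c" and "En v \<le> m"
proof -
  have l: "(\<lambda>n. dens (u n) x) \<longlonglongrightarrow> dens v x" for x
    unfolding dens_def using s_gt_1
    by (intro tendsto_intros tendsto_powr' tendsto_grad_norm lim) auto
  have i: "integrable_V G (dens (u n))" for n
    using u by (simp add: W1_weighted_iff)
  note * = integral_V_Fatou[OF _ i l _ E]
  show "v \<in> W1_weighted G s c"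
    unfolding W1_weighted_iff by (rule *(1)) (auto simp: En_def)
  show "En v \<le> m"
    unfolding En_def by (rule *(2)) (auto simp: En_def)
qed

text \<open>The product of the gradient norms is kept unsimplified, so that Cauchy-Schwarz can be
  multiplied by the power with exponent \<open>s - 2\<close> directly. The same function bounds the
  weak integrands of all truncations from above.\<close>

definition weak_bound :: "('v \<Rightarrow> real) \<Rightarrow> ('v \<Rightarrow> real) \<Rightarrow> 'v \<Rightarrow> real" where
  "weak_bound u \<phi> x = grad_norm G u x powr (s - 2) * (grad_norm G u x * grad_norm G \<phi> x)
     + c x * \<bar>u x\<bar> powr (s - 1) * \<bar>\<phi> x\<bar>"

lemma weak_bound_le: "weak_bound u \<phi> x \<le> dens u x + dens \<phi> x"
proof -
  have "grad_norm G u x powr (s - 2) * (grad_norm G u x * grad_norm G \<phi> x)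
      = grad_norm G u x powr (s - 1) * grad_norm G \<phi> x"
  proof (cases "grad_norm G u x = 0")
    case False
    then have "grad_norm G u x powr (s - 1) = grad_norm G u x powr (s - 2) * grad_norm G u x"
      using powr_add[of "grad_norm G u x" "s - 2" 1] grad_norm_nonneg[of u x] by (simp del: grad_norm_nonneg)
    then show ?thesis by simp
  qed simp
  also have "\<dots> \<le> grad_norm G u x powr s + grad_norm G \<phi> x powr s"
    using s_gt_1 by (intro powr_mult_le) auto
  finally have 1: "grad_norm G u x powr (s - 2) * (grad_norm G u x * grad_norm G \<phi> x)
      \<le> grad_norm G u x powr s + grad_norm G \<phi> x powr s" .
  have "c x * (\<bar>u x\<bar> powr (s - 1) * \<bar>\<phi> x\<bar>) \<le> c x * (\<bar>u x\<bar> powr s + \<bar>\<phi> x\<bar> powr s)"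
    using s_gt_1 by (intro mult_left_mono powr_mult_le) auto
  with 1 show ?thesis by (simp add: weak_bound_def dens_def algebra_simps)
qed

lemma weak_bound_nonneg: "0 \<le> weak_bound u \<phi> x"
  by (simp add: weak_bound_def)

lemma integrable_weak_bound:
  "u \<in> W1_weighted G s c \<Longrightarrow> \<phi> \<in> W1_weighted G s c \<Longrightarrow> integrable_V G (weak_bound u \<phi>)"
  by (rule integrable_V_comparison[OF integrable_V_add[of "dens u" "dens \<phi>"]])
    (auto simp: W1_weighted_iff weak_bound_nonneg weak_bound_le)

lemma weak_integrand_le_bound:
  assumes "0 \<le> u x"
  shows "\<bar>weak_integrand G s c u \<phi> x\<bar> \<le> weak_bound u \<phi> x"
  unfolding weak_integrand_def weak_bound_def
  using assms mult_left_mono[OF gradient_form_Cauchy_Schwarz[of u \<phi> x], of "grad_norm G u x powr (s - 2)"]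
  by (intro order_trans[OF abs_triangle_ineq] add_mono) (auto simp: abs_mult)

lemma integrable_weak_integrand:
  assumes "u \<in> W1_weighted G s c" "\<phi> \<in> W1_weighted G s c" "\<And>x. 0 \<le> u x"
  shows "integrable_V G (weak_integrand G s c u \<phi>)"
  by (rule integrable_V_comparison[OF integrable_weak_bound[OF assms(1,2)]])
    (simp add: weak_integrand_le_bound assms)

lemma weak_integrand_self:
  assumes "0 \<le> u x"
  shows "weak_integrand G s c u u x = dens u x"
proof -
  have 1: "grad_norm G u x powr (s - 2) * gradient_form G u u x = grad_norm G u x powr s"
  proof (cases "grad_norm G u x = 0")
    case False
    then have "grad_norm G u x powr s = grad_norm G u x powr (s - 2) * grad_norm G u x powr 2"
      by (subst powr_add[symmetric]) simp
    also have "grad_norm G u x powr 2 = gradient_form G u u x"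
      by (subst grad_norm_square[symmetric], subst powr_numeral) auto
    finally show ?thesis by simp
  qed simp
  have "u x powr (s - 1) * u x = u x powr s"
    using assms powr_mult_base[of "u x" "s - 1"] by (simp add: mult.commute)
  then show ?thesis using 1 assms by (simp add: weak_integrand_def dens_def mult.assoc)
qed

lemma integral_weak_integrand_self:
  "(\<And>x. 0 \<le> u x) \<Longrightarrow> integral_V G (weak_integrand G s c u u) = En u"
  unfolding En_def by (metis (no_types, lifting) ext weak_integrand_self)

section \<open>First variation of the energy\<close>

lemma gradient_form_perturb:
  "gradient_form G (\<lambda>x. u x + t * \<phi> x) (\<lambda>x. u x + t * \<phi> x) x
     = gradient_form G u u x + 2 * t * gradient_form G u \<phi> x + t * t * gradient_form G \<phi> \<phi> x"
  unfolding gradient_form_add_left gradient_form_add_right gradient_form_cmult_left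
    gradient_form_cmult_right
  by (simp add: gradient_form_commute[of \<phi> u] algebra_simps)

lemma grad_norm_perturb: "\<bar>grad_norm G (\<lambda>x. u x + t * \<phi> x) x - grad_norm G u x\<bar> \<le> \<bar>t\<bar> * grad_norm G \<phi> x"
proof -
  have "grad_norm G (\<lambda>x. u x + t * \<phi> x) x \<le> grad_norm G u x + grad_norm G (\<lambda>x. t * \<phi> x) x"
    by (rule grad_norm_add)
  moreover have "grad_norm G u x \<le> grad_norm G (\<lambda>x. u x + t * \<phi> x) x + grad_norm G (\<lambda>x. t * \<phi> x) x"
    by (rule grad_norm_le_add) auto
  ultimately show ?thesis by (simp add: grad_norm_cmult)
qed

lemma dens_difference_quotient_bound:
  assumes "0 < e" "e \<le> 1"
  shows "\<bar>(dens (\<lambda>x. u x + e * \<phi> x) x - dens u x) / e\<bar> \<le> s * 2 powr s * (dens u x + dens \<phi> x)"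
proof -
  have 1: "\<bar>(grad_norm G (\<lambda>x. u x + e * \<phi> x) x powr s - grad_norm G u x powr s) / e\<bar>
      \<le> s * 2 powr s * (grad_norm G u x powr s + grad_norm G \<phi> x powr s)"
    using assms s_gt_1 grad_norm_perturb[of u e \<phi> x]
    by (intro powr_difference_quotient_bound) auto
  have "\<bar>(\<bar>u x + e * \<phi> x\<bar> powr s - \<bar>u x\<bar> powr s) / e\<bar>
      \<le> s * 2 powr s * (\<bar>u x\<bar> powr s + \<bar>\<phi> x\<bar> powr s)"
    using assms s_gt_1 abs_triangle_ineq3[of "u x + e * \<phi> x" "u x"]
    by (intro powr_difference_quotient_bound) (auto simp: abs_mult)
  then have 2: "c x * \<bar>(\<bar>u x + e * \<phi> x\<bar> powr s - \<bar>u x\<bar> powr s) / e\<bar>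
      \<le> c x * (s * 2 powr s * (\<bar>u x\<bar> powr s + \<bar>\<phi> x\<bar> powr s))"
    by (intro mult_left_mono) auto
  have 3: "(dens (\<lambda>x. u x + e * \<phi> x) x - dens u x) / e
    = (grad_norm G (\<lambda>x. u x + e * \<phi> x) x powr s - grad_norm G u x powr s) / e
      + c x * ((\<bar>u x + e * \<phi> x\<bar> powr s - \<bar>u x\<bar> powr s) / e)"
    using assms by (simp add: dens_def field_simps)
  have 4: "\<bar>A + c x * B\<bar> \<le> \<bar>A\<bar> + c x * \<bar>B\<bar>" for A B
    using abs_triangle_ineq[of A "c x * B"] by (simp add: abs_mult)
  have 5: "s * 2 powr s * (dens u x + dens \<phi> x)
    = s * 2 powr s * (grad_norm G u x powr s + grad_norm G \<phi> x powr s)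
      + c x * (s * 2 powr s * (\<bar>u x\<bar> powr s + \<bar>\<phi> x\<bar> powr s))"
    by (simp add: dens_def algebra_simps)
  show ?thesis
    unfolding 3 5 by (rule order_trans[OF 4 add_mono[OF 1 2]])
qed

lemma dens_difference_quotient_tendsto:
  assumes e: "e \<longlonglongrightarrow> 0" "\<And>n. 0 < e n" "\<And>n. e n \<le> 1" and nn: "0 \<le> u x" "0 \<le> \<phi> x"
  shows "(\<lambda>n. (dens (\<lambda>x. u x + e n * \<phi> x) x - dens u x) / e n)
    \<longlonglongrightarrow> s * weak_integrand G s c u \<phi> x"
proof -
  have 1: "(\<lambda>n. (grad_norm G (\<lambda>x. u x + e n * \<phi> x) x powr s - grad_norm G u x powr s) / e n)
    \<longlonglongrightarrow> s * (grad_norm G u x powr (s - 2) * gradient_form G u \<phi> x)"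
  proof (cases "grad_norm G u x = 0")
    \<comment> \<open>Where the gradient of \<open>u\<close> vanishes, the perturbed gradient norm
      is at most \<open>e\<close> times that of \<open>\<phi>\<close>, and its power with
      \<open>s > 1\<close> is \<open>o(e)\<close>. The limit 0 agrees with the weak integrand, as
      \<open>0 powr (s - 2) = 0\<close>.\<close>
    case True
    have "(\<lambda>n. grad_norm G (\<lambda>x. u x + e n * \<phi> x) x powr s / e n) \<longlonglongrightarrow> 0"
    proof (rule tendsto_sandwich[OF _ _ tendsto_const powr_mult_quotient_tendsto[OF s_gt_1 e(1,2) grad_norm_nonneg[of \<phi> x]]])
      show "\<forall>\<^sub>F n in sequentially. 0 \<le> grad_norm G (\<lambda>x. u x + e n * \<phi> x) x powr s / e n"
        using e by (auto simp: less_imp_le)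
      have "grad_norm G (\<lambda>x. u x + e n * \<phi> x) x powr s / e n \<le> (e n * grad_norm G \<phi> x) powr s / e n" for n
        using grad_norm_perturb[of u "e n" \<phi> x] True e(2)[of n] s_gt_1
        by (intro divide_right_mono powr_mono2) auto
      then show "\<forall>\<^sub>F n in sequentially. grad_norm G (\<lambda>x. u x + e n * \<phi> x) x powr s / e n
          \<le> (e n * grad_norm G \<phi> x) powr s / e n" by simp
    qed
    then show ?thesis using True by simp
  next
    case False
    let ?A = "gradient_form G u u x" and ?B = "gradient_form G u \<phi> x" and ?C = "gradient_form G \<phi> \<phi> x"
    \<comment> \<open>Elsewhere the form of the perturbed function is a quadratic polynomial in
      \<open>t\<close>, positive at 0, and the chain rule applies to its power
      \<open>s / 2\<close>.\<close>
    have A: "?A > 0"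
      using False gradient_form_nonneg[of u x] by (auto simp: grad_norm_def)
    have "((\<lambda>t. (?A + 2 * t * ?B + t * t * ?C) powr (s / 2)) has_real_derivative
        (s / 2 * (?A + 2 * 0 * ?B + 0 * 0 * ?C) powr (s / 2 - 1) * (2 * ?B))) (at 0)"
      using A by (auto intro!: derivative_eq_intros)
    from DERIV_difference_quotient_seq[OF this e(1,2)]
    have "(\<lambda>n. ((?A + 2 * e n * ?B + e n * e n * ?C) powr (s / 2) - ?A powr (s / 2)) / e n)
        \<longlonglongrightarrow> s * (?A powr (s / 2 - 1) * ?B)" by (simp add: mult_ac)
    moreover have "?A powr (s / 2 - 1) = grad_norm G u x powr (s - 2)"
      unfolding grad_norm_powr by (simp add: diff_divide_distrib)
    ultimately show ?thesis
      unfolding grad_norm_powr[of _ _ s] gradient_form_perturb by simp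
  qed
  have "\<bar>u x + e n * \<phi> x\<bar> = u x + e n * \<phi> x" for n
    using nn e(2)[of n] by simp
  then have 2: "(\<lambda>n. (\<bar>u x + e n * \<phi> x\<bar> powr s - \<bar>u x\<bar> powr s) / e n) \<longlonglongrightarrow> s * (u x powr (s - 1) * \<phi> x)"
    using powr_difference_quotient_tendsto[OF s_gt_1 e(1,2) nn] nn by simp
  have "(\<lambda>n. (grad_norm G (\<lambda>x. u x + e n * \<phi> x) x powr s - grad_norm G u x powr s) / e n
      + c x * ((\<bar>u x + e n * \<phi> x\<bar> powr s - \<bar>u x\<bar> powr s) / e n))
    \<longlonglongrightarrow> s * (grad_norm G u x powr (s - 2) * gradient_form G u \<phi> x) + c x * (s * (u x powr (s - 1) * \<phi> x))"
    by (intro tendsto_intros 1 2)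
  moreover have "(grad_norm G (\<lambda>x. u x + e n * \<phi> x) x powr s - grad_norm G u x powr s) / e n
      + c x * ((\<bar>u x + e n * \<phi> x\<bar> powr s - \<bar>u x\<bar> powr s) / e n)
      = (dens (\<lambda>x. u x + e n * \<phi> x) x - dens u x) / e n" for n
    using e(2)[of n] by (simp add: dens_def field_simps)
  moreover have "s * (grad_norm G u x powr (s - 2) * gradient_form G u \<phi> x) + c x * (s * (u x powr (s - 1) * \<phi> x))
      = s * weak_integrand G s c u \<phi> x"
    by (simp add: weak_integrand_def algebra_simps)
  ultimately show ?thesis by simp
qed

lemma En_difference_quotient_tendsto:
  assumes W: "u \<in> W1_weighted G s c" "\<phi> \<in> W1_weighted G s c"
    and nn: "\<And>x. 0 \<le> u x" "\<And>x. 0 \<le> \<phi> x"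
    and e: "e \<longlonglongrightarrow> 0" "\<And>n. 0 < e n" "\<And>n. e n \<le> 1"
  shows "(\<lambda>n. (En (\<lambda>x. u x + e n * \<phi> x) - En u) / e n)
    \<longlonglongrightarrow> s * integral_V G (weak_integrand G s c u \<phi>)"
proof -
  have "(\<lambda>n. integral_V G (\<lambda>x. (dens (\<lambda>x. u x + e n * \<phi> x) x - dens u x) / e n))
     \<longlonglongrightarrow> integral_V G (\<lambda>x. s * weak_integrand G s c u \<phi> x)"
  proof (rule integral_V_dominated(2))
    show "integrable_V G (\<lambda>x. s * 2 powr s * (dens u x + dens \<phi> x))"
      using W by (intro integrable_V_cmult integrable_V_add) (auto simp: W1_weighted_iff)
  qed (use e nn in \<open>auto intro!: dens_difference_quotient_bound dens_difference_quotient_tendsto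
        simp del: abs_divide\<close>)
  moreover have "integral_V G (\<lambda>x. (dens (\<lambda>x. u x + e n * \<phi> x) x - dens u x) / e n)
      = (En (\<lambda>x. u x + e n * \<phi> x) - En u) / e n" for n
  proof -
    have "integrable_V G (dens (\<lambda>x. u x + e n * \<phi> x))" "integrable_V G (dens u)"
      using W W1_weighted_add[OF W(1) W1_weighted_cmult[OF W(2)]] by (auto simp: W1_weighted_iff)
    then show ?thesis
      using integral_V_cmult[of "1 / e n" "\<lambda>x. dens (\<lambda>x. u x + e n * \<phi> x) x - dens u x"]
      by (simp add: integral_V_diff En_def)
  qed
  ultimately show ?thesis by (simp add: integral_V_cmult)
qed

lemma En_perturb_tendsto:
  assumes W: "u \<in> W1_weighted G s c" "\<phi> \<in> W1_weighted G s c"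
    and nn: "\<And>x. 0 \<le> u x" "\<And>x. 0 \<le> \<phi> x"
    and e: "e \<longlonglongrightarrow> 0" "\<And>n. 0 < e n" "\<And>n. e n \<le> 1"
  shows "(\<lambda>n. En (\<lambda>x. u x + e n * \<phi> x)) \<longlonglongrightarrow> En u"
proof -
  \<comment> \<open>Continuity is read off from the convergent difference quotients, multiplied by
    \<open>e n\<close>.\<close>
  have "(\<lambda>n. (En (\<lambda>x. u x + e n * \<phi> x) - En u) / e n * e n + En u)
      \<longlonglongrightarrow> s * integral_V G (weak_integrand G s c u \<phi>) * 0 + En u"
    by (intro tendsto_intros e(1) En_difference_quotient_tendsto[OF W nn e])
  then show ?thesis using e(2) by (simp add: less_imp_neq[symmetric])
qed

lemma cutoff_in_W1_weighted:
  assumes "u \<in> W1_weighted G s c" "\<phi> \<in> W1_weighted G s c" "\<And>x. 0 \<le> u x"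
  shows "cutoff u \<phi> k \<in> W1_weighted G s c"
proof (rule W1_weighted_dominated[OF assms(2) W1_weighted_cmult[OF assms(1), of "real k"]])
  show "\<bar>cutoff u \<phi> k x\<bar> \<le> \<bar>\<phi> x\<bar> + \<bar>real k * u x\<bar>" for x
    using abs_cutoff_le[of u x \<phi> k] assms(3)[of x] by (smt (verit))
  show "\<bar>cutoff u \<phi> k y - cutoff u \<phi> k x\<bar> \<le> \<bar>\<phi> y - \<phi> x\<bar> + \<bar>real k * u y - real k * u x\<bar>" for x y
    by (auto simp: cutoff_def max_def abs_if)
qed

text \<open>The increment of a maximum is at most the larger of the two increments. In the direction
  in which \<open>u\<close> grows, that of \<open>- k u\<close> is not positive and drops out,
  whatever \<open>k\<close> is.\<close>

lemma cutoff_increment: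
  "(u y - u x) * (cutoff u \<phi> k y - cutoff u \<phi> k x) \<le> \<bar>u y - u x\<bar> * \<bar>\<phi> y - \<phi> x\<bar>"
proof (cases "u x \<le> u y")
  case True
  then have "cutoff u \<phi> k y - cutoff u \<phi> k x \<le> \<bar>\<phi> y - \<phi> x\<bar>"
    using mult_left_mono[OF True, of "real k"] by (auto simp: cutoff_def max_def)
  then have "(u y - u x) * (cutoff u \<phi> k y - cutoff u \<phi> k x) \<le> (u y - u x) * \<bar>\<phi> y - \<phi> x\<bar>"
    using True by (intro mult_left_mono) auto
  then show ?thesis using True by simp
next
  case False
  then have "cutoff u \<phi> k x - cutoff u \<phi> k y \<le> \<bar>\<phi> y - \<phi> x\<bar>"
    using mult_left_mono[of "u y" "u x" "real k"] by (auto simp: cutoff_def max_def)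
  then have "(u x - u y) * (cutoff u \<phi> k x - cutoff u \<phi> k y) \<le> (u x - u y) * \<bar>\<phi> y - \<phi> x\<bar>"
    using False by (intro mult_left_mono) auto
  then show ?thesis using False by (simp add: algebra_simps)
qed

lemma gradient_form_cutoff_le: "gradient_form G u (cutoff u \<phi> k) x \<le> grad_norm G u x * grad_norm G \<phi> x"
proof -
  have "gradient_form G u (cutoff u \<phi> k) x
    = (\<Sum>y\<in>nbrs G x. (edge_coeff x y * edge_coeff x y) * ((u y - u x) * (cutoff u \<phi> k y - cutoff u \<phi> k x)))"
    by (simp add: gradient_form_edge_coeff mult_ac)
  also have "\<dots> \<le> (\<Sum>y\<in>nbrs G x. (edge_coeff x y * edge_coeff x y) * (\<bar>u y - u x\<bar> * \<bar>\<phi> y - \<phi> x\<bar>))"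
    by (intro sum_mono mult_left_mono cutoff_increment) simp
  also have "\<dots> = (\<Sum>y\<in>nbrs G x. \<bar>edge_coeff x y * (u y - u x)\<bar> * \<bar>edge_coeff x y * (\<phi> y - \<phi> x)\<bar>)"
    by (simp add: abs_mult edge_coeff_nonneg mult_ac)
  also have "\<dots> \<le> grad_norm G u x * grad_norm G \<phi> x"
    by (rule gradient_form_Cauchy_Schwarz_abs)
  finally show ?thesis .
qed

lemma weak_integrand_cutoff_le:
  assumes "\<And>x. 0 \<le> u x"
  shows "weak_integrand G s c u (cutoff u \<phi> k) x \<le> weak_bound u \<phi> x"
proof -
  have "c x * u x powr (s - 1) * cutoff u \<phi> k x \<le> c x * u x powr (s - 1) * \<bar>\<phi> x\<bar>"
    using abs_cutoff_le[of u x \<phi> k] assms by (intro mult_left_mono) auto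
  then show ?thesis
    unfolding weak_integrand_def weak_bound_def
    using assms mult_left_mono[OF gradient_form_cutoff_le[of u \<phi> k x], of "grad_norm G u x powr (s - 2)"]
    by (intro add_mono) auto
qed

lemma cutoff_tendsto:
  assumes "0 < u x"
  shows "(\<lambda>k. cutoff u \<phi> k x) \<longlonglongrightarrow> \<phi> x"
proof -
  obtain K :: nat where K: "- \<phi> x / u x \<le> real K"
    using real_arch_simple by blast
  have "\<phi> x = cutoff u \<phi> k x" if "k \<ge> K" for k
  proof -
    have "- \<phi> x / u x \<le> real k" using K that by linarith
    then have "- (real k * u x) \<le> \<phi> x" using pos_divide_le_eq[OF assms, of "- \<phi> x" "real k"] by linarith
    then show ?thesis by (simp add: cutoff_def max_def)
  qed
  then have "\<forall>\<^sub>F k in sequentially. \<phi> x = cutoff u \<phi> k x"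
    unfolding eventually_sequentially by blast
  then show ?thesis
    by (rule tendsto_eventually[OF eventually_mono]) simp
qed

lemma weak_integrand_cutoff_tendsto:
  assumes "\<And>x. 0 < u x"
  shows "(\<lambda>k. weak_integrand G s c u (cutoff u \<phi> k) x) \<longlonglongrightarrow> weak_integrand G s c u \<phi> x"
  unfolding weak_integrand_def
  by (intro tendsto_intros tendsto_gradient_form cutoff_tendsto assms)

end

section \<open>Fibering maps\<close>

text \<open>The functionals enter only as real numbers. This pays off for minimising sequences:
  limits of energies obey the same estimates, although they need not be energies of a
  function.\<close>

locale fibering_params =
  fixes p q \<gamma> \<alpha> X0 X :: real
  assumes exps: "0 < \<gamma>" "\<gamma> < 1" "1 < q" "q \<le> p" "p < \<alpha> + 1"
    and X0_pos: "0 < X0" and X0_less_X: "X0 < X"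
begin

text \<open>Hoelder bounds normalised by the radii: the right-hand sides equal
  \<open>(\<alpha> + 1 - p) * A\<close> at \<open>A = X0 powr p\<close> and
  \<open>(p - 1 + \<gamma>) * A\<close> at \<open>A = X powr p\<close>.\<close>

definition bounds :: "real \<Rightarrow> real \<Rightarrow> real \<Rightarrow> bool" where
  "bounds A F L \<longleftrightarrow> 0 \<le> A \<and> 0 \<le> F \<and> 0 \<le> L
    \<and> (\<alpha> + \<gamma>) * F \<le> (\<alpha> + 1 - p) * X0 powr (p - 1 + \<gamma>) * A powr ((1 - \<gamma>) / p)
    \<and> (\<alpha> + \<gamma>) * L \<le> (p - 1 + \<gamma>) * X powr (- (\<alpha> + 1 - p)) * A powr ((\<alpha> + 1) / p)"

definition phi :: "real \<Rightarrow> real \<Rightarrow> real \<Rightarrow> real \<Rightarrow> real \<Rightarrow> real" where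
  "phi A B F L t = t powr (p - 1 + \<gamma>) * A + t powr (q - 1 + \<gamma>) * B - F - t powr (\<alpha> + \<gamma>) * L"

text \<open>The energy. Its coefficients are such that its derivative along a ray at
  \<open>t = 1\<close> is \<open>A + B - F - L\<close>.\<close>

definition J :: "real \<Rightarrow> real \<Rightarrow> real \<Rightarrow> real \<Rightarrow> real" where
  "J A B F L = A / p + B / q - F / (1 - \<gamma>) - L / (\<alpha> + 1)"

definition Jt :: "real \<Rightarrow> real \<Rightarrow> real \<Rightarrow> real \<Rightarrow> real \<Rightarrow> real" where
  "Jt A B F L t = J (t powr p * A) (t powr q * B) (t powr (1 - \<gamma>) * F) (t powr (\<alpha> + 1) * L)"

lemma Jt_1 [simp]: "Jt A B F L 1 = J A B F L" and phi_1 [simp]: "phi A B F L 1 = A + B - F - L"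
  by (simp_all add: Jt_def phi_def)

text \<open>Both sides of each estimate scale with the same power of \<open>t\<close>.\<close>

lemma bounds_scale:
  assumes "bounds A F L" "0 < t"
  shows "bounds (t powr p * A) (t powr (1 - \<gamma>) * F) (t powr (\<alpha> + 1) * L)"
proof -
  have b: "0 \<le> A" "0 \<le> F" "0 \<le> L"
    "(\<alpha> + \<gamma>) * F \<le> (\<alpha> + 1 - p) * X0 powr (p - 1 + \<gamma>) * A powr ((1 - \<gamma>) / p)"
    "(\<alpha> + \<gamma>) * L \<le> (p - 1 + \<gamma>) * X powr (- (\<alpha> + 1 - p)) * A powr ((\<alpha> + 1) / p)"
    using assms(1) by (auto simp: bounds_def)
  have e: "(t powr p * A) powr (r / p) = t powr r * A powr (r / p)" for r
    using b exps assms(2) by (simp add: powr_mult powr_powr)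
  have 1: "t powr (1 - \<gamma>) * ((\<alpha> + \<gamma>) * F)
      \<le> t powr (1 - \<gamma>) * ((\<alpha> + 1 - p) * X0 powr (p - 1 + \<gamma>) * A powr ((1 - \<gamma>) / p))"
    by (intro mult_left_mono b) auto
  have 2: "t powr (\<alpha> + 1) * ((\<alpha> + \<gamma>) * L)
      \<le> t powr (\<alpha> + 1) * ((p - 1 + \<gamma>) * X powr (- (\<alpha> + 1 - p)) * A powr ((\<alpha> + 1) / p))"
    by (intro mult_left_mono b) auto
  show ?thesis
    unfolding bounds_def e using b 1 2 by (simp add: mult_ac)
qed

lemma bounds_F_le:
  assumes "bounds A F L" "X0 powr p \<le> A"
  shows "(\<alpha> + \<gamma>) * F \<le> (\<alpha> + 1 - p) * A"
proof -
  have A: "0 < A" using assms(2) X0_pos by (smt (verit) powr_gt_zero)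
  have "X0 powr (p - 1 + \<gamma>) = (X0 powr p) powr ((p - 1 + \<gamma>) / p)"
    using exps by (simp add: powr_powr)
  also have "\<dots> \<le> A powr ((p - 1 + \<gamma>) / p)"
    using exps assms(2) by (intro powr_mono2) auto
  finally have "X0 powr (p - 1 + \<gamma>) * A powr ((1 - \<gamma>) / p)
      \<le> A powr ((p - 1 + \<gamma>) / p) * A powr ((1 - \<gamma>) / p)"
    by (intro mult_right_mono) auto
  also have "\<dots> = A powr 1"
    using exps by (subst powr_add[symmetric]) (simp add: field_simps)
  finally have "(\<alpha> + 1 - p) * (X0 powr (p - 1 + \<gamma>) * A powr ((1 - \<gamma>) / p)) \<le> (\<alpha> + 1 - p) * A"
    using A exps by (intro mult_left_mono) auto
  with assms(1) show ?thesis by (auto simp: bounds_def mult_ac)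
qed

lemma bounds_L_le:
  assumes "bounds A F L" "A \<le> X powr p"
  shows "(\<alpha> + \<gamma>) * L \<le> (p - 1 + \<gamma>) * A"
    and "A < X powr p \<Longrightarrow> 0 < A \<Longrightarrow> (\<alpha> + \<gamma>) * L < (p - 1 + \<gamma>) * A"
proof -
  have Xp: "X > 0" using X0_pos X0_less_X by simp
  have A: "0 \<le> A" using assms by (simp add: bounds_def)
  have eq: "A powr ((\<alpha> + 1) / p) = A powr ((\<alpha> + 1 - p) / p) * A"
    using A exps powr_mult_base[of A "(\<alpha> + 1 - p) / p"] by (simp add: field_simps)
  have Xe: "(X powr p) powr ((\<alpha> + 1 - p) / p) = X powr (\<alpha> + 1 - p)"
    using exps by (simp add: powr_powr)
  have b: "(\<alpha> + \<gamma>) * L \<le> (p - 1 + \<gamma>) * (X powr (- (\<alpha> + 1 - p)) * A powr ((\<alpha> + 1 - p) / p) * A)"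
    using assms(1) by (simp add: bounds_def eq mult_ac)
  have "A powr ((\<alpha> + 1 - p) / p) \<le> X powr (\<alpha> + 1 - p)"
    unfolding Xe[symmetric] using exps A assms(2) by (intro powr_mono2) auto
  then have "X powr (- (\<alpha> + 1 - p)) * A powr ((\<alpha> + 1 - p) / p) \<le> X powr (- (\<alpha> + 1 - p)) * X powr (\<alpha> + 1 - p)"
    by (intro mult_left_mono) auto
  also have "\<dots> = 1" using Xp by (subst powr_add[symmetric]) simp
  finally have "(p - 1 + \<gamma>) * (X powr (- (\<alpha> + 1 - p)) * A powr ((\<alpha> + 1 - p) / p) * A) \<le> (p - 1 + \<gamma>) * (1 * A)"
    using A exps by (intro mult_left_mono mult_right_mono) auto
  with b show "(\<alpha> + \<gamma>) * L \<le> (p - 1 + \<gamma>) * A" by simp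
  assume lt: "A < X powr p" "0 < A"
  have "A powr ((\<alpha> + 1 - p) / p) < X powr (\<alpha> + 1 - p)"
    unfolding Xe[symmetric] using exps lt by (intro powr_less_mono2) auto
  then have "X powr (- (\<alpha> + 1 - p)) * A powr ((\<alpha> + 1 - p) / p) < X powr (- (\<alpha> + 1 - p)) * X powr (\<alpha> + 1 - p)"
    using Xp by (intro mult_strict_left_mono) auto
  also have "\<dots> = 1" using Xp by (subst powr_add[symmetric]) simp
  finally have "(p - 1 + \<gamma>) * (X powr (- (\<alpha> + 1 - p)) * A powr ((\<alpha> + 1 - p) / p) * A) < (p - 1 + \<gamma>) * (1 * A)"
    using lt exps by (intro mult_strict_left_mono mult_strict_right_mono) auto
  with b show "(\<alpha> + \<gamma>) * L < (p - 1 + \<gamma>) * A" by simp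
qed

lemma phi_pos_between:
  assumes "bounds A F L" "0 < B" "X0 powr p \<le> A" "A \<le> X powr p"
  shows "0 < A + B - F - L"
proof -
  have "(\<alpha> + \<gamma>) * (F + L) \<le> (\<alpha> + \<gamma>) * A"
    using bounds_F_le[OF assms(1,3)] bounds_L_le(1)[OF assms(1,4)] by (simp add: algebra_simps)
  then have "F + L \<le> A" using exps by (simp add: mult_le_cancel_left_pos)
  with assms(2) show ?thesis by linarith
qed

lemma nehari_zero_large:
  assumes "bounds A F L" "0 < B" "X0 powr p \<le> A" "A + B = F + L"
  shows "X powr p < A" and "(p - 1 + \<gamma>) * A + (q - 1 + \<gamma>) * B - (\<alpha> + \<gamma>) * L < 0"
proof -
  show "X powr p < A"
    using phi_pos_between[OF assms(1-3)] assms(4) by force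
  \<comment> \<open>\<open>L\<close> is eliminated in favour of \<open>F\<close>, because the
    estimate of \<open>F\<close> holds for every \<open>A\<close> beyond \<open>X0 powr p\<close>,
    whereas that of \<open>L\<close> is useful only up to \<open>X powr p\<close>.\<close>
  have L: "L = A + B - F" using assms(4) by simp
  have "(p - 1 + \<gamma>) * A + (q - 1 + \<gamma>) * B - (\<alpha> + \<gamma>) * L
      = ((\<alpha> + \<gamma>) * F - (\<alpha> + 1 - p) * A) - (\<alpha> + 1 - q) * B"
    unfolding L by (simp add: algebra_simps)
  moreover have "0 < (\<alpha> + 1 - q) * B" using assms(2) exps by simp
  ultimately show "(p - 1 + \<gamma>) * A + (q - 1 + \<gamma>) * B - (\<alpha> + \<gamma>) * L < 0"
    using bounds_F_le[OF assms(1,3)] by linarith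
qed

text \<open>Put \<open>N = \<alpha> + \<gamma>\<close> and \<open>P = p - 1 + \<gamma>\<close>. With
  \<open>L = A + B - F\<close> the map becomes
  \<open>F (t^N - 1) - A (t^N - t^P) - B (t^N - t^(q-1+\<gamma>))\<close>. Now
  \<open>N F \<le> (N - P) A\<close>, and concavity of the power \<open>P / N\<close>, taken at
  \<open>t^N\<close>, compares the first two terms.\<close>

lemma phi_after_zero:
  assumes b: "bounds A F L" "0 < B" "X0 powr p \<le> A" "A + B = F + L" and t: "1 < t"
  shows "phi A B F L t < 0"
proof -
  let ?N = "\<alpha> + \<gamma>" and ?P = "p - 1 + \<gamma>"
  have N: "0 < ?N" and NP: "?P \<le> ?N" "0 < ?P" using exps by auto
  have "t powr ?P = (t powr ?N) powr (?P / ?N)" using N by (simp add: powr_powr)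
  also have "\<dots> \<le> 1 + ?P / ?N * (t powr ?N - 1)"
    using t N NP by (intro powr_le_Bernoulli) auto
  finally have "?N * t powr ?P \<le> ?N * (1 + ?P / ?N * (t powr ?N - 1))"
    using N by (intro mult_left_mono) auto
  also have "\<dots> = ?N + ?P * (t powr ?N - 1)" using N by (simp add: field_simps)
  finally have 1: "(\<alpha> + 1 - p) * (t powr ?N - 1) \<le> ?N * (t powr ?N - t powr ?P)"
    by (simp add: algebra_simps)
  have A: "0 \<le> A" using b by (simp add: bounds_def)
  have tN: "1 \<le> t powr ?N" using t N by (simp add: ge_one_powr_ge_zero)
  have "?N * F * (t powr ?N - 1) \<le> (\<alpha> + 1 - p) * A * (t powr ?N - 1)"
    using bounds_F_le[OF b(1,3)] tN by (intro mult_right_mono) auto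
  also have "\<dots> = A * ((\<alpha> + 1 - p) * (t powr ?N - 1))" by simp
  also have "\<dots> \<le> A * (?N * (t powr ?N - t powr ?P))" using A 1 by (rule mult_left_mono[rotated])
  finally have "?N * (F * (t powr ?N - 1)) \<le> ?N * (A * (t powr ?N - t powr ?P))" by (simp add: mult_ac)
  then have 2: "F * (t powr ?N - 1) \<le> A * (t powr ?N - t powr ?P)"
    using N by (simp add: mult_le_cancel_left_pos)
  have "t powr (q - 1 + \<gamma>) < t powr ?N" using t exps by (intro powr_less_mono) auto
  then have "0 < B * (t powr ?N - t powr (q - 1 + \<gamma>))" using b(2) by simp
  moreover have L: "L = A + B - F" using b(4) by simp
  ultimately show ?thesis using 2 unfolding phi_def L by (simp add: algebra_simps)
qed

text \<open>Mirror image of \<open>phi_after_zero\<close>. For \<open>t < 1\<close> a sharper bound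
  of \<open>F\<close> is needed; it is the estimate at the scaled point, which gains a factor
  \<open>t^(p-1+\<gamma>)\<close> and is available because that point is still outside the
  ball.\<close>

lemma phi_before_zero:
  assumes b: "bounds A F L" "0 < B" "A + B = F + L" and t: "0 < t" "t < 1" "X0 powr p \<le> t powr p * A"
  shows "0 < phi A B F L t"
proof -
  let ?N = "\<alpha> + \<gamma>" and ?P = "p - 1 + \<gamma>" and ?D = "\<alpha> + 1 - p"
  have N: "0 < ?N" and NP: "?D \<le> ?N" "0 < ?D" using exps by auto
  have "t powr ?D = (t powr ?N) powr (?D / ?N)" using N by (simp add: powr_powr)
  also have "\<dots> \<le> 1 + ?D / ?N * (t powr ?N - 1)"
    using t N NP by (intro powr_le_Bernoulli) auto
  finally have "?N * t powr ?D \<le> ?N * (1 + ?D / ?N * (t powr ?N - 1))"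
    using N by (intro mult_left_mono) auto
  also have "\<dots> = ?N + ?D * (t powr ?N - 1)" using N by (simp add: field_simps)
  finally have 1: "?D * (1 - t powr ?N) \<le> ?N * (1 - t powr ?D)"
    by (simp add: algebra_simps)
  have PD: "t powr ?P * t powr ?D = t powr ?N"
    by (subst powr_add[symmetric]) (simp add: add.commute)
  have A: "0 \<le> A" using b by (simp add: bounds_def)
  have tN: "t powr ?N \<le> 1" using t N by (simp add: powr_le1)
  have "t powr (1 - \<gamma>) * (?N * F) \<le> t powr (1 - \<gamma>) * (?D * t powr ?P * A)"
  proof -
    have "t powr (1 - \<gamma>) * t powr ?P = t powr p" by (subst powr_add[symmetric]) simp
    then have "t powr (1 - \<gamma>) * (?D * t powr ?P * A) = ?D * (t powr p * A)"
      by (metis (no_types, lifting) mult.assoc mult.commute)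
    moreover have "t powr (1 - \<gamma>) * (?N * F) = ?N * (t powr (1 - \<gamma>) * F)" by simp
    ultimately show ?thesis
      using bounds_F_le[OF bounds_scale[OF b(1) t(1)] t(3)] by metis
  qed
  then have "?N * F \<le> ?D * t powr ?P * A" using t by (simp add: mult_le_cancel_left_pos)
  then have "?N * F * (1 - t powr ?N) \<le> ?D * t powr ?P * A * (1 - t powr ?N)"
    using tN by (intro mult_right_mono) auto
  also have "\<dots> = (t powr ?P * A) * (?D * (1 - t powr ?N))" by simp
  also have "\<dots> \<le> (t powr ?P * A) * (?N * (1 - t powr ?D))" using A 1 by (intro mult_left_mono) auto
  also have "\<dots> = ?N * (A * (t powr ?P - t powr ?P * t powr ?D))" by (simp add: algebra_simps)
  finally have "?N * (F * (1 - t powr ?N)) \<le> ?N * (A * (t powr ?P - t powr ?N))"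
    unfolding PD by (simp add: mult_ac)
  then have 2: "F * (1 - t powr ?N) \<le> A * (t powr ?P - t powr ?N)"
    using N by (simp add: mult_le_cancel_left_pos)
  have "t powr ?N < t powr (q - 1 + \<gamma>)" using t exps by (intro powr_less_mono') auto
  then have "0 < B * (t powr (q - 1 + \<gamma>) - t powr ?N)" using b(2) by simp
  moreover have L: "L = A + B - F" using b(3) by simp
  ultimately show ?thesis using 2 unfolding phi_def L by (simp add: algebra_simps)
qed

lemma Jt_has_derivative:
  assumes "0 < t"
  shows "(Jt A B F L has_real_derivative t powr (- \<gamma>) * phi A B F L t) (at t)"
proof -
  have nz: "1 - \<gamma> \<noteq> 0" "\<alpha> + 1 \<noteq> 0" "p \<noteq> 0" "q \<noteq> 0" using exps by auto
  have e: "t powr (- \<gamma>) * t powr r = t powr (r - \<gamma>)" for r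
    by (subst powr_add[symmetric]) simp
  have "(Jt A B F L has_real_derivative
    (p * t powr (p - 1)) * A / p + (q * t powr (q - 1)) * B / q
     - ((1 - \<gamma>) * t powr (1 - \<gamma> - 1)) * F / (1 - \<gamma>) - ((\<alpha> + 1) * t powr (\<alpha> + 1 - 1)) * L / (\<alpha> + 1)) (at t)"
    unfolding Jt_def[abs_def] J_def using assms
    by (intro derivative_intros DERIV_cdivide DERIV_cmult_right has_real_derivative_powr)
  moreover have "(p * t powr (p - 1)) * A / p + (q * t powr (q - 1)) * B / q
     - ((1 - \<gamma>) * t powr (1 - \<gamma> - 1)) * F / (1 - \<gamma>) - ((\<alpha> + 1) * t powr (\<alpha> + 1 - 1)) * L / (\<alpha> + 1)
    = t powr (- \<gamma>) * phi A B F L t"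
    using nz by (simp add: phi_def distrib_left right_diff_distrib e flip: mult.assoc)
  ultimately show ?thesis by simp
qed

text \<open>The sign of \<open>phi\<close> is that of the derivative of the energy along the ray.
  For \<open>t < 1\<close> the condition at \<open>t\<close> holds on all of \<open>[t, 1]\<close>,
  as the scaled \<open>A\<close> grows with the factor.\<close>

lemma Jt_le_at_zero:
  assumes b: "bounds A F L" "0 < B" "X0 powr p \<le> A" "A + B = F + L" and t: "0 < t" "X0 powr p \<le> t powr p * A"
  shows "Jt A B F L t \<le> J A B F L"
proof (cases t "1::real" rule: linorder_cases)
  case less
  have "Jt A B F L t \<le> Jt A B F L 1"
  proof (rule DERIV_nonneg_imp_nondecreasing[OF less_imp_le[OF less]])
    fix r assume r: "t \<le> r" "r \<le> 1"
    then have "t powr p \<le> r powr p" using t exps by (intro powr_mono2) auto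
    then have "t powr p * A \<le> r powr p * A" using b by (intro mult_right_mono) (auto simp: bounds_def)
    then have "r < 1 \<Longrightarrow> 0 < phi A B F L r"
      using phi_before_zero[OF b(1,2,4)] r t by auto
    moreover have "phi A B F L 1 = 0" using b(4) by simp
    ultimately have "0 \<le> phi A B F L r" using r by (cases "r = 1") (auto simp: less_le)
    then show "\<exists>y. DERIV (Jt A B F L) r :> y \<and> 0 \<le> y"
      using Jt_has_derivative[of r A B F L] r t
      by (intro exI[of _ "r powr (- \<gamma>) * phi A B F L r"] conjI) auto
  qed
  then show ?thesis by simp
next
  case greater
  have "Jt A B F L 1 \<ge> Jt A B F L t"
  proof (rule DERIV_nonpos_imp_nonincreasing[OF less_imp_le[OF greater]])
    fix r assume r: "1 \<le> r" "r \<le> t"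
    then have "1 < r \<Longrightarrow> phi A B F L r < 0"
      using phi_after_zero[OF b] by auto
    moreover have "phi A B F L 1 = 0" using b(4) by simp
    ultimately have "phi A B F L r \<le> 0" using r by (cases "r = 1") (auto simp: less_le)
    then show "\<exists>y. DERIV (Jt A B F L) r :> y \<and> y \<le> 0"
      using Jt_has_derivative[of r A B F L] r
      by (intro exI[of _ "r powr (- \<gamma>) * phi A B F L r"] conjI) (auto simp: mult_nonneg_nonpos)
  qed
  then show ?thesis by simp
qed auto

lemma phi_scale:
  assumes "0 < t"
  shows "t powr p * A + t powr q * B - t powr (1 - \<gamma>) * F - t powr (\<alpha> + 1) * L = t powr (1 - \<gamma>) * phi A B F L t"
proof -
  have e: "t powr (1 - \<gamma>) * t powr r = t powr (1 - \<gamma> + r)" for r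
    by (subst powr_add[symmetric]) simp
  show ?thesis
    by (simp add: phi_def distrib_left right_diff_distrib e add.commute flip: mult.assoc)
qed

lemma continuous_on_phi: "continuous_on {0<..} (phi A B F L)"
  unfolding phi_def[abs_def] by (intro continuous_intros) auto

lemma phi_zero_between:
  assumes "0 < s" "s \<le> t" "0 \<le> phi A B F L s" "phi A B F L t \<le> 0"
  obtains r where "s \<le> r" "r \<le> t" "phi A B F L r = 0"
  using IVT2'[of "phi A B F L" t 0 s] assms continuous_on_subset[OF continuous_on_phi, of "{s..t}"]
  by fastforce

lemma ex_phi_zero:
  assumes b: "bounds A F L" "0 < A" "0 < B" "0 < L"
  obtains t where "0 < t" "X0 powr p \<le> t powr p * A" "phi A B F L t = 0"
proof -
  \<comment> \<open>\<open>t0\<close> moves the point onto the sphere of radius \<open>X0\<close>,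
    where the fibering map is positive.\<close>
  define t0 where "t0 = X0 / A powr (1 / p)"
  have t0: "0 < t0" using X0_pos b by (simp add: t0_def)
  have t0p: "t0 powr p * A = X0 powr p"
    using b exps X0_pos by (simp add: t0_def powr_divide powr_powr)
  have "0 < t0 powr p * A + t0 powr q * B - t0 powr (1 - \<gamma>) * F - t0 powr (\<alpha> + 1) * L"
  proof (rule phi_pos_between[OF bounds_scale[OF b(1) t0]])
    show "t0 powr p * A \<le> X powr p"
      unfolding t0p using X0_less_X X0_pos exps by (intro powr_mono2) auto
  qed (use t0 b t0p in auto)
  then have pos: "0 \<le> phi A B F L t0"
    unfolding phi_scale[OF t0] using t0 by (simp add: zero_less_mult_iff)
  let ?D = "\<alpha> + 1 - p"
  \<comment> \<open>The last entry makes the \<open>L\<close>-term dominate \<open>A + B\<close>;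
    the entry 1 allows the power with \<open>q\<close> to be bounded by the one with
    \<open>p\<close>, and \<open>t0\<close> keeps the order of the endpoints.\<close>
  define t1 where "t1 = max t0 (max 1 (((A + B) / L) powr (1 / ?D)))"
  have t1: "t0 \<le> t1" "1 \<le> t1" "((A + B) / L) powr (1 / ?D) \<le> t1" by (auto simp: t1_def)
  have "(A + B) / L = (((A + B) / L) powr (1 / ?D)) powr ?D"
    using exps b by (simp add: powr_powr)
  also have "\<dots> \<le> t1 powr ?D" using t1 exps by (intro powr_mono2) auto
  finally have 1: "A + B \<le> t1 powr ?D * L" using b by (simp add: pos_divide_le_eq)
  have "t1 powr (q - 1 + \<gamma>) \<le> t1 powr (p - 1 + \<gamma>)"
    using t1 exps by (intro powr_mono) auto
  then have "phi A B F L t1 \<le> t1 powr (p - 1 + \<gamma>) * A + t1 powr (p - 1 + \<gamma>) * B - t1 powr (\<alpha> + \<gamma>) * L"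
    using mult_right_mono[of "t1 powr (q - 1 + \<gamma>)" "t1 powr (p - 1 + \<gamma>)" B] b(1,3)
    unfolding phi_def bounds_def by linarith
  also have "t1 powr (\<alpha> + \<gamma>) = t1 powr (p - 1 + \<gamma>) * t1 powr ?D"
    by (subst powr_add[symmetric]) (simp add: add.commute)
  also have "t1 powr (p - 1 + \<gamma>) * A + t1 powr (p - 1 + \<gamma>) * B - t1 powr (p - 1 + \<gamma>) * t1 powr ?D * L
      = t1 powr (p - 1 + \<gamma>) * (A + B - t1 powr ?D * L)" by (simp add: algebra_simps)
  also have "\<dots> \<le> 0" using 1 by (intro mult_nonneg_nonpos) auto
  finally have "phi A B F L t1 \<le> 0" .
  then obtain t where t: "t0 \<le> t" "phi A B F L t = 0"
    using phi_zero_between[OF t0 t1(1) pos] by blast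
  have "t0 powr p * A \<le> t powr p * A"
    using t t0 b exps by (intro mult_right_mono powr_mono2) auto
  then show ?thesis using that[of t] t t0 t0p by auto
qed

text \<open>A strict sign change survives small changes of the coefficients, so the intermediate
  value theorem yields a nearby zero; no differentiable dependence is involved.\<close>

lemma phi_zero_perturb:
  assumes b: "bounds A F L" "0 < B" "X0 powr p \<le> A" "A + B = F + L" and \<eta>: "0 < \<eta>"
    and lim: "A' \<longlonglongrightarrow> A" "B' \<longlonglongrightarrow> B" "F' \<longlonglongrightarrow> F" "L' \<longlonglongrightarrow> L"
  shows "\<forall>\<^sub>F n in sequentially. \<exists>t. 0 < t \<and> \<bar>t - 1\<bar> \<le> \<eta> \<and> phi (A' n) (B' n) (F' n) (L' n) t = 0
    \<and> X0 powr p \<le> t powr p * A' n \<and> X0 powr p \<le> t powr p * A"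
proof -
  \<comment> \<open>A zero beyond \<open>X0\<close> lies even beyond \<open>X\<close>, which leaves
    room for the factors \<open>1 - d\<close>.\<close>
  have A0: "X0 powr p < A"
  proof -
    have "X0 powr p < X powr p" using X0_pos X0_less_X exps by (intro powr_less_mono2) auto
    then show ?thesis using nehari_zero_large(1)[OF b] by linarith
  qed
  have "((\<lambda>d. (1 - d) powr p * A) \<longlongrightarrow> (1 - 0) powr p * A) (at_right 0)"
    by (intro tendsto_intros) auto
  then have "\<forall>\<^sub>F d in at_right 0. X0 powr p < (1 - d) powr p * A"
    using A0 by (intro order_tendstoD(1)) auto
  moreover have "\<forall>\<^sub>F d in at_right 0. 0 < d \<and> d < min \<eta> 1"
    using \<eta> by (auto simp: eventually_at_right_field intro!: exI[of _ "min \<eta> 1"])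
  ultimately have "\<forall>\<^sub>F d in at_right (0::real). X0 powr p < (1 - d) powr p * A \<and> 0 < d \<and> d < min \<eta> 1"
    by eventually_elim auto
  then obtain d where d: "X0 powr p < (1 - d) powr p * A" "0 < d" "d < \<eta>" "d < 1"
    using eventually_happens'[of "at_right (0::real)"] by force
  have lphi: "(\<lambda>n. phi (A' n) (B' n) (F' n) (L' n) t) \<longlonglongrightarrow> phi A B F L t" for t
    unfolding phi_def by (intro tendsto_intros lim)
  have "0 < phi A B F L (1 - d)"
    using d by (intro phi_before_zero[OF b(1,2,4)]) auto
  then have e1: "\<forall>\<^sub>F n in sequentially. 0 < phi (A' n) (B' n) (F' n) (L' n) (1 - d)"
    by (rule order_tendstoD(1)[OF lphi])
  have "phi A B F L (1 + d) < 0"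
    using d by (intro phi_after_zero[OF b]) auto
  then have e2: "\<forall>\<^sub>F n in sequentially. phi (A' n) (B' n) (F' n) (L' n) (1 + d) < 0"
    by (rule order_tendstoD(2)[OF lphi])
  have e3: "\<forall>\<^sub>F n in sequentially. X0 powr p < (1 - d) powr p * A' n"
    by (rule order_tendstoD(1)[OF tendsto_mult_left[OF lim(1)] d(1)])
  from e1 e2 e3 show ?thesis
  proof eventually_elim
    case (elim n)
    obtain t where t: "1 - d \<le> t" "t \<le> 1 + d" "phi (A' n) (B' n) (F' n) (L' n) t = 0"
      using phi_zero_between[of "1 - d" "1 + d" "A' n" "B' n" "F' n" "L' n"] d elim by auto
    have le: "(1 - d) powr p \<le> t powr p" using t d exps by (intro powr_mono2) auto
    have "0 < (1 - d) powr p * A' n" "0 < (1 - d) powr p * A"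
      using elim(3) d(1) X0_pos by (smt (verit) powr_gt_zero)+
    then have "0 < A' n" "0 < A" using d by (auto simp: zero_less_mult_iff)
    then have "(1 - d) powr p * A' n \<le> t powr p * A' n" "(1 - d) powr p * A \<le> t powr p * A"
      using le by (auto intro: mult_right_mono)
    then show ?case using t d elim by (intro exI[of _ t]) auto
  qed
qed

text \<open>Subtracting the constraint divided by \<open>\<alpha> + 1\<close> removes
  \<open>L\<close> and leaves positive coefficients \<open>k1\<close>, \<open>k2\<close> for
  \<open>A\<close> and \<open>B\<close>. The bound of \<open>F\<close> is sublinear in
  \<open>A\<close> and can be absorbed.\<close>

lemma nehari_coercive:
  obtains \<kappa> K where "0 < \<kappa>"
    "\<And>A B F L. bounds A F L \<Longrightarrow> 0 \<le> B \<Longrightarrow> A + B = F + L \<Longrightarrow> \<kappa> * (A + B) \<le> J A B F L + K"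
proof -
  define k1 where "k1 = 1 / p - 1 / (\<alpha> + 1)"
  define k2 where "k2 = 1 / q - 1 / (\<alpha> + 1)"
  define k3 where "k3 = 1 / (1 - \<gamma>) - 1 / (\<alpha> + 1)"
  define th where "th = (1 - \<gamma>) / p"
  define cF where "cF = (\<alpha> + 1 - p) * X0 powr (p - 1 + \<gamma>) / (\<alpha> + \<gamma>)"
  have k: "0 < k1" "k1 \<le> k2" "0 < k3" "0 < th" "th < 1" "0 < cF"
  proof -
    have "1 / (\<alpha> + 1) < 1 / p" "1 / p \<le> 1 / q" "1 / (\<alpha> + 1) < 1 / (1 - \<gamma>)"
      using exps by (auto intro!: divide_strict_left_mono divide_left_mono mult_pos_pos)
    then show "0 < k1" "k1 \<le> k2" "0 < k3" by (auto simp: k1_def k2_def k3_def)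
  qed (use exps X0_pos in \<open>auto simp: th_def cF_def\<close>)
  \<comment> \<open>\<open>M\<close> is the point where the concave function
    \<open>k3 * cF * A powr th\<close> of \<open>A\<close> has slope \<open>k1 / 2\<close>; the
    tangent there gives the absorption estimate.\<close>
  define M where "M = (k1 / (2 * k3 * cF * th)) powr (1 / (th - 1))"
  have M: "0 < M" using k by (simp add: M_def)
  have M1: "M powr (th - 1) = k1 / (2 * k3 * cF * th)" using k by (simp add: M_def powr_powr)
  have young: "k3 * cF * A powr th \<le> k1 / 2 * A + k3 * cF * M powr th" if "0 \<le> A" for A
  proof (cases "A = 0")
    case True then show ?thesis using k by simp
  next
    case False
    then have A: "0 < A" using that by simp
    have "A powr th = M powr th * (A / M) powr th"
      using A M by (simp add: powr_divide)
    also have "\<dots> \<le> M powr th * (1 + th * (A / M - 1))"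
      using A M k by (intro mult_left_mono powr_le_Bernoulli) auto
    also have "\<dots> \<le> M powr th * (1 + th * (A / M))"
      using k by (intro mult_left_mono) (auto simp: right_diff_distrib)
    also have "\<dots> = M powr th + th * A * (M powr th / M powr 1)"
      using M by (simp add: field_simps)
    also have "M powr th / M powr 1 = k1 / (2 * k3 * cF * th)"
      unfolding M1[symmetric] by (rule powr_diff[symmetric])
    finally have "k3 * cF * A powr th \<le> k3 * cF * (M powr th + th * A * (k1 / (2 * k3 * cF * th)))"
      using k by (intro mult_left_mono) auto
    also have "\<dots> = k1 / 2 * A + k3 * cF * M powr th"
      using k by (simp add: field_simps)
    finally show ?thesis .
  qed
  show ?thesis
  proof (rule that[of "k1 / 2" "k3 * cF * M powr th"])
    fix A B F L assume b: "bounds A F L" "0 \<le> B" "A + B = F + L"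
    have "F \<le> cF * A powr th"
      using b(1) exps by (simp add: bounds_def cF_def th_def field_simps)
    then have "k3 * F \<le> k3 * (cF * A powr th)" using k by (intro mult_left_mono) auto
    also have "\<dots> \<le> k1 / 2 * A + k3 * cF * M powr th"
      using young[of A] b(1) by (simp add: bounds_def mult.assoc)
    finally have 1: "k3 * F \<le> k1 / 2 * A + k3 * cF * M powr th" .
    have "J A B F L = J A B F L - (A + B - F - L) / (\<alpha> + 1)" using b by simp
    also have "\<dots> = k1 * A + k2 * B - k3 * F"
      by (simp add: J_def k1_def k2_def k3_def algebra_simps add_divide_distrib diff_divide_distrib)
    finally have 2: "J A B F L = k1 * A + k2 * B - k3 * F" .
    have 3: "k1 * B \<le> k2 * B" "0 \<le> k1 * B" using k b by (auto intro: mult_right_mono)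
    show "k1 / 2 * (A + B) \<le> J A B F L + k3 * cF * M powr th"
      unfolding 2 distrib_left using 1 3 by linarith
  qed (use k in auto)
qed

end

section \<open>Bounds on the nonlinear terms\<close>

text \<open>In logarithms both claims are the same linear inequality:
  \<open>\<alpha> + 1 - p\<close> times the difference of the logarithms is
  \<open>ln Lambda_star - ln lam\<close> in either case.\<close>

lemma Lambda_star_threshold:
  fixes p \<alpha> \<gamma> \<mu>0 a0 lam :: real
  assumes "0 < \<gamma>" "\<gamma> < 1" "1 < p" "p < \<alpha> + 1" "0 < \<mu>0" "0 < a0" "0 < lam"
    and g: "0 < Linf_norm g" and f: "0 < L_norm G (p / (p - 1 + \<gamma>)) f"
    and lam: "lam < Lambda_star G \<mu>0 a0 f g \<gamma> \<alpha> p"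
  shows "X_0 G a0 f \<gamma> \<alpha> p < X_lam \<mu>0 a0 g \<gamma> \<alpha> p lam"
    and "S_0 G \<mu>0 a0 f \<gamma> \<alpha> p < S_lam \<mu>0 a0 g \<gamma> \<alpha> p lam"
proof -
  define P where "P = p - 1 + \<gamma>"
  define D where "D = \<alpha> + 1 - p"
  define lN where "lN = ln (P + D)"
  define lP where "lP = ln P"
  define lD where "lD = ln D"
  define ll where "ll = ln lam"
  define lm where "lm = ln \<mu>0"
  define la where "la = ln a0"
  define lg where "lg = ln (Linf_norm g)"
  define lf where "lf = ln (L_norm G (p / (p - 1 + \<gamma>)) f)"
  note defs = lN_def lP_def lD_def ll_def lm_def la_def lg_def lf_def
  have pos: "0 < P" "0 < D" "0 < P + D" "0 < p" using assms by (auto simp: P_def D_def)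
  have e: "p - 1 + \<gamma> = P" "p + \<gamma> - 1 = P" "\<alpha> + \<gamma> = P + D" "\<alpha> + 1 - p = D" "p - 1 - \<alpha> = - D"
    "\<alpha> + 1 = p + D" "1 - \<gamma> = p - P" by (auto simp: P_def D_def)
  note ln_simps = ln_mult_pos ln_div ln_powr
  have "ln lam < ln (Lambda_star G \<mu>0 a0 f g \<gamma> \<alpha> p)"
    using lam assms(7) by simp
  also have "\<dots> = ((P + D) / P) * (lP - lN) + (D / P) * (lD - lP) - lg + (D / p) * lm + ((P + D) / P) * la - (D / P) * lf"
    unfolding Lambda_star_def defs e using pos assms(5-7) g f
    by (simp add: ln_simps e)
  finally have L: "ll < ((P + D) / P) * (lP - lN) + (D / P) * (lD - lP) - lg + (D / p) * lm + ((P + D) / P) * la - (D / P) * lf"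
    by (simp add: ll_def)
  have X0: "ln (X_0 G a0 f \<gamma> \<alpha> p) = (1 / P) * (lN - lD) - ((p - P) / (p * P)) * la + (1 / P) * lf"
    unfolding X_0_def defs e using pos assms(5-7) g f by (simp add: ln_simps e)
  have X: "ln (X_lam \<mu>0 a0 g \<gamma> \<alpha> p lam) = (1 / D) * (lP - (ll + lN + lg - (D / p) * lm - ((p + D) / p) * la))"
    unfolding X_lam_def defs e using pos assms(5-7) g f by (simp add: ln_simps)
  have S0: "ln (S_0 G \<mu>0 a0 f \<gamma> \<alpha> p) = (1 / P) * (lN - lD) - (D / (p * (p + D))) * lm - (1 / P) * la + (1 / P) * lf"
    unfolding S_0_def defs e using pos assms(5-7) g f by (simp add: ln_simps e)
  have S: "ln (S_lam \<mu>0 a0 g \<gamma> \<alpha> p lam) = (1 / D) * (lP - (ll + lN)) + (1 / (p + D)) * lm + (1 / D) * la - (1 / D) * lg"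
    unfolding S_lam_def defs e using pos assms(5-7) g f by (simp add: ln_simps)
  have 1: "D * (ln (X_lam \<mu>0 a0 g \<gamma> \<alpha> p lam) - ln (X_0 G a0 f \<gamma> \<alpha> p))
     = ((P + D) / P) * (lP - lN) + (D / P) * (lD - lP) - lg + (D / p) * lm + ((P + D) / P) * la - (D / P) * lf - ll"
    unfolding X X0 using pos by (simp add: field_simps)
  \<comment> \<open>The powers of \<open>\<mu>0\<close> in \<open>S_lam\<close> and
    \<open>S_0\<close> combine to \<open>1 / p\<close>, which after multiplication by
    \<open>D\<close> is the exponent in \<open>Lambda_star\<close>.\<close>
  have pD: "1 / (p + D) + D / (p * (p + D)) = 1 / p"
    using pos by (simp add: divide_simps)
  have "D * (ln (S_lam \<mu>0 a0 g \<gamma> \<alpha> p lam) - ln (S_0 G \<mu>0 a0 f \<gamma> \<alpha> p))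
     = D * ((1 / D) * (lP - (ll + lN)) + (1 / (p + D) + D / (p * (p + D))) * lm + (1 / D) * la - (1 / D) * lg
       - (1 / P) * (lN - lD) + (1 / P) * la - (1 / P) * lf)"
    unfolding S S0 by (simp add: distrib_right)
  also have "\<dots> = ((P + D) / P) * (lP - lN) + (D / P) * (lD - lP) - lg + (D / p) * lm + ((P + D) / P) * la - (D / P) * lf - ll"
    unfolding pD using pos by (simp add: field_simps)
  finally have 2: "D * (ln (S_lam \<mu>0 a0 g \<gamma> \<alpha> p lam) - ln (S_0 G \<mu>0 a0 f \<gamma> \<alpha> p))
     = \<dots>" .
  have pos': "0 < X_lam \<mu>0 a0 g \<gamma> \<alpha> p lam" "0 < X_0 G a0 f \<gamma> \<alpha> p"
    "0 < S_lam \<mu>0 a0 g \<gamma> \<alpha> p lam" "0 < S_0 G \<mu>0 a0 f \<gamma> \<alpha> p"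
    unfolding X_lam_def X_0_def S_lam_def S_0_def e using pos assms(5-7) g f[unfolded e] by auto
  have "0 < D * (ln (X_lam \<mu>0 a0 g \<gamma> \<alpha> p lam) - ln (X_0 G a0 f \<gamma> \<alpha> p))"
    unfolding 1 using L by linarith
  then show "X_0 G a0 f \<gamma> \<alpha> p < X_lam \<mu>0 a0 g \<gamma> \<alpha> p lam"
    using pos pos' by (simp add: zero_less_mult_iff)
  have "0 < D * (ln (S_lam \<mu>0 a0 g \<gamma> \<alpha> p lam) - ln (S_0 G \<mu>0 a0 f \<gamma> \<alpha> p))"
    unfolding 2 using L by linarith
  then show "S_0 G \<mu>0 a0 f \<gamma> \<alpha> p < S_lam \<mu>0 a0 g \<gamma> \<alpha> p lam"
    using pos pos' by (simp add: zero_less_mult_iff)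
qed

context lf_graph
begin

lemma integral_V_Hoelder:
  fixes r r' :: real
  assumes r: "1 < r" "1 < r'" "1 / r + 1 / r' = 1"
    and nn: "\<And>x. 0 \<le> h x" "\<And>x. 0 \<le> w x"
    and int: "integrable_V G (\<lambda>x. h x powr r)" "integrable_V G (\<lambda>x. w x powr r')"
  shows "integrable_V G (\<lambda>x. h x * w x)"
    and "integral_V G (\<lambda>x. h x * w x)
      \<le> integral_V G (\<lambda>x. h x powr r) powr (1 / r) * integral_V G (\<lambda>x. w x powr r') powr (1 / r')"
proof -
  let ?A = "integral_V G (\<lambda>x. h x powr r)" and ?B = "integral_V G (\<lambda>x. w x powr r')"
  have young: "h x * w x \<le> (1 / r) * h x powr r + (1 / r') * w x powr r'" for x
    using Youngs_inequality[OF r nn(1) nn(2), of x x] by simp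
  show i: "integrable_V G (\<lambda>x. h x * w x)"
  proof (rule integrable_V_comparison[OF integrable_V_add[OF integrable_V_cmult[OF int(1)] integrable_V_cmult[OF int(2)]]])
    show "\<bar>h x * w x\<bar> \<le> (1 / r) * h x powr r + (1 / r') * w x powr r'" for x
      using young[of x] nn by simp
  qed
  show "integral_V G (\<lambda>x. h x * w x) \<le> ?A powr (1 / r) * ?B powr (1 / r')"
  \<comment> \<open>If one factor vanishes identically, dividing by its norm is impossible, but the
    product is 0. Otherwise Young's inequality is applied to the normalised factors.\<close>
  proof (cases "\<exists>x y. h x \<noteq> 0 \<and> w y \<noteq> 0")
    case False
    then have "(\<lambda>x. h x * w x) = (\<lambda>x. 0)" by auto
    then show ?thesis by (simp add: integral_V_def)
  next
    case True
    then obtain x y where "0 < h x powr r" "0 < w y powr r'" using nn r by fastforce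
    then have AB: "0 < ?A" "0 < ?B"
      using integral_V_pos[OF int(1), of x] integral_V_pos[OF int(2), of y] by auto
    define A where "A = ?A powr (1 / r)"
    define B where "B = ?B powr (1 / r')"
    have AB': "0 < A" "0 < B" "A powr r = ?A" "B powr r' = ?B"
      using AB r by (auto simp: A_def B_def powr_powr)
    have "h x * w x \<le> A * B / (r * ?A) * h x powr r + A * B / (r' * ?B) * w x powr r'" for x
    proof -
      have "h x / A * (w x / B) \<le> (h x / A) powr r / r + (w x / B) powr r' / r'"
        using AB' nn by (intro Youngs_inequality r) auto
      then have "A * B * (h x / A * (w x / B)) \<le> A * B * ((h x / A) powr r / r + (w x / B) powr r' / r')"
        using AB' by (intro mult_left_mono) auto
      moreover have "A * B * (h x / A * (w x / B)) = h x * w x" using AB' by simp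
      moreover have "(h x / A) powr r = h x powr r / ?A" "(w x / B) powr r' = w x powr r' / ?B"
        using AB' nn by (simp_all add: powr_divide)
      ultimately show ?thesis by (simp add: field_simps)
    qed
    then have "integral_V G (\<lambda>x. h x * w x)
        \<le> integral_V G (\<lambda>x. A * B / (r * ?A) * h x powr r + A * B / (r' * ?B) * w x powr r')"
      by (intro integral_V_mono i integrable_V_add integrable_V_cmult int)
    also have "\<dots> = A * B / (r * ?A) * ?A + A * B / (r' * ?B) * ?B"
      by (simp only: integral_V_add[OF integrable_V_cmult[OF int(1)] integrable_V_cmult[OF int(2)]] integral_V_cmult)
    also have "\<dots> = A * B * (1 / r + 1 / r')" using AB by (simp add: field_simps)
    finally show ?thesis unfolding r(3) by (simp add: A_def B_def)
  qed
qed

end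

locale singular_problem = lf_graph G for G :: "'v wgraph" +
  fixes \<mu>0 \<gamma> p q \<alpha> a0 b0 lam :: real and f g a b :: "'v \<Rightarrow> real"
  assumes mu0: "0 < \<mu>0" "\<And>x. \<mu>0 \<le> vmeas G x"
    and exps: "0 < \<gamma>" "\<gamma> < 1" "1 < q" "q \<le> p" "p < \<alpha> + 1"
    and f_pos: "\<And>x. 0 < f x" and g_nonneg: "\<And>x. 0 \<le> g x" and g_nz: "\<exists>x. g x \<noteq> 0"
    and f_L1: "f \<in> L_space G 1" and f_Lp: "f \<in> L_space G (p / (p - 1 + \<gamma>))"
    and g_L1: "g \<in> L_space G 1" and g_Linf: "g \<in> Linf_space"
    and a0: "0 < a0" "\<And>x. a0 \<le> a x" and b0: "0 < b0" "\<And>x. b0 \<le> b x"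
    and lam: "0 < lam" "lam < Lambda_star G \<mu>0 a0 f g \<gamma> \<alpha> p"
begin

lemma p_gt_1: "1 < p"
  using exps by simp

sublocale Wp: weighted_sobolev G p a a0
  using p_gt_1 a0 by unfold_locales auto

sublocale Wq: weighted_sobolev G q b b0
  using exps b0 by unfold_locales auto

lemma f_integrable: "integrable_V G f"
  using f_L1 f_pos by (simp add: L_space_def less_imp_le)

lemma g_integrable: "integrable_V G g"
  using g_L1 g_nonneg by (simp add: L_space_def)

lemma g_le: "g x \<le> Linf_norm g"
  using g_Linf g_nonneg cSUP_upper[of x UNIV "\<lambda>x. \<bar>g x\<bar>"]
  by (simp add: Linf_space_def Linf_norm_def)

lemma Linf_norm_g_pos: "0 < Linf_norm g"
  using g_nz g_nonneg g_le by (metis less_le_trans less_le)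

lemma f_powr_integrable: "integrable_V G (\<lambda>x. f x powr (p / (p - 1 + \<gamma>)))"
  using f_Lp f_pos by (simp add: L_space_def less_imp_le)

lemma L_norm_f: "L_norm G (p / (p - 1 + \<gamma>)) f
    = integral_V G (\<lambda>x. f x powr (p / (p - 1 + \<gamma>))) powr ((p - 1 + \<gamma>) / p)"
  using f_pos by (simp add: L_norm_def less_imp_le)

lemma L_norm_f_pos: "0 < L_norm G (p / (p - 1 + \<gamma>)) f"
proof -
  have "0 < integral_V G (\<lambda>x. f x powr (p / (p - 1 + \<gamma>)))"
    using f_pos[of undefined] by (intro integral_V_pos[OF f_powr_integrable, of undefined]) auto
  then show ?thesis unfolding L_norm_f by simp
qed

abbreviation "X0 \<equiv> X_0 G a0 f \<gamma> \<alpha> p"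
abbreviation "X \<equiv> X_lam \<mu>0 a0 g \<gamma> \<alpha> p lam"

text \<open>Here \<open>lam < Lambda_star\<close> enters, in the form \<open>X0 < X\<close>.\<close>

sublocale fibering_params p q \<gamma> \<alpha> X0 X
proof
  show "0 < X0"
    unfolding X_0_def using exps p_gt_1 a0 L_norm_f_pos by auto
  show "X0 < X"
    by (rule Lambda_star_threshold) (use exps p_gt_1 mu0 a0 lam Linf_norm_g_pos L_norm_f_pos in auto)
qed (use exps in auto)

definition Fi :: "('v \<Rightarrow> real) \<Rightarrow> real" where
  "Fi u = integral_V G (\<lambda>x. f x * u x powr (1 - \<gamma>))"

definition Li :: "('v \<Rightarrow> real) \<Rightarrow> real" where
  "Li u = lam * integral_V G (\<lambda>x. g x * u x powr (\<alpha> + 1))"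

abbreviation "W \<equiv> W_space G p q a b"
abbreviation "Wplus \<equiv> W_plus G p q a b"

lemma W_iff: "u \<in> W \<longleftrightarrow> u \<in> W1_weighted G p a \<and> u \<in> W1_weighted G q b"
  by (simp add: W_space_def)

lemma Wplus_iff: "u \<in> Wplus \<longleftrightarrow> u \<in> W1_weighted G p a \<and> u \<in> W1_weighted G q b \<and> (\<forall>x. 0 \<le> u x)"
  by (simp add: W_plus_def W_space_def)

lemma integrable_powr_p:
  assumes "u \<in> W" shows "integrable_V G (\<lambda>x. \<bar>u x\<bar> powr p)"
  using assms Wp.W1_weighted_iff unfolding W_iff W1_weighted_def W1_def
  by (auto elim!: integrable_V_comparison)

lemma integral_powr_p_le:
  assumes "u \<in> W" shows "a0 * integral_V G (\<lambda>x. \<bar>u x\<bar> powr p) \<le> Wp.En u"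
proof -
  have "a0 * integral_V G (\<lambda>x. \<bar>u x\<bar> powr p) = integral_V G (\<lambda>x. a0 * \<bar>u x\<bar> powr p)"
    by (simp add: integral_V_cmult)
  also have "\<dots> \<le> Wp.En u"
    unfolding Wp.En_def
  proof (rule integral_V_mono)
    show "a0 * \<bar>u x\<bar> powr p \<le> Wp.dens u x" for x
      using Wp.powr_le_dens[of x u] mult_right_mono[OF a0(2)[of x], of "\<bar>u x\<bar> powr p"] by simp
    show "integrable_V G (\<lambda>x. a0 * \<bar>u x\<bar> powr p)"
      by (rule integrable_V_cmult[OF integrable_powr_p[OF assms]])
    show "integrable_V G (Wp.dens u)"
      using assms by (simp add: W_iff Wp.W1_weighted_iff)
  qed
  finally show ?thesis .
qed

lemma powr_p_le:
  assumes "u \<in> W" shows "\<mu>0 * \<bar>u x\<bar> powr p \<le> integral_V G (\<lambda>x. \<bar>u x\<bar> powr p)"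
  using integral_V_ge_point[OF integrable_powr_p[OF assms], of x]
    mult_right_mono[OF mu0(2)[of x], of "\<bar>u x\<bar> powr p"] by simp

lemma sup_bound:
  assumes "u \<in> W"
  shows "\<bar>u x\<bar> \<le> (integral_V G (\<lambda>x. \<bar>u x\<bar> powr p) / \<mu>0) powr (1 / p)"
proof -
  have "\<bar>u x\<bar> = (\<bar>u x\<bar> powr p) powr (1 / p)" using p_gt_1 by (simp add: powr_powr)
  also have "\<dots> \<le> (integral_V G (\<lambda>x. \<bar>u x\<bar> powr p) / \<mu>0) powr (1 / p)"
    using powr_p_le[OF assms, of x] mu0 p_gt_1 by (intro powr_mono2) (auto simp: field_simps)
  finally show ?thesis .
qed

text \<open>The point mass bound \<open>\<mu> \<ge> \<mu>\<^sub>0\<close> yields \<open>L\<^sup>p \<subseteq> L\<^sup>\<infinity>\<close> and hence \<open>L\<^sup>p \<subseteq> L\<^bsup>\<alpha>+1\<^esup>\<close>.\<close>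

lemma powr_alpha_le:
  assumes "u \<in> W"
  shows "\<bar>u x\<bar> powr (\<alpha> + 1)
    \<le> (integral_V G (\<lambda>x. \<bar>u x\<bar> powr p) / \<mu>0) powr ((\<alpha> + 1 - p) / p) * \<bar>u x\<bar> powr p"
proof -
  have "\<bar>u x\<bar> powr (\<alpha> + 1) = \<bar>u x\<bar> powr (\<alpha> + 1 - p) * \<bar>u x\<bar> powr p"
    by (subst powr_add[symmetric]) simp
  also have "\<bar>u x\<bar> powr (\<alpha> + 1 - p)
      \<le> ((integral_V G (\<lambda>x. \<bar>u x\<bar> powr p) / \<mu>0) powr (1 / p)) powr (\<alpha> + 1 - p)"
    using exps by (intro powr_mono2 sup_bound assms) auto
  also have "\<dots> = (integral_V G (\<lambda>x. \<bar>u x\<bar> powr p) / \<mu>0) powr ((\<alpha> + 1 - p) / p)"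
    by (simp add: powr_powr)
  finally show ?thesis by (simp add: mult_right_mono)
qed

lemma integrable_powr_alpha:
  assumes "u \<in> W" shows "integrable_V G (\<lambda>x. \<bar>u x\<bar> powr (\<alpha> + 1))"
  by (rule integrable_V_comparison[OF integrable_V_cmult[OF integrable_powr_p[OF assms]]])
    (use powr_alpha_le[OF assms] in auto)

lemma integral_powr_alpha_le:
  assumes "u \<in> W"
  shows "integral_V G (\<lambda>x. \<bar>u x\<bar> powr (\<alpha> + 1))
    \<le> \<mu>0 powr (- ((\<alpha> + 1 - p) / p)) * integral_V G (\<lambda>x. \<bar>u x\<bar> powr p) powr ((\<alpha> + 1) / p)"
proof -
  let ?K = "integral_V G (\<lambda>x. \<bar>u x\<bar> powr p)"
  have K: "0 \<le> ?K" by (simp add: integral_V_nonneg)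
  have "integral_V G (\<lambda>x. \<bar>u x\<bar> powr (\<alpha> + 1))
      \<le> integral_V G (\<lambda>x. (?K / \<mu>0) powr ((\<alpha> + 1 - p) / p) * \<bar>u x\<bar> powr p)"
    by (intro integral_V_mono integrable_powr_alpha powr_alpha_le integrable_V_cmult integrable_powr_p assms)
  also have "\<dots> = (?K / \<mu>0) powr ((\<alpha> + 1 - p) / p) * ?K" by (simp add: integral_V_cmult)
  also have "\<dots> = \<mu>0 powr (- ((\<alpha> + 1 - p) / p)) * (?K * ?K powr ((\<alpha> + 1 - p) / p))"
    using K mu0 by (simp add: powr_divide powr_minus_divide)
  also have "?K * ?K powr ((\<alpha> + 1 - p) / p) = ?K powr (1 + (\<alpha> + 1 - p) / p)"
    using K by (intro powr_mult_base)
  also have "1 + (\<alpha> + 1 - p) / p = (\<alpha> + 1) / p" using p_gt_1 by (simp add: field_simps)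
  finally show ?thesis .
qed

text \<open>The Hoelder exponents \<open>p / (p - 1 + \<gamma>)\<close> and
  \<open>p / (1 - \<gamma>)\<close> are conjugate, and the second turns
  \<open>u powr (1 - \<gamma>)\<close> into \<open>u powr p\<close>.\<close>

lemma integrable_F:
  assumes "u \<in> Wplus" shows "integrable_V G (\<lambda>x. f x * u x powr (1 - \<gamma>))"
    and Fi_le: "Fi u \<le> L_norm G (p / (p - 1 + \<gamma>)) f
        * integral_V G (\<lambda>x. \<bar>u x\<bar> powr p) powr ((1 - \<gamma>) / p)"
proof -
  have nn: "0 \<le> u x" for x using assms by (simp add: Wplus_iff)
  have r: "1 < p / (p - 1 + \<gamma>)" "1 < p / (1 - \<gamma>)" "1 / (p / (p - 1 + \<gamma>)) + 1 / (p / (1 - \<gamma>)) = 1"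
    using exps p_gt_1 by (auto simp: field_simps)
  have e: "(u x powr (1 - \<gamma>)) powr (p / (1 - \<gamma>)) = \<bar>u x\<bar> powr p" for x
    using nn[of x] exps by (simp add: powr_powr)
  have W: "u \<in> W" using assms by (simp add: W_plus_def)
  have i: "integrable_V G (\<lambda>x. (u x powr (1 - \<gamma>)) powr (p / (1 - \<gamma>)))"
    unfolding e by (rule integrable_powr_p[OF W])
  have H: "integrable_V G (\<lambda>x. f x * u x powr (1 - \<gamma>))"
    "integral_V G (\<lambda>x. f x * u x powr (1 - \<gamma>)) \<le>
      integral_V G (\<lambda>x. f x powr (p / (p - 1 + \<gamma>))) powr (1 / (p / (p - 1 + \<gamma>))) *
      integral_V G (\<lambda>x. (u x powr (1 - \<gamma>)) powr (p / (1 - \<gamma>))) powr (1 / (p / (1 - \<gamma>)))"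
    using integral_V_Hoelder[OF r _ _ f_powr_integrable i] f_pos by (auto simp: less_imp_le)
  show "integrable_V G (\<lambda>x. f x * u x powr (1 - \<gamma>))" by (rule H)
  show "Fi u \<le> L_norm G (p / (p - 1 + \<gamma>)) f * integral_V G (\<lambda>x. \<bar>u x\<bar> powr p) powr ((1 - \<gamma>) / p)"
    using H(2) unfolding e Fi_def L_norm_f by simp
qed

lemma integrable_g_powr_alpha:
  assumes "u \<in> W" shows "integrable_V G (\<lambda>x. g x * \<bar>u x\<bar> powr (\<alpha> + 1))"
  by (rule integrable_V_comparison[OF integrable_V_cmult[OF integrable_powr_alpha[OF assms], of "Linf_norm g"]])
    (use g_le g_nonneg in \<open>auto intro: mult_right_mono\<close>)

lemma Li_le:
  assumes "u \<in> Wplus" shows "Li u \<le> lam * (Linf_norm g * integral_V G (\<lambda>x. \<bar>u x\<bar> powr (\<alpha> + 1)))"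
proof -
  have W: "u \<in> W" using assms by (simp add: W_plus_def)
  have e: "\<bar>u x\<bar> = u x" for x using assms by (simp add: Wplus_iff)
  have "integral_V G (\<lambda>x. g x * u x powr (\<alpha> + 1)) \<le> integral_V G (\<lambda>x. Linf_norm g * u x powr (\<alpha> + 1))"
    using integrable_g_powr_alpha[OF W] integrable_powr_alpha[OF W]
    by (intro integral_V_mono integrable_V_cmult) (auto simp: e intro: mult_right_mono g_le)
  then show ?thesis
    unfolding Li_def using lam by (intro mult_left_mono) (auto simp: integral_V_cmult e)
qed

lemma Fi_nonneg: "0 \<le> Fi u" and Li_nonneg: "0 \<le> Li u"
  unfolding Fi_def Li_def using lam f_pos g_nonneg
  by (auto intro!: integral_V_nonneg mult_nonneg_nonneg simp: less_imp_le)

text \<open>\<open>X0\<close> is defined by solving this for the Hoelder constant of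
  \<open>Fi\<close>; \<open>X_powr\<close> does the same for \<open>X\<close> and
  \<open>Li\<close>.\<close>

lemma X0_powr: "(\<alpha> + 1 - p) * X0 powr (p - 1 + \<gamma>)
    = (\<alpha> + \<gamma>) * (a0 powr (- ((1 - \<gamma>) / p)) * L_norm G (p / (p - 1 + \<gamma>)) f)"
proof -
  have nz: "p - 1 + \<gamma> \<noteq> 0" using exps p_gt_1 by simp
  have "X0 powr (p - 1 + \<gamma>) = (\<alpha> + \<gamma>) / (\<alpha> + 1 - p) * a0 powr (- ((1 - \<gamma>) / p)) * L_norm G (p / (p - 1 + \<gamma>)) f"
    unfolding X_0_def using exps p_gt_1 a0 L_norm_f_pos nz
    by (simp add: powr_mult powr_powr)
  then show ?thesis using exps by simp
qed

lemma X_powr: "(p - 1 + \<gamma>) * X powr (- (\<alpha> + 1 - p))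
    = (\<alpha> + \<gamma>) * (lam * Linf_norm g * \<mu>0 powr (- ((\<alpha> + 1 - p) / p)) * a0 powr (- ((\<alpha> + 1) / p)))"
proof -
  have e: "(p - 1 - \<alpha>) / p = - ((\<alpha> + 1 - p) / p)" by (simp add: diff_divide_distrib add_divide_distrib)
  have "X powr (\<alpha> + 1 - p) = (p - 1 + \<gamma>)
       / (lam * (\<alpha> + \<gamma>) * Linf_norm g * \<mu>0 powr (- ((\<alpha> + 1 - p) / p)) * a0 powr (- ((\<alpha> + 1) / p)))"
    unfolding X_lam_def e using exps p_gt_1 a0 mu0 lam Linf_norm_g_pos by (simp add: powr_powr)
  then show ?thesis using exps p_gt_1
    unfolding powr_minus[of X] by (simp add: mult_ac)
qed

lemma bounds_Wplus:
  assumes "u \<in> Wplus" shows "bounds (Wp.En u) (Fi u) (Li u)"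
  unfolding bounds_def
proof (intro conjI Wp.En_nonneg Fi_nonneg Li_nonneg)
  let ?K = "integral_V G (\<lambda>x. \<bar>u x\<bar> powr p)"
  have W: "u \<in> W" using assms by (simp add: W_plus_def)
  have K: "0 \<le> ?K" by (simp add: integral_V_nonneg)
  \<comment> \<open>Passing from the integral of the \<open>p\<close>-th power to the energy
    produces the powers of \<open>a0\<close> in the constants.\<close>
  have KA: "?K powr r \<le> a0 powr (- r) * Wp.En u powr r" if "0 \<le> r" for r
  proof -
    have "?K powr r \<le> (Wp.En u / a0) powr r"
      using integral_powr_p_le[OF W] a0 K that by (intro powr_mono2) (auto simp: field_simps)
    then show ?thesis using a0 by (simp add: powr_divide powr_minus_divide)
  qed
  have "Fi u \<le> L_norm G (p / (p - 1 + \<gamma>)) f * (a0 powr (- ((1 - \<gamma>) / p)) * Wp.En u powr ((1 - \<gamma>) / p))"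
    using Fi_le[OF assms] KA[of "(1 - \<gamma>) / p"] exps p_gt_1 L_norm_f_pos
    by (elim order_trans) (auto intro: mult_left_mono)
  then have "(\<alpha> + \<gamma>) * Fi u \<le> (\<alpha> + \<gamma>) * (L_norm G (p / (p - 1 + \<gamma>)) f * (a0 powr (- ((1 - \<gamma>) / p)) * Wp.En u powr ((1 - \<gamma>) / p)))"
    using exps by (intro mult_left_mono) auto
  then show "(\<alpha> + \<gamma>) * Fi u \<le> (\<alpha> + 1 - p) * X0 powr (p - 1 + \<gamma>) * Wp.En u powr ((1 - \<gamma>) / p)"
    unfolding X0_powr by (simp add: mult_ac)
  have "integral_V G (\<lambda>x. \<bar>u x\<bar> powr (\<alpha> + 1))
      \<le> \<mu>0 powr (- ((\<alpha> + 1 - p) / p)) * (a0 powr (- ((\<alpha> + 1) / p)) * Wp.En u powr ((\<alpha> + 1) / p))"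
    using exps p_gt_1 by (intro order_trans[OF integral_powr_alpha_le[OF W]] mult_left_mono KA) auto
  then have "lam * (Linf_norm g * integral_V G (\<lambda>x. \<bar>u x\<bar> powr (\<alpha> + 1))) \<le> lam * (Linf_norm g *
      (\<mu>0 powr (- ((\<alpha> + 1 - p) / p)) * (a0 powr (- ((\<alpha> + 1) / p)) * Wp.En u powr ((\<alpha> + 1) / p))))"
    using lam Linf_norm_g_pos by (intro mult_left_mono) auto
  then have "(\<alpha> + \<gamma>) * Li u \<le> (\<alpha> + \<gamma>) * (lam * (Linf_norm g *
      (\<mu>0 powr (- ((\<alpha> + 1 - p) / p)) * (a0 powr (- ((\<alpha> + 1) / p)) * Wp.En u powr ((\<alpha> + 1) / p)))))"
    using Li_le[OF assms] exps by (intro mult_left_mono) auto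
  then show "(\<alpha> + \<gamma>) * Li u \<le> (p - 1 + \<gamma>) * X powr (- (\<alpha> + 1 - p)) * Wp.En u powr ((\<alpha> + 1) / p)"
    unfolding X_powr by (simp add: mult_ac)
qed

end

section \<open>One-sided critical points\<close>

context singular_problem
begin

lemma W_add: "u \<in> W \<Longrightarrow> v \<in> W \<Longrightarrow> (\<lambda>x. u x + v x) \<in> W"
  by (simp add: W_iff Wp.W1_weighted_add Wq.W1_weighted_add)

lemma W_cmult: "u \<in> W \<Longrightarrow> (\<lambda>x. k * u x) \<in> W"
  by (simp add: W_iff Wp.W1_weighted_cmult Wq.W1_weighted_cmult)

lemma W_abs: "u \<in> W \<Longrightarrow> (\<lambda>x. \<bar>u x\<bar>) \<in> W"
  unfolding W_iff
  by (intro conjI Wp.W1_weighted_dominated[of u u "\<lambda>x. \<bar>u x\<bar>"] Wq.W1_weighted_dominated[of u u "\<lambda>x. \<bar>u x\<bar>"])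
    (auto simp: abs_if)

lemma W_indicator: "(\<lambda>x. of_bool (x = z)) \<in> W"
  by (simp add: W_iff Wp.indicator_in_W1_weighted Wq.indicator_in_W1_weighted)

lemma Wplus_W: "u \<in> Wplus \<Longrightarrow> u \<in> W" and Wplus_nonneg: "u \<in> Wplus \<Longrightarrow> 0 \<le> u x"
  by (auto simp: W_plus_def)

lemma WplusI: "u \<in> W \<Longrightarrow> (\<And>x. 0 \<le> u x) \<Longrightarrow> u \<in> Wplus"
  by (auto simp: W_plus_def)

lemma Wplus_perturb: "u \<in> Wplus \<Longrightarrow> \<phi> \<in> Wplus \<Longrightarrow> 0 \<le> e \<Longrightarrow> (\<lambda>x. u x + e * \<phi> x) \<in> Wplus"
  by (intro WplusI W_add W_cmult) (auto simp: Wplus_W Wplus_nonneg)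

lemma Wplus_cmult: "u \<in> Wplus \<Longrightarrow> 0 \<le> t \<Longrightarrow> (\<lambda>x. t * u x) \<in> Wplus"
  by (intro WplusI W_cmult) (auto simp: Wplus_W Wplus_nonneg)

text \<open>For \<open>u > 0\<close> the weak equation is formally its Euler-Lagrange
  equation.\<close>

definition energy :: "('v \<Rightarrow> real) \<Rightarrow> real" where
  "energy u = J (Wp.En u) (Wq.En u) (Fi u) (Li u)"

lemma Fi_cmult: "0 \<le> t \<Longrightarrow> (\<And>x. 0 \<le> u x) \<Longrightarrow> Fi (\<lambda>x. t * u x) = t powr (1 - \<gamma>) * Fi u"
  unfolding Fi_def by (subst integral_V_cmult[symmetric]) (simp add: powr_mult mult_ac)

lemma Li_cmult: "0 \<le> t \<Longrightarrow> (\<And>x. 0 \<le> u x) \<Longrightarrow> Li (\<lambda>x. t * u x) = t powr (\<alpha> + 1) * Li u"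
  unfolding Li_def using integral_V_cmult[of "t powr (\<alpha> + 1)" "\<lambda>x. g x * u x powr (\<alpha> + 1)"]
  by (simp add: powr_mult mult_ac)

lemma energy_cmult:
  assumes "0 \<le> t" "u \<in> Wplus"
  shows "energy (\<lambda>x. t * u x) = Jt (Wp.En u) (Wq.En u) (Fi u) (Li u) t"
  using assms by (simp add: energy_def Jt_def Wp.En_cmult Wq.En_cmult Fi_cmult Li_cmult Wplus_nonneg)

lemma integrable_g:
  "u \<in> Wplus \<Longrightarrow> integrable_V G (\<lambda>x. g x * u x powr (\<alpha> + 1))"
  using integrable_g_powr_alpha[of u] by (simp add: Wplus_W Wplus_nonneg)

lemma integrable_g_test:
  assumes "u \<in> Wplus" "\<phi> \<in> W" shows "integrable_V G (\<lambda>x. g x * u x powr \<alpha> * \<phi> x)"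
proof (rule integrable_V_comparison[OF integrable_V_add[OF integrable_g[OF assms(1)] integrable_g_powr_alpha[OF assms(2)]]])
  fix x
  have "u x powr (\<alpha> + 1 - 1) * \<bar>\<phi> x\<bar> \<le> u x powr (\<alpha> + 1) + \<bar>\<phi> x\<bar> powr (\<alpha> + 1)"
    using exps p_gt_1 Wplus_nonneg[OF assms(1)] by (intro powr_mult_le) auto
  then have "g x * (u x powr \<alpha> * \<bar>\<phi> x\<bar>) \<le> g x * (u x powr (\<alpha> + 1) + \<bar>\<phi> x\<bar> powr (\<alpha> + 1))"
    by (intro mult_left_mono g_nonneg) simp
  then show "\<bar>g x * u x powr \<alpha> * \<phi> x\<bar> \<le> g x * u x powr (\<alpha> + 1) + g x * \<bar>\<phi> x\<bar> powr (\<alpha> + 1)"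
    using g_nonneg[of x] by (simp add: abs_mult distrib_left mult.assoc)
qed

lemma Li_difference_quotient_tendsto:
  assumes u: "u \<in> Wplus" "\<phi> \<in> Wplus" and e: "e \<longlonglongrightarrow> 0" "\<And>n. 0 < e n" "\<And>n. e n \<le> 1"
  shows "(\<lambda>n. (Li (\<lambda>x. u x + e n * \<phi> x) - Li u) / e n)
    \<longlonglongrightarrow> (\<alpha> + 1) * (lam * integral_V G (\<lambda>x. g x * u x powr \<alpha> * \<phi> x))"
proof -
  have a1: "1 < \<alpha> + 1" using exps by simp
  let ?q = "\<lambda>n x. ((u x + e n * \<phi> x) powr (\<alpha> + 1) - u x powr (\<alpha> + 1)) / e n"
  have "(\<lambda>n. integral_V G (\<lambda>x. g x * ?q n x)) \<longlonglongrightarrow> integral_V G (\<lambda>x. g x * ((\<alpha> + 1) * (u x powr (\<alpha> + 1 - 1) * \<phi> x)))"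
  proof (rule integral_V_dominated(2))
    show "integrable_V G (\<lambda>x. (\<alpha> + 1) * 2 powr (\<alpha> + 1) * (g x * u x powr (\<alpha> + 1) + g x * \<phi> x powr (\<alpha> + 1)))"
      using u by (intro integrable_V_cmult integrable_V_add integrable_g)
    show "(\<lambda>n. g x * ?q n x) \<longlonglongrightarrow> g x * ((\<alpha> + 1) * (u x powr (\<alpha> + 1 - 1) * \<phi> x))" for x
      using u by (intro tendsto_intros powr_difference_quotient_tendsto a1 e) (auto simp: Wplus_nonneg)
    fix n x
    have "\<bar>?q n x\<bar> \<le> (\<alpha> + 1) * 2 powr (\<alpha> + 1) * (u x powr (\<alpha> + 1) + \<phi> x powr (\<alpha> + 1))"
      using e(2,3)[of n] u Wplus_nonneg[OF u(1), of x] Wplus_nonneg[OF u(2), of x] a1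
      by (intro powr_difference_quotient_bound) (auto simp: less_imp_le)
    then have "g x * \<bar>?q n x\<bar> \<le> g x * ((\<alpha> + 1) * 2 powr (\<alpha> + 1) * (u x powr (\<alpha> + 1) + \<phi> x powr (\<alpha> + 1)))"
      by (intro mult_left_mono g_nonneg)
    moreover have "\<bar>g x * ?q n x\<bar> = g x * \<bar>?q n x\<bar>" by (metis abs_mult abs_of_nonneg g_nonneg)
    ultimately show "\<bar>g x * ?q n x\<bar> \<le> (\<alpha> + 1) * 2 powr (\<alpha> + 1) * (g x * u x powr (\<alpha> + 1) + g x * \<phi> x powr (\<alpha> + 1))"
      by (simp only: distrib_left mult_ac)
  qed
  then have "(\<lambda>n. lam * integral_V G (\<lambda>x. g x * ?q n x)) \<longlonglongrightarrow> lam * integral_V G (\<lambda>x. (\<alpha> + 1) * (g x * u x powr \<alpha> * \<phi> x))"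
    by (intro tendsto_intros) (simp add: mult_ac)
  moreover have "lam * integral_V G (\<lambda>x. g x * ?q n x) = (Li (\<lambda>x. u x + e n * \<phi> x) - Li u) / e n" for n
  proof -
    have "integral_V G (\<lambda>x. g x * ?q n x)
       = integral_V G (\<lambda>x. (1 / e n) * (g x * (u x + e n * \<phi> x) powr (\<alpha> + 1) - g x * u x powr (\<alpha> + 1)))"
      by (simp add: right_diff_distrib diff_divide_distrib)
    also have "\<dots> = (1 / e n) * (integral_V G (\<lambda>x. g x * (u x + e n * \<phi> x) powr (\<alpha> + 1)) - integral_V G (\<lambda>x. g x * u x powr (\<alpha> + 1)))"
      unfolding integral_V_cmult using u e(2)[of n]
      by (subst integral_V_diff) (auto intro!: integrable_g Wplus_perturb simp: less_imp_le)
    finally show ?thesis by (simp add: Li_def right_diff_distrib diff_divide_distrib)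
  qed
  ultimately show ?thesis unfolding integral_V_cmult by (simp add: mult_ac)
qed

lemma Li_perturb_tendsto:
  assumes u: "u \<in> Wplus" "\<phi> \<in> Wplus" and e: "e \<longlonglongrightarrow> 0" "\<And>n. 0 < e n" "\<And>n. e n \<le> 1"
  shows "(\<lambda>n. Li (\<lambda>x. u x + e n * \<phi> x)) \<longlonglongrightarrow> Li u"
proof -
  have "(\<lambda>n. (Li (\<lambda>x. u x + e n * \<phi> x) - Li u) / e n * e n + Li u)
      \<longlonglongrightarrow> (\<alpha> + 1) * (lam * integral_V G (\<lambda>x. g x * u x powr \<alpha> * \<phi> x)) * 0 + Li u"
    by (intro tendsto_intros e(1) Li_difference_quotient_tendsto[OF u e])
  then show ?thesis using e(2) by (simp add: less_imp_neq[symmetric])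
qed

text \<open>Only continuity, since at zeros of \<open>u\<close> the difference quotients may blow
  up. The majorant is the value at \<open>e = 1\<close>.\<close>

lemma Fi_perturb_tendsto:
  assumes u: "u \<in> Wplus" "\<phi> \<in> Wplus" and e: "e \<longlonglongrightarrow> 0" "\<And>n. 0 < e n" "\<And>n. e n \<le> 1"
  shows "(\<lambda>n. Fi (\<lambda>x. u x + e n * \<phi> x)) \<longlonglongrightarrow> Fi u"
  unfolding Fi_def
proof (rule integral_V_dominated(2))
  have "(\<lambda>x. u x + 1 * \<phi> x) \<in> Wplus" using u by (intro Wplus_perturb) auto
  then show "integrable_V G (\<lambda>x. f x * (u x + \<phi> x) powr (1 - \<gamma>))"
    using integrable_F by fastforce
  have "(\<lambda>n. f x * (u x + e n * \<phi> x) powr (1 - \<gamma>)) \<longlonglongrightarrow> f x * (u x + 0 * \<phi> x) powr (1 - \<gamma>)" for x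
    using exps e u by (intro tendsto_intros tendsto_powr')
      (auto simp: Wplus_nonneg less_imp_le intro!: always_eventually add_nonneg_nonneg)
  then show "(\<lambda>n. f x * (u x + e n * \<phi> x) powr (1 - \<gamma>)) \<longlonglongrightarrow> f x * u x powr (1 - \<gamma>)" for x
    by simp
  fix n x
  have "(u x + e n * \<phi> x) powr (1 - \<gamma>) \<le> (u x + \<phi> x) powr (1 - \<gamma>)"
    using exps e(2,3)[of n] Wplus_nonneg[OF u(1), of x] Wplus_nonneg[OF u(2), of x]
    by (intro powr_mono2) (auto simp: mult_left_le_one_le)
  then show "\<bar>f x * (u x + e n * \<phi> x) powr (1 - \<gamma>)\<bar> \<le> f x * (u x + \<phi> x) powr (1 - \<gamma>)"
    using f_pos[of x] by (simp add: abs_mult)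
qed

text \<open>
  The factor \<open>t\<close> accommodates minimisers on the Nehari set, where a perturbation of \<open>u\<close> has to
  be projected back along its ray.
\<close>

lemma one_sided_variation:
  assumes u: "u \<in> Wplus" "\<phi> \<in> Wplus"
    and e: "e \<longlonglongrightarrow> 0" "\<And>n. 0 < e n" "\<And>n. e n \<le> 1"
    and t: "t \<longlonglongrightarrow> 1" "\<And>n. 0 < t n"
    and min: "\<And>n. energy (\<lambda>x. t n * u x) \<le> energy (\<lambda>x. t n * (u x + e n * \<phi> x))"
  obtains R where "\<And>n. (Fi (\<lambda>x. u x + e n * \<phi> x) - Fi u) / e n \<le> R n"
    "R \<longlonglongrightarrow> (1 - \<gamma>) * (integral_V G (weak_integrand G p a u \<phi>) + integral_V G (weak_integrand G q b u \<phi>)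
      - lam * integral_V G (\<lambda>x. g x * u x powr \<alpha> * \<phi> x))"
proof -
  let ?v = "\<lambda>n x. u x + e n * \<phi> x"
  define dA where "dA n = (Wp.En (?v n) - Wp.En u) / e n" for n
  define dB where "dB n = (Wq.En (?v n) - Wq.En u) / e n" for n
  define dL where "dL n = (Li (?v n) - Li u) / e n" for n
  define dF where "dF n = (Fi (?v n) - Fi u) / e n" for n
  let ?wp = "integral_V G (weak_integrand G p a u \<phi>)" and ?wq = "integral_V G (weak_integrand G q b u \<phi>)"
    and ?wl = "lam * integral_V G (\<lambda>x. g x * u x powr \<alpha> * \<phi> x)"
  \<comment> \<open>What the energy inequality gives when solved for the quotient of
    \<open>Fi\<close>; the scaling factors tend to 1 and disappear in the limit.\<close>
  define R where "R n = (1 - \<gamma>) * t n powr (- (1 - \<gamma>)) *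
     (t n powr p * dA n / p + t n powr q * dB n / q - t n powr (\<alpha> + 1) * dL n / (\<alpha> + 1))" for n
  have nz: "p \<noteq> 0" "q \<noteq> 0" "\<alpha> + 1 \<noteq> 0" using exps by auto
  have lA: "dA \<longlonglongrightarrow> p * ?wp" unfolding dA_def
    by (rule Wp.En_difference_quotient_tendsto) (use u e in \<open>auto simp: Wplus_iff\<close>)
  have lB: "dB \<longlonglongrightarrow> q * ?wq" unfolding dB_def
    by (rule Wq.En_difference_quotient_tendsto) (use u e in \<open>auto simp: Wplus_iff\<close>)
  have lL: "dL \<longlonglongrightarrow> (\<alpha> + 1) * ?wl" unfolding dL_def
    by (rule Li_difference_quotient_tendsto[OF u e])
  have "R \<longlonglongrightarrow> (1 - \<gamma>) * 1 powr (- (1 - \<gamma>)) *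
     (1 powr p * (p * ?wp) / p + 1 powr q * (q * ?wq) / q - 1 powr (\<alpha> + 1) * ((\<alpha> + 1) * ?wl) / (\<alpha> + 1))"
    unfolding R_def using nz by (intro tendsto_intros lA lB lL t) auto
  then have lR: "R \<longlonglongrightarrow> (1 - \<gamma>) * (?wp + ?wq - ?wl)" using nz by simp
  have "dF n \<le> R n" for n
  proof -
    have v: "?v n \<in> Wplus" using u e(2)[of n] by (intro Wplus_perturb) auto
    have en: "0 < e n" by (rule e)
    have inc: "Wp.En (?v n) = Wp.En u + e n * dA n" "Wq.En (?v n) = Wq.En u + e n * dB n"
      "Fi (?v n) = Fi u + e n * dF n" "Li (?v n) = Li u + e n * dL n"
      using en by (auto simp: dA_def dB_def dF_def dL_def)
    have "0 \<le> energy (\<lambda>x. t n * ?v n x) - energy (\<lambda>x. t n * u x)" using min[of n] by simp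
    also have "\<dots> = e n * (t n powr p * dA n / p + t n powr q * dB n / q
        - t n powr (1 - \<gamma>) * dF n / (1 - \<gamma>) - t n powr (\<alpha> + 1) * dL n / (\<alpha> + 1))"
      unfolding energy_cmult[OF less_imp_le[OF t(2)] v] energy_cmult[OF less_imp_le[OF t(2)] u(1)]
        Jt_def J_def inc by (simp add: algebra_simps add_divide_distrib)
    finally have "t n powr (1 - \<gamma>) * dF n / (1 - \<gamma>)
        \<le> t n powr p * dA n / p + t n powr q * dB n / q - t n powr (\<alpha> + 1) * dL n / (\<alpha> + 1)"
      using en by (simp add: zero_le_mult_iff)
    then have "(1 - \<gamma>) * t n powr (- (1 - \<gamma>)) * (t n powr (1 - \<gamma>) * dF n / (1 - \<gamma>)) \<le> R n"
      unfolding R_def using exps by (intro mult_left_mono) auto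
    moreover have "t n powr (- (1 - \<gamma>)) * t n powr (1 - \<gamma>) = 1"
      using t(2)[of n] by (subst powr_add[symmetric]) simp
    then have "(1 - \<gamma>) * t n powr (- (1 - \<gamma>)) * (t n powr (1 - \<gamma>) * dF n / (1 - \<gamma>)) = dF n"
      using exps by simp
    ultimately show ?thesis by simp
  qed
  then show ?thesis using that[of R] lR by (simp add: dF_def)
qed

text \<open>The sequences may depend on \<open>\<phi>\<close>. The constant \<open>t = 1\<close>
  serves the ball minimiser, projection factors serve the Nehari minimiser.\<close>

definition one_sided_critical :: "('v \<Rightarrow> real) \<Rightarrow> bool" where
  "one_sided_critical u \<longleftrightarrow> (\<forall>\<phi>\<in>Wplus. \<exists>e t. e \<longlonglongrightarrow> 0 \<and> (\<forall>n. 0 < e n \<and> e n \<le> 1) \<and> t \<longlonglongrightarrow> 1 \<and> (\<forall>n. 0 < t n)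
     \<and> (\<forall>n::nat. energy (\<lambda>x. t n * u x) \<le> energy (\<lambda>x. t n * (u x + e n * \<phi> x))))"

lemma one_sided_criticalE:
  assumes "one_sided_critical u" "u \<in> Wplus" "\<phi> \<in> Wplus"
  obtains e R where "e \<longlonglongrightarrow> 0" "\<And>n::nat. 0 < e n" "\<And>n. e n \<le> 1"
    "\<And>n. (Fi (\<lambda>x. u x + e n * \<phi> x) - Fi u) / e n \<le> R n"
    "R \<longlonglongrightarrow> (1 - \<gamma>) * (integral_V G (weak_integrand G p a u \<phi>) + integral_V G (weak_integrand G q b u \<phi>)
      - lam * integral_V G (\<lambda>x. g x * u x powr \<alpha> * \<phi> x))"
proof -
  from assms(1,3) obtain e t where et: "e \<longlonglongrightarrow> 0" "\<And>n. 0 < e n" "\<And>n. e n \<le> 1" "t \<longlonglongrightarrow> 1" "\<And>n. 0 < t n"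
    "\<And>n::nat. energy (\<lambda>x. t n * u x) \<le> energy (\<lambda>x. t n * (u x + e n * \<phi> x))"
    unfolding one_sided_critical_def by blast
  show ?thesis
    by (rule one_sided_variation[OF assms(2,3) et]) (rule that[OF et(1-3)])
qed

lemma integral_F_difference_quotient:
  assumes u: "u \<in> Wplus" "\<phi> \<in> Wplus" and e: "0 < e"
  shows "integrable_V G (\<lambda>x. f x * (((u x + e * \<phi> x) powr (1 - \<gamma>) - u x powr (1 - \<gamma>)) / e))"
    and "integral_V G (\<lambda>x. f x * (((u x + e * \<phi> x) powr (1 - \<gamma>) - u x powr (1 - \<gamma>)) / e))
      = (Fi (\<lambda>x. u x + e * \<phi> x) - Fi u) / e"
    and "0 \<le> f x * (((u x + e * \<phi> x) powr (1 - \<gamma>) - u x powr (1 - \<gamma>)) / e)"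
proof -
  have eq: "(\<lambda>x. f x * (((u x + e * \<phi> x) powr (1 - \<gamma>) - u x powr (1 - \<gamma>)) / e))
    = (\<lambda>x. (1 / e) * (f x * (u x + e * \<phi> x) powr (1 - \<gamma>) - f x * u x powr (1 - \<gamma>)))"
    by (simp add: right_diff_distrib diff_divide_distrib)
  have i: "integrable_V G (\<lambda>x. f x * (u x + e * \<phi> x) powr (1 - \<gamma>))" "integrable_V G (\<lambda>x. f x * u x powr (1 - \<gamma>))"
    using integrable_F[OF Wplus_perturb[OF u, of e]] integrable_F[OF u(1)] e by auto
  show "integrable_V G (\<lambda>x. f x * (((u x + e * \<phi> x) powr (1 - \<gamma>) - u x powr (1 - \<gamma>)) / e))"
    unfolding eq by (intro integrable_V_cmult integrable_V_diff i)
  show "integral_V G (\<lambda>x. f x * (((u x + e * \<phi> x) powr (1 - \<gamma>) - u x powr (1 - \<gamma>)) / e))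
      = (Fi (\<lambda>x. u x + e * \<phi> x) - Fi u) / e"
    unfolding eq integral_V_cmult integral_V_diff[OF i] Fi_def by simp
  have "u x powr (1 - \<gamma>) \<le> (u x + e * \<phi> x) powr (1 - \<gamma>)"
    using u e exps by (intro powr_mono2) (auto simp: Wplus_nonneg)
  then show "0 \<le> f x * (((u x + e * \<phi> x) powr (1 - \<gamma>) - u x powr (1 - \<gamma>)) / e)"
    using f_pos[of x] e by simp
qed

text \<open>
  At a zero of \<open>u\<close> a bump of height \<open>e\<close> lowers the singular part of the energy by the order of
  \<open>e\<^bsup>1-\<gamma>\<^esup>\<close>, which outweighs the first-order changes of the other terms.
\<close>

lemma one_sided_critical_pos:
  assumes crit: "one_sided_critical u" and u: "u \<in> Wplus"
  shows "0 < u z"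
proof (rule ccontr)
  assume "\<not> 0 < u z"
  then have uz: "u z = 0" using Wplus_nonneg[OF u, of z] by simp
  define \<phi> where "\<phi> = (\<lambda>x. of_bool (x = z) :: real)"
  have \<phi>: "\<phi> \<in> Wplus" unfolding \<phi>_def by (intro WplusI W_indicator) auto
  obtain e R where e: "e \<longlonglongrightarrow> 0" "\<And>n::nat. 0 < e n" and "\<And>n. e n \<le> 1" and le: "\<And>n. (Fi (\<lambda>x. u x + e n * \<phi> x) - Fi u) / e n \<le> R n"
    and R: "R \<longlonglongrightarrow> (1 - \<gamma>) * (integral_V G (weak_integrand G p a u \<phi>) + integral_V G (weak_integrand G q b u \<phi>)
      - lam * integral_V G (\<lambda>x. g x * u x powr \<alpha> * \<phi> x))" (is "_ \<longlonglongrightarrow> ?r")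
    by (rule one_sided_criticalE[OF crit u \<phi>]) (rule that)
  \<comment> \<open>The quotient at \<open>z\<close> is \<open>e powr (- \<gamma>)\<close> times
    \<open>f z\<close>. Multiplication by \<open>e powr \<gamma>\<close> removes the blow-up but
    sends the right-hand side to 0, because \<open>R\<close> converges.\<close>
  have "vmeas G z * f z \<le> e n powr \<gamma> * R n" for n
  proof -
    have en: "0 < e n" by (rule e)
    have "vmeas G z * (f z * (((u z + e n * \<phi> z) powr (1 - \<gamma>) - u z powr (1 - \<gamma>)) / e n))
       \<le> integral_V G (\<lambda>x. f x * (((u x + e n * \<phi> x) powr (1 - \<gamma>) - u x powr (1 - \<gamma>)) / e n))"
      by (rule integral_V_ge_point) (use integral_F_difference_quotient[OF u \<phi> en] in auto)
    also have "\<dots> \<le> R n"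
      unfolding integral_F_difference_quotient(2)[OF u \<phi> en] by (rule le)
    finally have "vmeas G z * (f z * (e n powr (1 - \<gamma>) / e n)) \<le> R n"
      by (simp add: uz \<phi>_def)
    moreover have "e n powr \<gamma> * (e n powr (1 - \<gamma>) / e n) = 1"
    proof -
      have "e n powr \<gamma> * e n powr (1 - \<gamma>) = e n"
        using en by (subst powr_add[symmetric]) simp
      then show ?thesis using en by simp
    qed
    then have "e n powr \<gamma> * (vmeas G z * (f z * (e n powr (1 - \<gamma>) / e n))) = vmeas G z * f z"
      by (metis (no_types, lifting) mult.assoc mult.commute mult.right_neutral)
    ultimately show ?thesis
      by (metis mult_left_mono powr_ge_zero)
  qed
  moreover have "(\<lambda>n. e n powr \<gamma> * R n) \<longlonglongrightarrow> 0 powr \<gamma> * ?r"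
    using e exps by (intro tendsto_intros R tendsto_powr') (auto simp: less_imp_le)
  ultimately have "vmeas G z * f z \<le> 0 powr \<gamma> * ?r"
    by (intro LIMSEQ_le_const) auto
  moreover have "0 < vmeas G z * f z" using f_pos[of z] by simp
  ultimately show False by simp
qed

lemma singular_quotient_tendsto:
  assumes "0 < u x" and e: "e \<longlonglongrightarrow> 0" "\<And>n. 0 < e n"
  shows "(\<lambda>n. f x * (((u x + e n * \<phi> x) powr (1 - \<gamma>) - u x powr (1 - \<gamma>)) / e n))
    \<longlonglongrightarrow> (1 - \<gamma>) * (f x * u x powr (- \<gamma>) * \<phi> x)"
proof -
  have "((\<lambda>t. (u x + t * \<phi> x) powr (1 - \<gamma>)) has_real_derivative
      ((1 - \<gamma>) * (u x + 0 * \<phi> x) powr (1 - \<gamma> - 1) * \<phi> x)) (at 0)"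
    using assms by (auto intro!: derivative_eq_intros)
  from tendsto_mult_left[OF DERIV_difference_quotient_seq[OF this e], of "f x"]
  show ?thesis by (simp add: mult_ac)
qed

text \<open>The quotients of the singular term are non-negative with integrals bounded by
  \<open>R\<close>, so Fatou yields integrability and inequality at once, without a
  majorant.\<close>

lemma weak_inequality_nonneg:
  assumes crit: "one_sided_critical u" and u: "u \<in> Wplus" and \<phi>: "\<phi> \<in> Wplus"
  shows "integrable_V G (\<lambda>x. f x * u x powr (- \<gamma>) * \<phi> x)"
    and "integral_V G (\<lambda>x. f x * u x powr (- \<gamma>) * \<phi> x)
      \<le> integral_V G (weak_integrand G p a u \<phi>) + integral_V G (weak_integrand G q b u \<phi>)
        - lam * integral_V G (\<lambda>x. g x * u x powr \<alpha> * \<phi> x)" (is "_ \<le> ?r")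
proof -
  obtain e R where e: "e \<longlonglongrightarrow> 0" "\<And>n::nat. 0 < e n" and "\<And>n. e n \<le> 1" and le: "\<And>n. (Fi (\<lambda>x. u x + e n * \<phi> x) - Fi u) / e n \<le> R n"
    and R: "R \<longlonglongrightarrow> (1 - \<gamma>) * ?r"
    by (rule one_sided_criticalE[OF crit u \<phi>]) (rule that)
  note q = integral_F_difference_quotient[OF u \<phi> e(2)]
  let ?q = "\<lambda>n x. f x * (((u x + e n * \<phi> x) powr (1 - \<gamma>) - u x powr (1 - \<gamma>)) / e n)"
  have lim: "(\<lambda>n. ?q n x) \<longlonglongrightarrow> (1 - \<gamma>) * (f x * u x powr (- \<gamma>) * \<phi> x)" for x
    by (rule singular_quotient_tendsto[OF one_sided_critical_pos[OF crit u] e])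
  have le': "integral_V G (?q n) \<le> R n" for n
    unfolding q(2) by (rule le)
  note F = integral_V_Fatou[where \<psi> = ?q, OF q(3) q(1) lim le' R]
  have i: "integrable_V G (\<lambda>x. (1 - \<gamma>) * (f x * u x powr (- \<gamma>) * \<phi> x))"
    and l: "integral_V G (\<lambda>x. (1 - \<gamma>) * (f x * u x powr (- \<gamma>) * \<phi> x)) \<le> (1 - \<gamma>) * ?r"
    using F by auto
  show "integrable_V G (\<lambda>x. f x * u x powr (- \<gamma>) * \<phi> x)"
    using integrable_V_cmult[OF i, of "1 / (1 - \<gamma>)"] exps by simp
  show "integral_V G (\<lambda>x. f x * u x powr (- \<gamma>) * \<phi> x) \<le> ?r"
    using l exps unfolding integral_V_cmult by simp
qed

definition residual :: "('v \<Rightarrow> real) \<Rightarrow> ('v \<Rightarrow> real) \<Rightarrow> 'v \<Rightarrow> real" where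
  "residual u \<phi> x = weak_integrand G p a u \<phi> x + weak_integrand G q b u \<phi> x
     - f x * u x powr (- \<gamma>) * \<phi> x - lam * (g x * u x powr \<alpha> * \<phi> x)"

lemma residual_add: "residual u (\<lambda>x. \<phi> x + \<psi> x) x = residual u \<phi> x + residual u \<psi> x"
  unfolding residual_def weak_integrand_def gradient_form_add_right by (simp add: algebra_simps)

lemma residual_cmult: "residual u (\<lambda>x. k * \<phi> x) x = k * residual u \<phi> x"
  unfolding residual_def weak_integrand_def gradient_form_cmult_right by (simp add: algebra_simps)

text \<open>The integrated residual is linear in the test function, non-negative on non-negative
  ones, and zero at \<open>u\<close>. Multiples of \<open>u\<close> can therefore be added for free,
  which makes truncated test functions non-negative.\<close>

theorem one_sided_critical_imp_solution:
  assumes crit: "one_sided_critical u" and u: "u \<in> Wplus" and zero: "Wp.En u + Wq.En u = Fi u + Li u"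
  shows "positive_solution G p q a b f g \<gamma> \<alpha> lam u"
proof -
  have pos: "0 < u x" for x by (rule one_sided_critical_pos[OF crit u])
  have nn: "0 \<le> u x" for x by (rule Wplus_nonneg[OF u])
  have uW: "u \<in> W1_weighted G p a" "u \<in> W1_weighted G q b" using u by (auto simp: Wplus_iff)
  have fabs: "integrable_V G (\<lambda>x. f x * u x powr (- \<gamma>) * \<bar>\<phi> x\<bar>)" if "\<phi> \<in> W" for \<phi>
    using weak_inequality_nonneg(1)[OF crit u WplusI[OF W_abs[OF that]]] by simp
  have fi: "integrable_V G (\<lambda>x. f x * u x powr (- \<gamma>) * \<phi> x)" if "\<phi> \<in> W" for \<phi>
    by (rule integrable_V_comparison[OF fabs[OF that]]) (simp add: abs_mult f_pos less_imp_le)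
  note ints = Wp.integrable_weak_integrand[OF uW(1) _ nn] Wq.integrable_weak_integrand[OF uW(2) _ nn]
    fi integrable_g_test[OF u]
  have res_i: "integrable_V G (residual u \<phi>)"
    and res_eq: "integral_V G (residual u \<phi>)
      = integral_V G (weak_integrand G p a u \<phi>) + integral_V G (weak_integrand G q b u \<phi>)
        - integral_V G (\<lambda>x. f x * u x powr (- \<gamma>) * \<phi> x) - lam * integral_V G (\<lambda>x. g x * u x powr \<alpha> * \<phi> x)"
    if \<phi>: "\<phi> \<in> W" for \<phi>
  proof -
    have i: "integrable_V G (weak_integrand G p a u \<phi>)" "integrable_V G (weak_integrand G q b u \<phi>)"
      "integrable_V G (\<lambda>x. f x * u x powr (- \<gamma>) * \<phi> x)" "integrable_V G (\<lambda>x. lam * (g x * u x powr \<alpha> * \<phi> x))"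
      using \<phi> by (auto intro!: ints integrable_V_cmult simp: W_iff)
    show "integrable_V G (residual u \<phi>)"
      unfolding residual_def by (intro integrable_V_diff integrable_V_add i)
    show "integral_V G (residual u \<phi>)
      = integral_V G (weak_integrand G p a u \<phi>) + integral_V G (weak_integrand G q b u \<phi>)
        - integral_V G (\<lambda>x. f x * u x powr (- \<gamma>) * \<phi> x) - lam * integral_V G (\<lambda>x. g x * u x powr \<alpha> * \<phi> x)"
      unfolding residual_def
      by (simp only: integral_V_diff integral_V_add integrable_V_diff integrable_V_add i integral_V_cmult)
  qed
  have res_nonneg: "0 \<le> integral_V G (residual u \<phi>)" if "\<phi> \<in> Wplus" for \<phi>
    using weak_inequality_nonneg(2)[OF crit u that] unfolding res_eq[OF Wplus_W[OF that]] by linarith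
  \<comment> \<open>Tested with \<open>u\<close> itself, the weak equation is the Nehari
    equation.\<close>
  have res_self: "integral_V G (residual u u) = 0"
  proof -
    have 1: "u x powr (- \<gamma>) * u x = u x powr (1 - \<gamma>)" "u x powr \<alpha> * u x = u x powr (\<alpha> + 1)" for x
      using pos[of x] powr_add[of "u x" "- \<gamma>" 1] powr_add[of "u x" \<alpha> 1] by auto
    show ?thesis
      unfolding res_eq[OF Wplus_W[OF u]] Wp.integral_weak_integrand_self[OF nn] Wq.integral_weak_integrand_self[OF nn]
        mult.assoc 1 using zero by (simp add: Fi_def Li_def)
  qed
  have cut_nonneg: "0 \<le> integral_V G (residual u (cutoff u \<phi> k))" if \<phi>: "\<phi> \<in> W" for \<phi> k
  proof -
    have c: "cutoff u \<phi> k \<in> W"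
      using \<phi> uW nn by (auto simp: W_iff intro: Wp.cutoff_in_W1_weighted Wq.cutoff_in_W1_weighted)
    have ku: "(\<lambda>x. real k * u x) \<in> W" by (rule W_cmult[OF Wplus_W[OF u]])
    have "(\<lambda>x. cutoff u \<phi> k x + real k * u x) \<in> Wplus"
      by (rule WplusI[OF W_add[OF c ku]]) (simp add: cutoff_def max_def)
    from res_nonneg[OF this] have "0 \<le> integral_V G (\<lambda>x. residual u (cutoff u \<phi> k) x + residual u (\<lambda>x. real k * u x) x)"
      by (simp add: residual_add[abs_def])
    also have "\<dots> = integral_V G (residual u (cutoff u \<phi> k)) + real k * integral_V G (residual u u)"
      unfolding integral_V_add[OF res_i[OF c] res_i[OF ku]] by (simp add: residual_cmult[abs_def] integral_V_cmult)
    finally show ?thesis by (simp add: res_self)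
  qed
  have res_nonneg': "0 \<le> integral_V G (residual u \<phi>)" if \<phi>: "\<phi> \<in> W" for \<phi>
  proof -
    define H where "H x = Wp.weak_bound u \<phi> x + Wq.weak_bound u \<phi> x + f x * u x powr (- \<gamma>) * \<bar>\<phi> x\<bar>
      + lam * (g x * u x powr \<alpha> * \<bar>\<phi> x\<bar>)" for x
    have Hi: "integrable_V G H"
      unfolding H_def using \<phi> uW integrable_g_test[OF u W_abs[OF \<phi>]]
      by (intro integrable_V_add integrable_V_cmult fabs Wp.integrable_weak_bound Wq.integrable_weak_bound)
        (auto simp: W_iff)
    have c: "cutoff u \<phi> k \<in> W" for k
      using \<phi> uW nn by (auto simp: W_iff intro: Wp.cutoff_in_W1_weighted Wq.cutoff_in_W1_weighted)
    have le: "residual u (cutoff u \<phi> k) x \<le> H x" for k x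
    proof -
      have m: "\<bar>cutoff u \<phi> k x\<bar> \<le> \<bar>\<phi> x\<bar>" by (rule abs_cutoff_le) (rule nn)
      have "f x * u x powr (- \<gamma>) * (- cutoff u \<phi> k x) \<le> f x * u x powr (- \<gamma>) * \<bar>\<phi> x\<bar>"
        using m f_pos[of x] by (intro mult_left_mono) auto
      moreover have "lam * (g x * u x powr \<alpha> * (- cutoff u \<phi> k x)) \<le> lam * (g x * u x powr \<alpha> * \<bar>\<phi> x\<bar>)"
        using m g_nonneg[of x] lam by (intro mult_left_mono) auto
      ultimately show ?thesis
        using Wp.weak_integrand_cutoff_le[of u \<phi> k x, OF nn] Wq.weak_integrand_cutoff_le[of u \<phi> k x, OF nn]
        by (simp add: residual_def H_def)
    qed
    have lim: "(\<lambda>k. H x - residual u (cutoff u \<phi> k) x) \<longlonglongrightarrow> H x - residual u \<phi> x" for x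
      unfolding residual_def
      by (intro tendsto_intros Wp.weak_integrand_cutoff_tendsto Wq.weak_integrand_cutoff_tendsto
          Wp.cutoff_tendsto pos)
    \<comment> \<open>The truncated residuals are bounded only from above, so Fatou is applied to
      the non-negative differences.\<close>
    have "integral_V G (\<lambda>x. H x - residual u \<phi> x) \<le> integral_V G H"
    proof (rule integral_V_Fatou(2)[OF _ _ lim _ tendsto_const])
      show "0 \<le> H x - residual u (cutoff u \<phi> k) x" for k x using le[of k x] by simp
      show "integrable_V G (\<lambda>x. H x - residual u (cutoff u \<phi> k) x)" for k
        by (intro integrable_V_diff Hi res_i c)
      show "integral_V G (\<lambda>x. H x - residual u (cutoff u \<phi> k) x) \<le> integral_V G H" for k
        unfolding integral_V_diff[OF Hi res_i[OF c]] using cut_nonneg[OF \<phi>] by simp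
    qed
    then show ?thesis unfolding integral_V_diff[OF Hi res_i[OF \<phi>]] by simp
  qed
  have "integral_V G (residual u \<phi>) = 0" if \<phi>: "\<phi> \<in> W" for \<phi>
  proof -
    \<comment> \<open>Testing with \<open>- \<phi>\<close> turns the inequality into an
      equality.\<close>
    have "0 \<le> integral_V G (residual u (\<lambda>x. - 1 * \<phi> x))"
      by (rule res_nonneg'[OF W_cmult[OF \<phi>]])
    then show ?thesis using res_nonneg'[OF \<phi>] unfolding residual_cmult[abs_def] integral_V_cmult by simp
  qed
  then have eq: "integral_V G (weak_integrand G p a u \<phi>) + integral_V G (weak_integrand G q b u \<phi>)
      = integral_V G (\<lambda>x. f x * u x powr (- \<gamma>) * \<phi> x) + lam * integral_V G (\<lambda>x. g x * u x powr \<alpha> * \<phi> x)"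
    if "\<phi> \<in> W" for \<phi>
    using res_eq[OF that] that by simp
  show ?thesis
    unfolding positive_solution_def
  proof (intro conjI ballI)
    fix \<phi> assume \<phi>: "\<phi> \<in> W"
    then have \<phi>': "\<phi> \<in> W1_weighted G p a" "\<phi> \<in> W1_weighted G q b" by (simp_all add: W_iff)
    show "integrable_V G (weak_integrand G p a u \<phi>)" "integrable_V G (weak_integrand G q b u \<phi>)"
      using \<phi>' by (auto intro: ints)
    show "integrable_V G (\<lambda>x. f x * u x powr (- \<gamma>) * \<phi> x)" "integrable_V G (\<lambda>x. g x * u x powr \<alpha> * \<phi> x)"
      by (rule fi[OF \<phi>] integrable_g_test[OF u \<phi>])+
    show "integral_V G (weak_integrand G p a u \<phi>) + integral_V G (weak_integrand G q b u \<phi>)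
      = integral_V G (\<lambda>x. f x * u x powr (- \<gamma>) * \<phi> x) + lam * integral_V G (\<lambda>x. g x * u x powr \<alpha> * \<phi> x)"
      by (rule eq[OF \<phi>])
  qed (use pos Wplus_W[OF u] in auto)
qed

end

section \<open>Minimisers\<close>

lemma one_over_Suc_tendsto: "(\<lambda>n. 1 / (real n + 1)) \<longlonglongrightarrow> 0"
  using LIMSEQ_inverse_real_of_nat by (simp add: inverse_eq_divide add.commute)

text \<open>The bound by the infimum plus 1 holds for every \<open>n\<close>, so that coercivity
  gives uniform bounds.\<close>

lemma minimizing_sequence:
  fixes h :: "'a \<Rightarrow> real"
  assumes "S \<noteq> {}" "\<And>u. u \<in> S \<Longrightarrow> c \<le> h u"
  obtains u where "\<And>n. u n \<in> S" "(\<lambda>n. h (u n)) \<longlonglongrightarrow> Inf (h ` S)" "\<And>n::nat. h (u n) \<le> Inf (h ` S) + 1"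
    "\<And>w. w \<in> S \<Longrightarrow> Inf (h ` S) \<le> h w"
proof -
  have bdd: "bdd_below (h ` S)" using assms(2) by (auto simp: bdd_below_def)
  have "\<exists>w\<in>S. h w < Inf (h ` S) + 1 / (real n + 1)" for n
  proof -
    have "Inf (h ` S) < Inf (h ` S) + 1 / (real n + 1)" by simp
    then show ?thesis using assms(1) cInf_lessD[of "h ` S"] by blast
  qed
  then obtain u where u: "\<And>n. u n \<in> S" "\<And>n. h (u n) < Inf (h ` S) + 1 / (real n + 1)" by metis
  have low: "Inf (h ` S) \<le> h w" if "w \<in> S" for w
    using that bdd by (intro cInf_lower) auto
  have "(\<lambda>n. Inf (h ` S) + 1 / (real n + 1)) \<longlonglongrightarrow> Inf (h ` S) + 0"
    by (rule tendsto_add[OF tendsto_const one_over_Suc_tendsto])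
  then have up: "(\<lambda>n. Inf (h ` S) + 1 / (real n + 1)) \<longlonglongrightarrow> Inf (h ` S)" by simp
  have lim: "(\<lambda>n. h (u n)) \<longlonglongrightarrow> Inf (h ` S)"
  proof (rule tendsto_sandwich[OF _ _ tendsto_const up])
    show "\<forall>\<^sub>F n in sequentially. Inf (h ` S) \<le> h (u n)" by (simp add: low u(1))
    show "\<forall>\<^sub>F n in sequentially. h (u n) \<le> Inf (h ` S) + 1 / (real n + 1)" by (simp add: less_imp_le u(2))
  qed
  have "h (u n) \<le> Inf (h ` S) + 1" for n
    using u(2)[of n] by (smt (verit) divide_le_eq_1 of_nat_0_le_iff)
  then show ?thesis using that[of u] u(1) lim low by blast
qed

context fibering_params
begin

text \<open>Meant for limits of energies, which may exceed the energy of the limit function, while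
  \<open>F\<close> and \<open>L\<close> pass to the limit exactly.\<close>

lemma bounds_mono:
  assumes "bounds A F L" "A \<le> A'"
  shows "bounds A' F L"
proof -
  have A: "0 \<le> A" using assms by (simp add: bounds_def)
  have "(\<alpha> + 1 - p) * X0 powr (p - 1 + \<gamma>) * A powr ((1 - \<gamma>) / p)
      \<le> (\<alpha> + 1 - p) * X0 powr (p - 1 + \<gamma>) * A' powr ((1 - \<gamma>) / p)"
    using exps A assms(2) by (intro mult_left_mono powr_mono2) auto
  moreover have "(p - 1 + \<gamma>) * X powr (- (\<alpha> + 1 - p)) * A powr ((\<alpha> + 1) / p)
      \<le> (p - 1 + \<gamma>) * X powr (- (\<alpha> + 1 - p)) * A' powr ((\<alpha> + 1) / p)"
    using exps A assms(2) by (intro mult_left_mono powr_mono2) auto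
  ultimately show ?thesis using assms unfolding bounds_def by linarith
qed

text \<open>In the ball \<open>A\<close> is bounded, hence so are \<open>F\<close> and
  \<open>L\<close>; only \<open>B\<close> has to be controlled by the energy.\<close>

lemma ball_coercive:
  obtains K where "\<And>A B F L. bounds A F L \<Longrightarrow> 0 \<le> B \<Longrightarrow> A \<le> X0 powr p \<Longrightarrow> B / q \<le> J A B F L + K"
proof -
  define cF where "cF = (\<alpha> + 1 - p) * X0 powr (p - 1 + \<gamma>) * (X0 powr p) powr ((1 - \<gamma>) / p) / (\<alpha> + \<gamma>)"
  define cL where "cL = (p - 1 + \<gamma>) * X powr (- (\<alpha> + 1 - p)) * (X0 powr p) powr ((\<alpha> + 1) / p) / (\<alpha> + \<gamma>)"
  show ?thesis
  proof (rule that[of "cF / (1 - \<gamma>) + cL / (\<alpha> + 1)"])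
    fix A B F L :: real assume b: "bounds A F L" "0 \<le> B" "A \<le> X0 powr p"
    have A: "0 \<le> A" using b by (simp add: bounds_def)
    have "bounds (X0 powr p) F L" by (rule bounds_mono[OF b(1,3)])
    then have "F \<le> cF" "L \<le> cL"
      using exps by (auto simp: bounds_def cF_def cL_def pos_le_divide_eq mult.commute)
    then have "F / (1 - \<gamma>) \<le> cF / (1 - \<gamma>)" "L / (\<alpha> + 1) \<le> cL / (\<alpha> + 1)"
      using exps by (auto intro: divide_right_mono)
    moreover have "0 \<le> A / p" using A exps by simp
    ultimately show "B / q \<le> J A B F L + (cF / (1 - \<gamma>) + cL / (\<alpha> + 1))" by (simp add: J_def)
  qed
qed

lemma J_mono: "A \<le> A' \<Longrightarrow> B \<le> B' \<Longrightarrow> J A B F L \<le> J A' B' F L"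
  using exps by (auto simp: J_def intro!: add_mono divide_right_mono)

lemma Jt_mono: "A \<le> A' \<Longrightarrow> B \<le> B' \<Longrightarrow> Jt A B F L t \<le> Jt A' B' F L t"
  unfolding Jt_def by (intro J_mono mult_left_mono) auto

lemma tendsto_J:
  assumes "(A \<longlongrightarrow> A') M" "(B \<longlongrightarrow> B') M" "(F \<longlongrightarrow> F') M" "(L \<longlongrightarrow> L') M"
  shows "((\<lambda>n. J (A n) (B n) (F n) (L n)) \<longlongrightarrow> J A' B' F' L') M"
  unfolding J_def using exps by (intro tendsto_intros assms) auto

text \<open>\<open>1 - \<gamma>\<close> is the smallest power of \<open>t\<close> in the energy, and
  it carries a negative sign. After division by it the terms of \<open>A\<close> and
  \<open>B\<close> vanish as \<open>t\<close> tends to 0.\<close>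

lemma ex_small_negative:
  assumes "0 < F" "0 \<le> L"
  obtains t where "0 < t" "t powr p * A \<le> X0 powr p" "Jt A B F L t < 0"
proof -
  let ?h = "\<lambda>t. t powr (p - 1 + \<gamma>) * A / p + t powr (q - 1 + \<gamma>) * B / q - F / (1 - \<gamma>)"
  have "(?h \<longlongrightarrow> 0 powr (p - 1 + \<gamma>) * A / p + 0 powr (q - 1 + \<gamma>) * B / q - F / (1 - \<gamma>)) (at_right 0)"
    using exps by (intro tendsto_intros tendsto_powr') (auto simp: eventually_at_filter)
  then have "\<forall>\<^sub>F t in at_right 0. ?h t < 0"
    using assms exps by (intro order_tendstoD(2)) auto
  moreover have "((\<lambda>t. t powr p * A) \<longlongrightarrow> 0 powr p * A) (at_right 0)"
    using exps by (intro tendsto_intros tendsto_powr') (auto simp: eventually_at_filter)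
  then have "\<forall>\<^sub>F t in at_right 0. t powr p * A < X0 powr p"
    using X0_pos by (intro order_tendstoD(2)) auto
  moreover have "\<forall>\<^sub>F t in at_right 0. (0::real) < t" by (rule eventually_at_right_less)
  ultimately have "\<forall>\<^sub>F t in at_right 0. 0 < t \<and> t powr p * A < X0 powr p \<and> ?h t < 0"
    by eventually_elim auto
  then obtain t where t: "0 < t" "t powr p * A < X0 powr p" "?h t < 0"
    using eventually_happens'[of "at_right (0::real)"] by force
  have e: "t powr (1 - \<gamma>) * t powr r = t powr (1 - \<gamma> + r)" for r
    by (subst powr_add[symmetric]) simp
  have "Jt A B F L t = t powr (1 - \<gamma>) * ?h t - t powr (\<alpha> + 1) * L / (\<alpha> + 1)"
    by (simp add: Jt_def J_def distrib_left right_diff_distrib e flip: mult.assoc)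
  also have "\<dots> < 0"
    using t assms exps mult_pos_neg[of "t powr (1 - \<gamma>)" "?h t"] by (smt (verit) divide_nonneg_nonneg mult_nonneg_nonneg powr_ge_zero powr_gt_zero)
  finally show ?thesis using that[of t] t by auto
qed

end

context singular_problem
begin

text \<open>A summable function that is positive everywhere can only live on a countable set; the
  diagonal argument for pointwise convergence rests on this.\<close>

lemma countable_V: "countable (UNIV :: 'v set)"
proof -
  have "(\<lambda>x. vmeas G x * f x) summable_on UNIV"
    using f_integrable by (simp add: integrable_V_def)
  from summable_countable_real[OF this] have "countable {x. vmeas G x * f x \<noteq> 0}" by simp
  moreover have "{x. vmeas G x * f x \<noteq> 0} = UNIV"
    using vmeas_pos f_pos by (auto simp: less_imp_neq[symmetric])
  ultimately show ?thesis by metis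
qed

lemma convergent_subsequence:
  assumes u: "\<And>n. u n \<in> Wplus" and A: "\<And>n. Wp.En (u n) \<le> K" and B: "\<And>n. Wq.En (u n) \<le> K"
  obtains k v A' B' where "strict_mono (k :: nat \<Rightarrow> nat)" "v \<in> Wplus"
    "(\<lambda>n. Wp.En (u (k n))) \<longlonglongrightarrow> A'" "(\<lambda>n. Wq.En (u (k n))) \<longlonglongrightarrow> B'"
    "(\<lambda>n. Fi (u (k n))) \<longlonglongrightarrow> Fi v" "(\<lambda>n. Li (u (k n))) \<longlonglongrightarrow> Li v"
    "Wp.En v \<le> A'" "Wq.En v \<le> B'"
proof -
  define M where "M = (K / a0 / \<mu>0) powr (1 / p)"
  have M: "\<bar>u n x\<bar> \<le> M" for n x
  proof -
    have "\<bar>u n x\<bar> \<le> (integral_V G (\<lambda>x. \<bar>u n x\<bar> powr p) / \<mu>0) powr (1 / p)"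
      by (rule sup_bound[OF Wplus_W[OF u]])
    also have "integral_V G (\<lambda>x. \<bar>u n x\<bar> powr p) \<le> K / a0"
      using integral_powr_p_le[OF Wplus_W[OF u[of n]]] A[of n] a0 by (simp add: pos_le_divide_eq mult.commute)
    then have "(integral_V G (\<lambda>x. \<bar>u n x\<bar> powr p) / \<mu>0) powr (1 / p) \<le> M"
      unfolding M_def using mu0 p_gt_1
      by (intro powr_mono2 divide_right_mono divide_nonneg_nonneg integral_V_nonneg) auto
    finally show ?thesis .
  qed
  \<comment> \<open>Diagonal argument for uniformly bounded functions on a countable set. A second
    extraction then makes the energies converge, possibly to values above those of
    \<open>v\<close>.\<close>
  obtain k1 where k1: "strict_mono (k1 :: nat \<Rightarrow> nat)" "\<And>x. \<exists>l. (\<lambda>n. u (k1 n) x) \<longlonglongrightarrow> l"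
    using function_convergent_subsequence[OF countable_V, of u M] M by auto
  then obtain v where v: "\<And>x. (\<lambda>n. u (k1 n) x) \<longlonglongrightarrow> v x" by metis
  have "compact ({0..K} \<times> {0..K})" by (intro compact_Times) auto
  then obtain l k2 where "strict_mono (k2 :: nat \<Rightarrow> nat)"
    and l: "((\<lambda>n. (Wp.En (u (k1 n)), Wq.En (u (k1 n)))) \<circ> k2) \<longlonglongrightarrow> l"
    unfolding compact_def using A B
    by (smt (verit, del_insts) SigmaI Wp.En_nonneg Wq.En_nonneg atLeastAtMost_iff)
  define k where "k = k1 \<circ> k2"
  have k: "strict_mono k" unfolding k_def by (rule strict_mono_o) fact+
  have lA: "(\<lambda>n. Wp.En (u (k n))) \<longlonglongrightarrow> fst l" and lB: "(\<lambda>n. Wq.En (u (k n))) \<longlonglongrightarrow> snd l"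
    using tendsto_fst[OF l] tendsto_snd[OF l] by (simp_all add: k_def o_def)
  have lim: "(\<lambda>n. u (k n) x) \<longlonglongrightarrow> v x" for x
    using LIMSEQ_subseq_LIMSEQ[OF v[of x] \<open>strict_mono k2\<close>] by (simp add: k_def o_def)
  have nn: "0 \<le> v x" for x
    using LIMSEQ_le_const[OF lim[of x], of 0] Wplus_nonneg[OF u] by blast
  have uW: "u n \<in> W1_weighted G p a" "u n \<in> W1_weighted G q b" for n
    using u[of n] by (auto simp: Wplus_iff)
  have v1: "v \<in> W1_weighted G p a" "Wp.En v \<le> fst l"
    by (rule Wp.W1_weighted_Fatou[OF uW(1) lim lA])+
  have v2: "v \<in> W1_weighted G q b" "Wq.En v \<le> snd l"
    by (rule Wq.W1_weighted_Fatou[OF uW(2) lim lB])+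
  have "(\<lambda>n. Fi (u (k n))) \<longlonglongrightarrow> Fi v"
    unfolding Fi_def
  proof (rule integral_V_dominated(2))
    show "integrable_V G (\<lambda>x. M powr (1 - \<gamma>) * f x)" by (rule integrable_V_cmult[OF f_integrable])
    show "(\<lambda>n. f x * u (k n) x powr (1 - \<gamma>)) \<longlonglongrightarrow> f x * v x powr (1 - \<gamma>)" for x
      using exps by (intro tendsto_intros tendsto_powr' lim) (auto simp: Wplus_nonneg[OF u])
    show "\<bar>f x * u (k n) x powr (1 - \<gamma>)\<bar> \<le> M powr (1 - \<gamma>) * f x" for n x
      using M[of "k n" x] Wplus_nonneg[OF u, of "k n" x] f_pos[of x] exps
      by (auto simp: abs_mult mult.commute intro!: mult_right_mono mult_left_mono powr_mono2)
  qed
  moreover have "(\<lambda>n. Li (u (k n))) \<longlonglongrightarrow> Li v"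
    unfolding Li_def
  proof (rule tendsto_mult_left, rule integral_V_dominated(2))
    show "integrable_V G (\<lambda>x. M powr (\<alpha> + 1) * g x)" by (rule integrable_V_cmult[OF g_integrable])
    show "(\<lambda>n. g x * u (k n) x powr (\<alpha> + 1)) \<longlonglongrightarrow> g x * v x powr (\<alpha> + 1)" for x
      using exps by (intro tendsto_intros tendsto_powr' lim) (auto simp: Wplus_nonneg[OF u])
    show "\<bar>g x * u (k n) x powr (\<alpha> + 1)\<bar> \<le> M powr (\<alpha> + 1) * g x" for n x
      using M[of "k n" x] Wplus_nonneg[OF u, of "k n" x] g_nonneg[of x] exps
      by (auto simp: abs_mult mult.commute intro!: mult_right_mono mult_left_mono powr_mono2)
  qed
  ultimately show ?thesis
    using that[of k v "fst l" "snd l"] k lA lB v1 v2 nn by (simp add: Wplus_iff)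
qed

lemma nonzero_pos:
  assumes "u \<in> Wplus" "u x \<noteq> 0"
  shows "0 < Wp.En u" "0 < Wq.En u" "0 < Fi u"
proof -
  show "0 < Wp.En u" "0 < Wq.En u"
    using assms by (auto simp: Wplus_iff intro: Wp.En_pos Wq.En_pos)
  have "0 < f x * u x powr (1 - \<gamma>)" using f_pos[of x] assms by simp
  then show "0 < Fi u"
    unfolding Fi_def using f_pos by (intro integral_V_pos[OF integrable_F(1)[OF assms(1)]]) (auto simp: less_imp_le)
qed

lemma indicator_Wplus: "(\<lambda>x. of_bool (x = z)) \<in> Wplus"
  by (rule WplusI[OF W_indicator]) simp

text \<open>
  On the ball \<open>\<parallel>u\<parallel> \<le> X\<^sub>0\<close> the energy is coercive, and on its boundary it increases radially, so
  its minimiser is interior.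
\<close>

lemma ex_ball_minimizer:
  obtains u where "u \<in> Wplus" "0 < Wp.En u" "0 < Wq.En u" "Wp.En u < X0 powr p"
    "\<And>w. w \<in> Wplus \<Longrightarrow> Wp.En w \<le> X0 powr p \<Longrightarrow> energy u \<le> energy w"
proof -
  define S where "S = {u \<in> Wplus. Wp.En u \<le> X0 powr p}"
  obtain K where K: "\<And>A B F L. bounds A F L \<Longrightarrow> 0 \<le> B \<Longrightarrow> A \<le> X0 powr p \<Longrightarrow> B / q \<le> J A B F L + K"
    using ball_coercive by blast
  have K: "Wq.En u / q \<le> energy u + K" if "u \<in> S" for u
    unfolding energy_def using that by (intro K bounds_Wplus) (auto simp: S_def)
  obtain w where w: "w \<in> S" "energy w < 0"
  proof -
    define d where "d = (\<lambda>x. of_bool (x = (undefined :: 'v)) :: real)"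
    have d: "d \<in> Wplus" unfolding d_def by (rule indicator_Wplus)
    have "0 < Fi d" by (rule nonzero_pos(3)[OF d, of undefined]) (simp add: d_def)
    then obtain t where t: "0 < t" "t powr p * Wp.En d \<le> X0 powr p" "Jt (Wp.En d) (Wq.En d) (Fi d) (Li d) t < 0"
      using ex_small_negative[OF _ Li_nonneg] by blast
    then show ?thesis
      using that[of "\<lambda>x. t * d x"] d by (simp add: S_def Wplus_cmult Wp.En_cmult energy_cmult)
  qed
  have "- K \<le> energy u" if "u \<in> S" for u
  proof -
    have "0 \<le> Wq.En u / q" using exps by simp
    then show ?thesis using K[OF that] by linarith
  qed
  then obtain v where v: "\<And>n. v n \<in> S" "(\<lambda>n. energy (v n)) \<longlonglongrightarrow> Inf (energy ` S)"
      "\<And>n::nat. energy (v n) \<le> Inf (energy ` S) + 1"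
    and inf: "\<And>w. w \<in> S \<Longrightarrow> Inf (energy ` S) \<le> energy w"
    using minimizing_sequence[of S "- K" energy] w(1) by (metis empty_iff)
  have "Wq.En (v n) \<le> q * (Inf (energy ` S) + 1 + K)" for n
  proof -
    have "Wq.En (v n) / q \<le> Inf (energy ` S) + 1 + K" using K[OF v(1)[of n]] v(3)[of n] by linarith
    then show ?thesis using exps by (simp add: pos_divide_le_eq mult.commute)
  qed
  then have "v n \<in> Wplus" "Wp.En (v n) \<le> max (X0 powr p) (q * (Inf (energy ` S) + 1 + K))"
    "Wq.En (v n) \<le> max (X0 powr p) (q * (Inf (energy ` S) + 1 + K))" for n
    using v(1)[of n] by (auto simp: S_def le_max_iff_disj)
  note sub = convergent_subsequence[OF this]
  obtain k u A' B' where k: "strict_mono (k :: nat \<Rightarrow> nat)" and u: "u \<in> Wplus"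
    and lim: "(\<lambda>n. Wp.En (v (k n))) \<longlonglongrightarrow> A'" "(\<lambda>n. Wq.En (v (k n))) \<longlonglongrightarrow> B'"
      "(\<lambda>n. Fi (v (k n))) \<longlonglongrightarrow> Fi u" "(\<lambda>n. Li (v (k n))) \<longlonglongrightarrow> Li u"
    and le: "Wp.En u \<le> A'" "Wq.En u \<le> B'"
    by (rule sub) (rule that)
  have "(\<lambda>n. energy (v (k n))) \<longlonglongrightarrow> J A' B' (Fi u) (Li u)"
    unfolding energy_def by (intro tendsto_J lim)
  moreover have "(\<lambda>n. energy (v (k n))) \<longlonglongrightarrow> Inf (energy ` S)"
    using LIMSEQ_subseq_LIMSEQ[OF v(2) k] by (simp add: o_def)
  ultimately have "J A' B' (Fi u) (Li u) = Inf (energy ` S)" by (rule LIMSEQ_unique)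
  then have uinf: "energy u \<le> Inf (energy ` S)"
    using J_mono[OF le, of "Fi u" "Li u"] by (simp add: energy_def)
  have "A' \<le> X0 powr p"
    using LIMSEQ_le_const2[OF lim(1), of "X0 powr p"] v(1) by (auto simp: S_def)
  then have uS: "u \<in> S" using u le by (simp add: S_def)
  have min: "energy u \<le> energy w" if "w \<in> S" for w using uinf inf[OF that] by linarith
  \<comment> \<open>The negative minimum excludes the zero function, whose energy is 0.\<close>
  have "energy u < 0" using min[OF w(1)] w(2) by linarith
  moreover have "energy (\<lambda>x. 0) = 0"
    using energy_cmult[of 0 u] u by (simp add: Jt_def J_def)
  ultimately have "u \<noteq> (\<lambda>x. 0)" by auto
  then obtain x where "u x \<noteq> 0" by (auto simp: fun_eq_iff)
  from nonzero_pos[OF u this] have pos: "0 < Wp.En u" "0 < Wq.En u" by auto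
  have "Wp.En u \<noteq> X0 powr p"
  proof
    assume eq: "Wp.En u = X0 powr p"
    have "Wp.En u \<le> X powr p"
      unfolding eq using X0_pos X0_less_X p_gt_1 by (intro powr_mono2) auto
    then have "0 < 1 powr (- \<gamma>) * phi (Wp.En u) (Wq.En u) (Fi u) (Li u) 1"
      using phi_pos_between[OF bounds_Wplus[OF u] pos(2)] eq by simp
    from DERIV_pos_inc_left[OF Jt_has_derivative[OF zero_less_one] this]
    obtain d where d: "0 < d" "\<And>h. 0 < h \<Longrightarrow> h < d \<Longrightarrow>
        Jt (Wp.En u) (Wq.En u) (Fi u) (Li u) (1 - h) < Jt (Wp.En u) (Wq.En u) (Fi u) (Li u) 1"
      by blast
    define h where "h = min (d / 2) (1 / 2)"
    have h: "0 < h" "h < d" "h < 1" using d by (auto simp: h_def min_def)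
    have "(1 - h) powr p \<le> 1" using h p_gt_1 by (intro powr_le1) auto
    then have "(\<lambda>x. (1 - h) * u x) \<in> S"
      using uS h mult_right_mono[of "(1 - h) powr p" 1 "Wp.En u"] by (simp add: S_def Wplus_cmult Wp.En_cmult)
    from min[OF this] d(2)[OF h(1,2)] h show False
      by (simp add: energy_cmult[OF _ u]) (simp add: energy_def)
  qed
  then have "Wp.En u < X0 powr p" using uS by (auto simp: S_def)
  then show ?thesis using that[OF u pos] min by (simp add: S_def)
qed

lemma ex_first_critical:
  obtains u where "u \<in> Wplus" "0 < Wq.En u" "0 < Wp.En u" "Wp.En u < X0 powr p"
    "Wp.En u + Wq.En u = Fi u + Li u" "one_sided_critical u"
proof -
  obtain u where u: "u \<in> Wplus" "0 < Wp.En u" "0 < Wq.En u" "Wp.En u < X0 powr p"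
    and min: "\<And>w. w \<in> Wplus \<Longrightarrow> Wp.En w \<le> X0 powr p \<Longrightarrow> energy u \<le> energy w"
    using ex_ball_minimizer by blast
  \<comment> \<open>An interior minimiser can be scaled both up and down, so the derivative along
    its ray vanishes at 1.\<close>
  have zero: "Wp.En u + Wq.En u = Fi u + Li u"
  proof -
    have "((\<lambda>t. t powr p * Wp.En u) \<longlongrightarrow> 1 powr p * Wp.En u) (at 1)"
      by (intro tendsto_intros) auto
    then have "\<forall>\<^sub>F t in at 1. t powr p * Wp.En u < X0 powr p"
      using u(4) by (intro order_tendstoD(2)) auto
    then obtain d where d: "0 < d" "\<And>t. t \<noteq> 1 \<Longrightarrow> dist t 1 < d \<Longrightarrow> t powr p * Wp.En u < X0 powr p"
      unfolding eventually_at by auto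
    have "Jt (Wp.En u) (Wq.En u) (Fi u) (Li u) 1 \<le> Jt (Wp.En u) (Wq.En u) (Fi u) (Li u) t"
      if t: "\<bar>1 - t\<bar> < min d 1" for t
    proof (cases "t = 1")
      case False
      then have "t powr p * Wp.En u < X0 powr p" using d(2)[of t] t by (simp add: dist_real_def abs_minus_commute)
      then have "energy u \<le> energy (\<lambda>x. t * u x)"
        using t u(1) by (intro min Wplus_cmult) (auto simp: Wp.En_cmult)
      moreover have "0 \<le> t" using t by linarith
      ultimately show ?thesis using energy_cmult[of t u] u(1) by (simp add: energy_def)
    qed simp
    then have "1 powr (- \<gamma>) * phi (Wp.En u) (Wq.En u) (Fi u) (Li u) 1 = 0"
      using DERIV_local_min[OF Jt_has_derivative[OF zero_less_one], of "min d 1"] d(1) by auto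
    then show ?thesis by simp
  qed
  have "one_sided_critical u"
    unfolding one_sided_critical_def
  proof
    fix \<phi> assume \<phi>: "\<phi> \<in> Wplus"
    define e where "e n = 1 / (real n + 1)" for n
    have e: "e \<longlonglongrightarrow> 0" "\<And>n. 0 < e n" "\<And>n. e n \<le> 1"
      using one_over_Suc_tendsto by (auto simp: e_def[abs_def])
    have "(\<lambda>n. Wp.En (\<lambda>x. u x + e n * \<phi> x)) \<longlonglongrightarrow> Wp.En u"
      using u(1) \<phi> e by (intro Wp.En_perturb_tendsto) (auto simp: Wplus_iff)
    \<comment> \<open>Small perturbations stay in the open ball; the first \<open>N\<close> steps
      are discarded.\<close>
    from order_tendstoD(2)[OF this u(4)] obtain N where
      N: "\<And>n. n \<ge> N \<Longrightarrow> Wp.En (\<lambda>x. u x + e n * \<phi> x) < X0 powr p"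
      unfolding eventually_sequentially by blast
    have "energy (\<lambda>x. 1 * u x) \<le> energy (\<lambda>x. 1 * (u x + e (n + N) * \<phi> x))" for n
      using N[of "n + N"] u(1) \<phi> e(2)[of "n + N"] by (simp add: min Wplus_perturb less_imp_le)
    then show "\<exists>e t. e \<longlonglongrightarrow> 0 \<and> (\<forall>n. 0 < e n \<and> e n \<le> 1) \<and> t \<longlonglongrightarrow> 1 \<and> (\<forall>n. 0 < t n)
       \<and> (\<forall>n::nat. energy (\<lambda>x. t n * u x) \<le> energy (\<lambda>x. t n * (u x + e n * \<phi> x)))"
      using e LIMSEQ_ignore_initial_segment[OF e(1), of N]
      by (intro exI[of _ "\<lambda>n. e (n + N)"] exI[of _ "\<lambda>n. 1"]) auto
  qed
  then show ?thesis using that u zero by blast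
qed

text \<open>The closed condition on \<open>Wp.En\<close> stands in for \<open>N < 0\<close> because
  it survives limits. By \<open>nehari_zero_large\<close> it even forces
  \<open>Wp.En u > X powr p\<close> and \<open>N < 0\<close>.\<close>

definition outer_nehari :: "('v \<Rightarrow> real) set" where
  "outer_nehari = {u \<in> Wplus. X0 powr p \<le> Wp.En u \<and> Wp.En u + Wq.En u = Fi u + Li u}"

lemma outer_nehari_pos:
  assumes "u \<in> outer_nehari" shows "0 < Wp.En u" "0 < Wq.En u"
proof -
  have *: "0 < Wp.En u" using assms X0_pos by (smt (verit) mem_Collect_eq outer_nehari_def powr_gt_zero)
  then show "0 < Wp.En u" .
  have u: "u \<in> Wplus" using assms by (simp add: outer_nehari_def)
  have "Wp.En (\<lambda>x. 0 * u x) = 0" by (subst Wp.En_cmult) simp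
  then have "u \<noteq> (\<lambda>x. 0 * u x)" using * by auto
  then obtain x where "u x \<noteq> 0" by (auto simp: fun_eq_iff)
  then show "0 < Wq.En u" using nonzero_pos[OF u] by blast
qed

lemma scaled_in_outer_nehari:
  assumes "u \<in> Wplus" "0 < t" "X0 powr p \<le> t powr p * Wp.En u" "phi (Wp.En u) (Wq.En u) (Fi u) (Li u) t = 0"
  shows "(\<lambda>x. t * u x) \<in> outer_nehari"
  using assms phi_scale[OF assms(2), of "Wp.En u" "Wq.En u" "Fi u" "Li u"]
  by (simp add: outer_nehari_def Wplus_cmult Wp.En_cmult Wq.En_cmult Fi_cmult Li_cmult Wplus_nonneg)

text \<open>A point mass where \<open>g\<close> is positive makes \<open>Li\<close> positive, so its
  ray meets the Nehari set outside the ball.\<close>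

lemma outer_nehari_nonempty: "outer_nehari \<noteq> {}"
proof -
  obtain z where z: "g z \<noteq> 0" using g_nz by blast
  define d where "d = (\<lambda>x. of_bool (x = z) :: real)"
  have d: "d \<in> Wplus" unfolding d_def by (rule indicator_Wplus)
  have "0 < g z * d z powr (\<alpha> + 1)" using z g_nonneg[of z] by (simp add: d_def)
  then have "0 < integral_V G (\<lambda>x. g x * d x powr (\<alpha> + 1))"
    using g_nonneg by (intro integral_V_pos[OF integrable_g[OF d]]) auto
  then have "0 < Li d" using lam by (simp add: Li_def)
  moreover have "d z \<noteq> 0" by (simp add: d_def)
  ultimately obtain t where "0 < t" "X0 powr p \<le> t powr p * Wp.En d"
      "phi (Wp.En d) (Wq.En d) (Fi d) (Li d) t = 0"
    using ex_phi_zero[OF bounds_Wplus[OF d] nonzero_pos(1,2)[OF d]] by blast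
  from scaled_in_outer_nehari[OF d this] show ?thesis by blast
qed

text \<open>
  The pointwise limit of a minimising sequence need not lie on the Nehari set; its projection along the
  ray does, and has no more energy, because energies along rays are maximal on the Nehari set.
\<close>

lemma ex_outer_minimizer:
  obtains u where "u \<in> outer_nehari" "\<And>w. w \<in> outer_nehari \<Longrightarrow> energy u \<le> energy w"
proof -
  let ?S = outer_nehari
  obtain \<kappa> K where k: "0 < \<kappa>"
    and K: "\<And>A B F L. bounds A F L \<Longrightarrow> 0 \<le> B \<Longrightarrow> A + B = F + L \<Longrightarrow> \<kappa> * (A + B) \<le> J A B F L + K"
    using nehari_coercive by blast
  have K: "\<kappa> * (Wp.En u + Wq.En u) \<le> energy u + K" if "u \<in> ?S" for u
    unfolding energy_def using that by (intro K bounds_Wplus) (auto simp: outer_nehari_def)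
  have "- K \<le> energy u" if "u \<in> ?S" for u
  proof -
    have "0 \<le> \<kappa> * (Wp.En u + Wq.En u)" using k by simp
    then show ?thesis using K[OF that] by linarith
  qed
  then obtain v where v: "\<And>n. v n \<in> ?S" "(\<lambda>n. energy (v n)) \<longlonglongrightarrow> Inf (energy ` ?S)"
      "\<And>n::nat. energy (v n) \<le> Inf (energy ` ?S) + 1"
    and inf: "\<And>w. w \<in> ?S \<Longrightarrow> Inf (energy ` ?S) \<le> energy w"
    using minimizing_sequence[OF outer_nehari_nonempty, of "- K" energy] by metis
  have AB: "Wp.En (v n) + Wq.En (v n) \<le> (Inf (energy ` ?S) + 1 + K) / \<kappa>" for n
    using K[OF v(1)[of n]] v(3)[of n] k by (simp add: pos_le_divide_eq mult.commute)
  have "Wp.En (v n) \<le> (Inf (energy ` ?S) + 1 + K) / \<kappa>" "Wq.En (v n) \<le> (Inf (energy ` ?S) + 1 + K) / \<kappa>" for n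
    using AB[of n] Wp.En_nonneg[of "v n"] Wq.En_nonneg[of "v n"] by linarith+
  note sub = convergent_subsequence[OF _ this]
  have vS: "v n \<in> Wplus" "X0 powr p \<le> Wp.En (v n)" "Wp.En (v n) + Wq.En (v n) = Fi (v n) + Li (v n)" for n
    using v(1)[of n] by (auto simp: outer_nehari_def)
  obtain k w A B where k: "strict_mono (k :: nat \<Rightarrow> nat)" and w: "w \<in> Wplus"
    and lim: "(\<lambda>n. Wp.En (v (k n))) \<longlonglongrightarrow> A" "(\<lambda>n. Wq.En (v (k n))) \<longlonglongrightarrow> B"
      "(\<lambda>n. Fi (v (k n))) \<longlonglongrightarrow> Fi w" "(\<lambda>n. Li (v (k n))) \<longlonglongrightarrow> Li w"
    and le: "Wp.En w \<le> A" "Wq.En w \<le> B"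
    by (rule sub[OF vS(1)]) (rule that)
  have "(\<lambda>n. energy (v (k n))) \<longlonglongrightarrow> J A B (Fi w) (Li w)"
    unfolding energy_def by (intro tendsto_J lim)
  moreover have "(\<lambda>n. energy (v (k n))) \<longlonglongrightarrow> Inf (energy ` ?S)"
    using LIMSEQ_subseq_LIMSEQ[OF v(2) k] by (simp add: o_def)
  ultimately have Jinf: "J A B (Fi w) (Li w) = Inf (energy ` ?S)" by (rule LIMSEQ_unique)
  have A0: "X0 powr p \<le> A"
    using LIMSEQ_le_const[OF lim(1), of "X0 powr p"] vS by blast
  have "(\<lambda>n. Wp.En (v (k n)) + Wq.En (v (k n))) \<longlonglongrightarrow> Fi w + Li w"
    unfolding vS(3) by (intro tendsto_intros lim)
  moreover have "(\<lambda>n. Wp.En (v (k n)) + Wq.En (v (k n))) \<longlonglongrightarrow> A + B"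
    by (intro tendsto_intros lim)
  ultimately have zero: "A + B = Fi w + Li w" using LIMSEQ_unique by blast
  \<comment> \<open>\<open>N < 0\<close> keeps \<open>Li\<close> away from 0 along the sequence; as
    \<open>Li\<close> converges, the limit function cannot vanish.\<close>
  have "(p - 1 + \<gamma>) * X0 powr p \<le> (\<alpha> + \<gamma>) * Li (v n)" for n
  proof -
    have "(p - 1 + \<gamma>) * Wp.En (v n) + (q - 1 + \<gamma>) * Wq.En (v n) - (\<alpha> + \<gamma>) * Li (v n) < 0"
      by (rule nehari_zero_large(2)[OF bounds_Wplus outer_nehari_pos(2)]) (use v(1) vS in auto)
    moreover have "(p - 1 + \<gamma>) * X0 powr p \<le> (p - 1 + \<gamma>) * Wp.En (v n)"
      using vS exps p_gt_1 by (intro mult_left_mono) auto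
    moreover have "0 \<le> (q - 1 + \<gamma>) * Wq.En (v n)" using exps by simp
    ultimately show ?thesis by linarith
  qed
  then have "(p - 1 + \<gamma>) * X0 powr p \<le> (\<alpha> + \<gamma>) * Li w"
    by (intro LIMSEQ_le_const[OF tendsto_mult_left[OF lim(4)]]) auto
  moreover have "0 < (p - 1 + \<gamma>) * X0 powr p" using exps p_gt_1 X0_pos by simp
  ultimately have "0 < (\<alpha> + \<gamma>) * Li w" by linarith
  then have Lw: "0 < Li w" using exps by (simp add: zero_less_mult_iff)
  have "Li (\<lambda>x. 0) = 0" using exps by (simp add: Li_def integral_V_def)
  then have "w \<noteq> (\<lambda>x. 0)" using Lw by auto
  then obtain x where "w x \<noteq> 0" by (auto simp: fun_eq_iff)
  from nonzero_pos[OF w this] have pos: "0 < Wp.En w" "0 < Wq.En w" by auto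
  obtain t where t: "0 < t" "X0 powr p \<le> t powr p * Wp.En w" "phi (Wp.En w) (Wq.En w) (Fi w) (Li w) t = 0"
    using ex_phi_zero[OF bounds_Wplus[OF w] pos Lw] by blast
  have u: "(\<lambda>x. t * w x) \<in> ?S" by (rule scaled_in_outer_nehari[OF w t])
  have "energy (\<lambda>x. t * w x) = Jt (Wp.En w) (Wq.En w) (Fi w) (Li w) t"
    using t w by (simp add: energy_cmult)
  also have "\<dots> \<le> Jt A B (Fi w) (Li w) t" by (rule Jt_mono[OF le])
  \<comment> \<open>The limits \<open>A\<close> and \<open>B\<close> satisfy the Nehari equation
    even if the energies of \<open>w\<close> do not, so the energy formed with them is maximal at
    factor 1.\<close>
  also have "\<dots> \<le> J A B (Fi w) (Li w)"
  proof (rule Jt_le_at_zero[OF bounds_mono[OF bounds_Wplus[OF w] le(1)] _ A0 zero t(1)])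
    show "0 < B" using pos le by linarith
    show "X0 powr p \<le> t powr p * A" using t(2) mult_left_mono[OF le(1), of "t powr p"] by simp
  qed
  finally have "energy (\<lambda>x. t * w x) \<le> Inf (energy ` ?S)" using Jinf by simp
  then show ?thesis using that[OF u] inf by force
qed

text \<open>If \<open>t\<close> projects the perturbation \<open>w\<close> of \<open>u\<close>, then
  \<open>energy (t u) \<le> energy u \<le> energy (t w)\<close>: \<open>u\<close> is maximal on the
  outer part of its ray, and \<open>t w\<close> competes in the minimisation.\<close>

lemma ex_second_critical:
  obtains u where "u \<in> outer_nehari" "one_sided_critical u"
proof -
  obtain u where u: "u \<in> outer_nehari" and min: "\<And>w. w \<in> outer_nehari \<Longrightarrow> energy u \<le> energy w"
    using ex_outer_minimizer by blast
  have uW: "u \<in> Wplus" "X0 powr p \<le> Wp.En u" "Wp.En u + Wq.En u = Fi u + Li u"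
    using u by (auto simp: outer_nehari_def)
  note nz = bounds_Wplus[OF uW(1)] outer_nehari_pos(2)[OF u] uW(2,3)
  have "one_sided_critical u"
    unfolding one_sided_critical_def
  proof
    fix \<phi> assume \<phi>: "\<phi> \<in> Wplus"
    define e where "e n = 1 / (real n + 1)" for n
    have e: "e \<longlonglongrightarrow> 0" "\<And>n. 0 < e n" "\<And>n. e n \<le> 1"
      using one_over_Suc_tendsto by (auto simp: e_def[abs_def])
    let ?w = "\<lambda>n x. u x + e n * \<phi> x"
    have lim: "(\<lambda>n. Wp.En (?w n)) \<longlonglongrightarrow> Wp.En u" "(\<lambda>n. Wq.En (?w n)) \<longlonglongrightarrow> Wq.En u"
      "(\<lambda>n. Fi (?w n)) \<longlonglongrightarrow> Fi u" "(\<lambda>n. Li (?w n)) \<longlonglongrightarrow> Li u"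
      using uW(1) \<phi> e by (auto simp: Wplus_iff intro!: Wp.En_perturb_tendsto Wq.En_perturb_tendsto
          Fi_perturb_tendsto Li_perturb_tendsto)
    \<comment> \<open>Taking an index \<open>n \<ge> k\<close> and a factor within
      \<open>e k\<close> of 1 for each \<open>k\<close> makes both selected sequences
      converge.\<close>
    define admissible where "admissible k n t \<longleftrightarrow> k \<le> n \<and> 0 < t \<and> \<bar>t - 1\<bar> \<le> e k
      \<and> energy (\<lambda>x. t * u x) \<le> energy (\<lambda>x. t * ?w n x)" for k n t
    have "\<exists>n t. admissible k n t" for k
    proof -
      obtain N where N: "\<And>n. n \<ge> N \<Longrightarrow> \<exists>t. 0 < t \<and> \<bar>t - 1\<bar> \<le> e k
          \<and> phi (Wp.En (?w n)) (Wq.En (?w n)) (Fi (?w n)) (Li (?w n)) t = 0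
          \<and> X0 powr p \<le> t powr p * Wp.En (?w n) \<and> X0 powr p \<le> t powr p * Wp.En u"
        using phi_zero_perturb[OF nz e(2) lim, of k] unfolding eventually_sequentially by blast
      define n where "n = max N k"
      obtain t where t: "0 < t" "\<bar>t - 1\<bar> \<le> e k"
          "phi (Wp.En (?w n)) (Wq.En (?w n)) (Fi (?w n)) (Li (?w n)) t = 0"
          "X0 powr p \<le> t powr p * Wp.En (?w n)" "X0 powr p \<le> t powr p * Wp.En u"
        using N[of n] by (auto simp: n_def)
      have "energy (\<lambda>x. t * u x) = Jt (Wp.En u) (Wq.En u) (Fi u) (Li u) t"
        using t uW by (simp add: energy_cmult)
      also have "\<dots> \<le> energy u"
        unfolding energy_def by (rule Jt_le_at_zero[OF nz t(1,5)])
      also have "\<dots> \<le> energy (\<lambda>x. t * ?w n x)"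
        by (intro min scaled_in_outer_nehari t Wplus_perturb uW \<phi> less_imp_le[OF e(2)])
      finally have "admissible k n t" using t by (simp add: admissible_def n_def)
      then show ?thesis by blast
    qed
    then obtain m t where "\<And>k. admissible k (m k) (t k)" by metis
    then have mt: "\<And>k. k \<le> m k" "\<And>k. 0 < t k" "\<And>k. \<bar>t k - 1\<bar> \<le> e k"
        "\<And>k. energy (\<lambda>x. t k * u x) \<le> energy (\<lambda>x. t k * ?w (m k) x)"
      by (simp_all add: admissible_def)
    have "(\<lambda>k. e (m k)) \<longlonglongrightarrow> 0"
    proof (rule tendsto_sandwich[OF _ _ tendsto_const e(1)])
      have "e (m k) \<le> e k" for k using mt(1)[of k] by (auto simp: e_def intro: divide_left_mono)
      then show "\<forall>\<^sub>F k in sequentially. e (m k) \<le> e k" by simp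
      show "\<forall>\<^sub>F k in sequentially. 0 \<le> e (m k)" by (simp add: e(2) less_imp_le)
    qed
    moreover have "(\<lambda>k. t k - 1) \<longlonglongrightarrow> 0"
      by (rule Lim_null_comparison[OF _ e(1)]) (simp add: mt(3))
    then have "t \<longlonglongrightarrow> 1" by (simp add: LIM_zero_iff)
    ultimately show "\<exists>e t. e \<longlonglongrightarrow> 0 \<and> (\<forall>n. 0 < e n \<and> e n \<le> 1) \<and> t \<longlonglongrightarrow> 1 \<and> (\<forall>n. 0 < t n)
       \<and> (\<forall>n::nat. energy (\<lambda>x. t n * u x) \<le> energy (\<lambda>x. t n * (u x + e n * \<phi> x)))"
      using e mt by (intro exI[of _ "\<lambda>k. e (m k)"] exI[of _ t]) auto
  qed
  then show ?thesis using that u by blast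
qed

end

section \<open>Norm estimates and the limit\<close>

context singular_problem
begin

lemma L_norm_alpha_le:
  assumes "u \<in> W"
  shows "L_norm G (\<alpha> + 1) u
    \<le> \<mu>0 powr (- ((\<alpha> + 1 - p) / (p * (\<alpha> + 1)))) * integral_V G (\<lambda>x. \<bar>u x\<bar> powr p) powr (1 / p)"
proof -
  let ?K = "integral_V G (\<lambda>x. \<bar>u x\<bar> powr p)"
  have K: "0 \<le> ?K" by (simp add: integral_V_nonneg)
  have a1: "0 < \<alpha> + 1" using exps by simp
  have "L_norm G (\<alpha> + 1) u
      \<le> (\<mu>0 powr (- ((\<alpha> + 1 - p) / p)) * ?K powr ((\<alpha> + 1) / p)) powr (1 / (\<alpha> + 1))"
    unfolding L_norm_def using a1
    by (intro powr_mono2 integral_powr_alpha_le[OF assms] integral_V_nonneg) auto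
  also have "\<dots> = \<mu>0 powr (- ((\<alpha> + 1 - p) / (p * (\<alpha> + 1)))) * ?K powr (1 / p)"
    using a1 by (simp add: powr_mult powr_powr)
  finally show ?thesis .
qed

lemma L_space_alpha: "u \<in> W \<Longrightarrow> u \<in> L_space G (\<alpha> + 1)"
  by (simp add: L_space_def integrable_powr_alpha)

lemma fibering_eq:
  "fibering G p q a b f g \<gamma> \<alpha> lam u 1 = Wp.En u + Wq.En u - Fi u - Li u"
  by (simp add: fibering_def Wp.W1_norm_powr Wq.W1_norm_powr Fi_def Li_def)

lemma nehari_N_eq:
  "nehari_N G p q a b g \<gamma> \<alpha> lam u
    = (p - 1 + \<gamma>) * Wp.En u + (q - 1 + \<gamma>) * Wq.En u - (\<alpha> + \<gamma>) * Li u"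
  by (simp add: nehari_N_def Wp.W1_norm_powr Wq.W1_norm_powr Li_def mult.assoc)

lemma in_nehari:
  assumes "u \<in> Wplus" "Wp.En u + Wq.En u = Fi u + Li u"
  shows "u \<in> nehari G p q a b f g \<gamma> \<alpha> lam"
  unfolding nehari_def using assms by (auto intro!: exI[of _ u] exI[of _ 1] simp: fibering_eq)

text \<open>On the Nehari set the strict hypothesis follows from \<open>N > 0\<close>. Both sides
  are compared with the integral of \<open>|u|^p\<close>, for which the inequality is solved before
  passing to the exponent \<open>\<alpha> + 1\<close>.\<close>

lemma less_S_0:
  assumes u: "u \<in> Wplus" and A: "0 < Wp.En u" and less: "(\<alpha> + 1 - p) * Wp.En u < (\<alpha> + \<gamma>) * Fi u"
  shows "L_norm G (\<alpha> + 1) u < S_0 G \<mu>0 a0 f \<gamma> \<alpha> p"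
proof -
  let ?K = "integral_V G (\<lambda>x. \<bar>u x\<bar> powr p)" and ?f = "L_norm G (p / (p - 1 + \<gamma>)) f" and ?P = "p - 1 + \<gamma>"
  have P: "0 < ?P" "0 < p" "0 < \<alpha> + 1 - p" "0 < \<alpha> + \<gamma>" using exps p_gt_1 by auto
  have W: "u \<in> W" by (rule Wplus_W[OF u])
  have "0 < (\<alpha> + 1 - p) * Wp.En u" using A P by simp
  then have "0 < (\<alpha> + \<gamma>) * Fi u" using less by linarith
  then have "0 < Fi u" using P by (simp add: zero_less_mult_iff)
  then have "?K \<noteq> 0" using Fi_le[OF u] by auto
  then have K: "0 < ?K" using integral_V_nonneg[of "\<lambda>x. \<bar>u x\<bar> powr p"] by (simp add: less_le)
  have "(\<alpha> + 1 - p) * (a0 * ?K) \<le> (\<alpha> + 1 - p) * Wp.En u"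
    using P by (intro mult_left_mono integral_powr_p_le W) auto
  also have "\<dots> < (\<alpha> + \<gamma>) * Fi u" by (rule less)
  also have "\<dots> \<le> (\<alpha> + \<gamma>) * (?f * ?K powr ((1 - \<gamma>) / p))"
    using P by (intro mult_left_mono Fi_le[OF u]) auto
  finally have 1: "(\<alpha> + 1 - p) * a0 * ?K < (\<alpha> + \<gamma>) * ?f * ?K powr ((1 - \<gamma>) / p)" by (simp add: mult.assoc)
  have "?K = ?K powr (?P / p + (1 - \<gamma>) / p)" using K P by (simp add: field_simps)
  also have "\<dots> = ?K powr (?P / p) * ?K powr ((1 - \<gamma>) / p)" by (rule powr_add)
  finally have "((\<alpha> + 1 - p) * a0 * ?K powr (?P / p)) * ?K powr ((1 - \<gamma>) / p)
      < ((\<alpha> + \<gamma>) * ?f) * ?K powr ((1 - \<gamma>) / p)"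
    using 1 by (simp add: mult.assoc)
  then have "(\<alpha> + 1 - p) * a0 * ?K powr (?P / p) < (\<alpha> + \<gamma>) * ?f"
    by (rule mult_right_less_imp_less) simp
  moreover have "y < n / d * (1 / c) * w" if "d * c * y < n * w" "0 < d" "0 < c" for c d n w y :: real
    using that by (simp add: field_simps)
  ultimately have 2: "?K powr (?P / p) < (\<alpha> + \<gamma>) / (\<alpha> + 1 - p) * (1 / a0) * ?f"
    using P a0 by blast
  have "?K powr (1 / p) = (?K powr (?P / p)) powr (1 / ?P)" using P by (simp add: powr_powr)
  also have "\<dots> < ((\<alpha> + \<gamma>) / (\<alpha> + 1 - p) * (1 / a0) * ?f) powr (1 / ?P)"
    using 2 P by (intro powr_less_mono2) auto
  also have "\<dots> = ((\<alpha> + \<gamma>) / (\<alpha> + 1 - p)) powr (1 / ?P) * a0 powr (- (1 / ?P)) * ?f powr (1 / ?P)"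
    using P a0 L_norm_f_pos by (simp add: powr_mult powr_divide powr_minus_divide)
  finally have 3: "?K powr (1 / p) < \<dots>" .
  have "L_norm G (\<alpha> + 1) u \<le> \<mu>0 powr (- ((\<alpha> + 1 - p) / (p * (\<alpha> + 1)))) * ?K powr (1 / p)"
    by (rule L_norm_alpha_le[OF W])
  also have "\<dots> < \<mu>0 powr (- ((\<alpha> + 1 - p) / (p * (\<alpha> + 1)))) *
      (((\<alpha> + \<gamma>) / (\<alpha> + 1 - p)) powr (1 / ?P) * a0 powr (- (1 / ?P)) * ?f powr (1 / ?P))"
    using mu0 by (intro mult_strict_left_mono 3) auto
  also have "\<mu>0 powr (- ((\<alpha> + 1 - p) / (p * (\<alpha> + 1)))) = (1 / \<mu>0) powr ((\<alpha> + 1 - p) / (p * (\<alpha> + 1)))"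
    using mu0 by (simp add: powr_divide powr_minus_divide)
  finally show ?thesis by (simp add: S_0_def mult_ac)
qed

text \<open>With \<open>Y\<close> the norm in question, the left side is bounded below by a multiple
  of \<open>Y^p\<close>, reading the embedding backwards, and the right side above by one of
  \<open>Y^(\<alpha>+1)\<close>. Dividing by \<open>Y^p\<close> leaves a lower bound for
  \<open>Y\<close>.\<close>

lemma S_lam_less:
  assumes u: "u \<in> Wplus" and A: "0 < Wp.En u" and less: "(p - 1 + \<gamma>) * Wp.En u < (\<alpha> + \<gamma>) * Li u"
  shows "S_lam \<mu>0 a0 g \<gamma> \<alpha> p lam < L_norm G (\<alpha> + 1) u"
proof -
  let ?K = "integral_V G (\<lambda>x. \<bar>u x\<bar> powr p)" and ?g = "Linf_norm g" and ?P = "p - 1 + \<gamma>"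
    and ?D = "\<alpha> + 1 - p" and ?I = "integral_V G (\<lambda>x. \<bar>u x\<bar> powr (\<alpha> + 1))"
  define Y where "Y = L_norm G (\<alpha> + 1) u"
  have P: "0 < ?P" "0 < p" "0 < ?D" "0 < \<alpha> + \<gamma>" "0 < \<alpha> + 1" using exps p_gt_1 by auto
  have W: "u \<in> W" by (rule Wplus_W[OF u])
  have K: "0 \<le> ?K" and I: "0 \<le> ?I" by (simp_all add: integral_V_nonneg)
  have Y0: "0 \<le> Y" by (simp add: Y_def L_norm_def)
  have YI: "?I = Y powr (\<alpha> + 1)" using I P by (simp add: Y_def L_norm_def powr_powr)
  have "Y powr p \<le> (\<mu>0 powr (- (?D / (p * (\<alpha> + 1)))) * ?K powr (1 / p)) powr p"
    using P Y0 L_norm_alpha_le[OF W] by (intro powr_mono2) (auto simp: Y_def)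
  also have "\<dots> = \<mu>0 powr (- (?D / (\<alpha> + 1))) * ?K"
    using K P by (simp add: powr_mult powr_powr)
  finally have "\<mu>0 powr (?D / (\<alpha> + 1)) * Y powr p \<le> \<mu>0 powr (?D / (\<alpha> + 1)) * (\<mu>0 powr (- (?D / (\<alpha> + 1))) * ?K)"
    by (intro mult_left_mono) auto
  also have "\<dots> = ?K" using mu0 by (simp add: powr_minus)
  finally have KY: "\<mu>0 powr (?D / (\<alpha> + 1)) * Y powr p \<le> ?K" .
  have "?P * (a0 * (\<mu>0 powr (?D / (\<alpha> + 1)) * Y powr p)) \<le> ?P * (a0 * ?K)"
    using P a0 KY by (intro mult_left_mono) auto
  also have "\<dots> \<le> ?P * Wp.En u" using P by (intro mult_left_mono integral_powr_p_le W) auto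
  also have "\<dots> < (\<alpha> + \<gamma>) * Li u" by (rule less)
  also have "\<dots> \<le> (\<alpha> + \<gamma>) * (lam * (?g * Y powr (\<alpha> + 1)))"
    using P Li_le[OF u] unfolding YI by (intro mult_left_mono) auto
  finally have 1: "?P * a0 * \<mu>0 powr (?D / (\<alpha> + 1)) * Y powr p < (\<alpha> + \<gamma>) * lam * ?g * Y powr (\<alpha> + 1)"
    by (simp add: mult.assoc)
  then have "Y \<noteq> 0" by auto
  then have Yp: "0 < Y" using Y0 by simp
  have "Y powr (\<alpha> + 1) = Y powr ?D * Y powr p" by (subst powr_add[symmetric]) simp
  with 1 have "(?P * a0 * \<mu>0 powr (?D / (\<alpha> + 1))) * Y powr p < ((\<alpha> + \<gamma>) * lam * ?g * Y powr ?D) * Y powr p"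
    by (simp add: mult_ac)
  then have "?P * a0 * \<mu>0 powr (?D / (\<alpha> + 1)) < (\<alpha> + \<gamma>) * lam * ?g * Y powr ?D"
    by (rule mult_right_less_imp_less) simp
  moreover have "k / (m * n) * w * c * (1 / h) < y" if "k * c * w < n * m * h * y" "0 < n" "0 < m" "0 < h"
    for c h k m n w y :: real
    using that by (simp add: field_simps)
  ultimately have 2: "?P / (lam * (\<alpha> + \<gamma>)) * \<mu>0 powr (?D / (\<alpha> + 1)) * a0 * (1 / ?g) < Y powr ?D"
    using P lam Linf_norm_g_pos by blast
  have "S_lam \<mu>0 a0 g \<gamma> \<alpha> p lam = (?P / (lam * (\<alpha> + \<gamma>)) * \<mu>0 powr (?D / (\<alpha> + 1)) * a0 * (1 / ?g)) powr (1 / ?D)"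
  proof -
    have "(\<mu>0 powr (?D / (\<alpha> + 1))) powr (1 / ?D) = (1 / \<mu>0) powr (- (1 / (\<alpha> + 1)))"
      using P mu0 by (simp add: powr_powr powr_divide powr_minus_divide)
    moreover have "(k * w * c * h) powr s = k powr s * w powr s * c powr s * h powr s"
      if "0 \<le> k" "0 \<le> w" "0 \<le> c" "0 \<le> h" for c h k s w :: real
      using that by (simp add: powr_mult)
    from this[of "?P / (lam * (\<alpha> + \<gamma>))" "\<mu>0 powr (?D / (\<alpha> + 1))" a0 "1 / ?g" "1 / ?D"]
    have "(?P / (lam * (\<alpha> + \<gamma>)) * \<mu>0 powr (?D / (\<alpha> + 1)) * a0 * (1 / ?g)) powr (1 / ?D)
      = (?P / (lam * (\<alpha> + \<gamma>))) powr (1 / ?D) * (\<mu>0 powr (?D / (\<alpha> + 1))) powr (1 / ?D)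
        * a0 powr (1 / ?D) * (1 / ?g) powr (1 / ?D)"
      using P lam a0 Linf_norm_g_pos by simp
    ultimately show ?thesis unfolding S_lam_def by simp
  qed
  also have "\<dots> < (Y powr ?D) powr (1 / ?D)"
    using 2 P lam a0 Linf_norm_g_pos by (intro powr_less_mono2) auto
  also have "\<dots> = Y" using P Yp by (simp add: powr_powr)
  finally show ?thesis by (simp add: Y_def)
qed

theorem two_solutions:
  "\<exists>u v. u \<noteq> v
      \<and> positive_solution G p q a b f g \<gamma> \<alpha> lam u
      \<and> positive_solution G p q a b f g \<gamma> \<alpha> lam v
      \<and> u \<in> nehari_plus G p q a b f g \<gamma> \<alpha> lam
      \<and> v \<in> nehari_minus G p q a b f g \<gamma> \<alpha> lam
      \<and> W1_norm G p a v > X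
      \<and> X > X0
      \<and> X0 > W1_norm G p a u
      \<and> u \<in> L_space G (\<alpha> + 1) \<and> v \<in> L_space G (\<alpha> + 1)
      \<and> L_norm G (\<alpha> + 1) v > S_lam \<mu>0 a0 g \<gamma> \<alpha> p lam
      \<and> S_lam \<mu>0 a0 g \<gamma> \<alpha> p lam > S_0 G \<mu>0 a0 f \<gamma> \<alpha> p
      \<and> S_0 G \<mu>0 a0 f \<gamma> \<alpha> p > L_norm G (\<alpha> + 1) u
      \<and> W_norm G p q a b v > W1_norm G p a v"
proof -
  obtain u where u: "u \<in> Wplus" "0 < Wq.En u" "0 < Wp.En u" "Wp.En u < X0 powr p"
      "Wp.En u + Wq.En u = Fi u + Li u" "one_sided_critical u"
    using ex_first_critical by blast
  obtain v where v': "v \<in> outer_nehari" "one_sided_critical v"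
    using ex_second_critical by blast
  then have v: "v \<in> Wplus" "X0 powr p \<le> Wp.En v" "Wp.En v + Wq.En v = Fi v + Li v"
    by (auto simp: outer_nehari_def)
  note vpos = outer_nehari_pos[OF v'(1)]
  note vN = nehari_zero_large[OF bounds_Wplus[OF v(1)] vpos(2) v(2,3)]
  have Xp: "0 < X" using X0_pos X0_less_X by simp
  have P: "0 < p - 1 + \<gamma>" "0 < q - 1 + \<gamma>" "0 < \<alpha> + 1 - q" using exps p_gt_1 by auto
  have "X0 powr p < X powr p" using X0_pos X0_less_X p_gt_1 by (intro powr_less_mono2) auto
  then have uX: "Wp.En u < X powr p" using u by linarith
  have qB: "0 < (q - 1 + \<gamma>) * Wq.En u" "0 < (q - 1 + \<gamma>) * Wq.En v" "0 < (\<alpha> + 1 - q) * Wq.En u"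
    using P u vpos by auto
  have uL: "(\<alpha> + \<gamma>) * Li u < (p - 1 + \<gamma>) * Wp.En u"
    using bounds_L_le(2)[OF bounds_Wplus[OF u(1)]] uX u by auto
  then have uN: "0 < nehari_N G p q a b g \<gamma> \<alpha> lam u"
    unfolding nehari_N_eq using qB by linarith
  have vN': "nehari_N G p q a b g \<gamma> \<alpha> lam v < 0"
    unfolding nehari_N_eq by (rule vN(2))
  have uF: "(\<alpha> + 1 - p) * Wp.En u < (\<alpha> + \<gamma>) * Fi u"
  proof -
    have L: "Li u = Wp.En u + Wq.En u - Fi u" using u(5) by simp
    have "(\<alpha> + \<gamma>) * Li u = (\<alpha> + \<gamma>) * Wp.En u + (\<alpha> + \<gamma>) * Wq.En u - (\<alpha> + \<gamma>) * Fi u"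
      unfolding L by (simp add: algebra_simps)
    moreover have "0 < (\<alpha> + \<gamma>) * Wq.En u" using u exps p_gt_1 by simp
    moreover have "(\<alpha> + 1 - p) * Wp.En u + (p - 1 + \<gamma>) * Wp.En u = (\<alpha> + \<gamma>) * Wp.En u"
      by (simp add: algebra_simps)
    ultimately show ?thesis using uL by linarith
  qed
  have "X = (X powr p) powr (1 / p)" using Xp p_gt_1 by (simp add: powr_powr)
  also have "\<dots> < W1_norm G p a v"
    unfolding Wp.W1_norm_eq using vN(1) p_gt_1 by (intro powr_less_mono2) auto
  finally have vX: "X < W1_norm G p a v" .
  have "W1_norm G p a u < (X0 powr p) powr (1 / p)"
    unfolding Wp.W1_norm_eq using u p_gt_1 by (intro powr_less_mono2) auto
  also have "\<dots> = X0" using X0_pos p_gt_1 by (simp add: powr_powr)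
  finally have uX0: "W1_norm G p a u < X0" .
  have "0 < W1_norm G q b v" using vpos by (simp add: Wq.W1_norm_eq)
  then have vW: "W1_norm G p a v < W_norm G p q a b v" by (simp add: W_norm_def)
  have S: "S_0 G \<mu>0 a0 f \<gamma> \<alpha> p < S_lam \<mu>0 a0 g \<gamma> \<alpha> p lam"
    by (rule Lambda_star_threshold(2)) (use exps p_gt_1 mu0 a0 lam Linf_norm_g_pos L_norm_f_pos in auto)
  have uS: "L_norm G (\<alpha> + 1) u < S_0 G \<mu>0 a0 f \<gamma> \<alpha> p"
    by (rule less_S_0[OF u(1,3) uF])
  have vS: "S_lam \<mu>0 a0 g \<gamma> \<alpha> p lam < L_norm G (\<alpha> + 1) v"
    by (rule S_lam_less[OF v(1) vpos(1)]) (use vN(2) qB in linarith)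
  have sol: "positive_solution G p q a b f g \<gamma> \<alpha> lam u" "positive_solution G p q a b f g \<gamma> \<alpha> lam v"
    using one_sided_critical_imp_solution u v v' by auto
  have neh: "u \<in> nehari_plus G p q a b f g \<gamma> \<alpha> lam" "v \<in> nehari_minus G p q a b f g \<gamma> \<alpha> lam"
    using in_nehari[OF u(1,5)] in_nehari[OF v(1,3)] uN vN' by (auto simp: nehari_plus_def nehari_minus_def)
  have "u \<noteq> v" using uN vN' by auto
  then show ?thesis
    using sol neh vX X0_less_X uX0 L_space_alpha[OF Wplus_W[OF u(1)]] L_space_alpha[OF Wplus_W[OF v(1)]]
      vS S uS vW by blast
qed

text \<open>
  For \<open>p \<le> r\<close> the conjugate exponent \<open>r / (r - 1 + \<gamma>)\<close> lies between \<open>1\<close> and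
  \<open>p / (p - 1 + \<gamma>)\<close>, so \<open>f\<close> stays in the corresponding space by interpolation.
\<close>

lemma L_norm_f_ge:
  assumes r: "p \<le> r"
  shows "vmeas G z powr ((r - 1 + \<gamma>) / r) * f z \<le> L_norm G (r / (r - 1 + \<gamma>)) f"
proof -
  let ?t = "r / (r - 1 + \<gamma>)" and ?s = "p / (p - 1 + \<gamma>)"
  have P: "0 < p - 1 + \<gamma>" "0 < r - 1 + \<gamma>" "0 < r" using r exps p_gt_1 by auto
  have "r * (p - 1 + \<gamma>) \<le> p * (r - 1 + \<gamma>)"
    using mult_right_mono[OF r, of "1 - \<gamma>"] exps by (simp add: algebra_simps)
  then have t: "1 \<le> ?t" "?t \<le> ?s" using P exps by (auto simp: divide_le_eq le_divide_eq field_simps)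
  have "f x powr ?t \<le> f x + f x powr ?s" for x
  proof (cases "f x \<le> 1")
    case True
    then have "f x powr ?t \<le> f x powr 1" using t f_pos[of x] by (intro powr_mono') auto
    then show ?thesis using f_pos[of x] by simp (smt (verit) powr_ge_zero)
  next
    case False
    then have "f x powr ?t \<le> f x powr ?s" using t by (intro powr_mono) auto
    then show ?thesis using f_pos[of x] by simp
  qed
  \<comment> \<open>Summability has to come first: the integral of a non-summable function is 0 by
    default and would not dominate a single term.\<close>
  then have int: "integrable_V G (\<lambda>x. \<bar>f x\<bar> powr ?t)"
    using f_pos by (intro integrable_V_comparison[OF integrable_V_add[OF f_integrable f_powr_integrable]])
      (simp add: less_imp_le)
  have "vmeas G z powr ((r - 1 + \<gamma>) / r) * f z = (vmeas G z * \<bar>f z\<bar> powr ?t) powr (1 / ?t)"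
    using P f_pos[of z] by (simp add: powr_mult powr_powr)
  also have "\<dots> \<le> L_norm G ?t f"
    unfolding L_norm_def using P
    by (intro powr_mono2 integral_V_ge_point[OF int]) auto
  finally show ?thesis .
qed

text \<open>\<open>X_lam\<close> exceeds \<open>X_0\<close>, whose factor with base
  \<open>(\<alpha> + \<gamma>) / (\<alpha> + 1 - r)\<close> blows up. The function \<open>l\<close>
  lets the parameter follow the threshold, which itself depends on the exponent.\<close>

lemma X_lam_tendsto_at_top:
  fixes l :: "real \<Rightarrow> real"
  assumes l: "\<forall>\<^sub>F r in at_left (\<alpha> + 1). 0 < l r \<and> l r < Lambda_star G \<mu>0 a0 f g \<gamma> \<alpha> r"
  shows "filterlim (\<lambda>r. X_lam \<mu>0 a0 g \<gamma> \<alpha> r (l r)) at_top (at_left (\<alpha> + 1))"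
proof -
  fix z :: 'v
  define e where "e r = 1 / (r - 1 + \<gamma>)" for r
  \<comment> \<open>The remaining factors of \<open>X_0\<close>, with the norm of \<open>f\<close>
    replaced by its lower bound from the single vertex \<open>z\<close>; their limit is
    positive.\<close>
  define R where "R r = a0 powr (- ((1 - \<gamma>) / (r * (r - 1 + \<gamma>))))
    * (vmeas G z powr ((r - 1 + \<gamma>) / r) * f z) powr (1 / (r - 1 + \<gamma>))" for r
  let ?F = "at_left (\<alpha> + 1)"
  let ?c = "\<lambda>r. (\<alpha> + \<gamma>) / (\<alpha> + 1 - r)"
  have N: "0 < \<alpha> + \<gamma>" "0 < \<alpha> + 1" using exps by auto
  have left: "\<forall>\<^sub>F r in ?F. r < \<alpha> + 1" by (auto simp: eventually_at_filter)
  have id: "((\<lambda>r. r) \<longlongrightarrow> \<alpha> + 1) ?F" by (rule tendsto_ident_at)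
  have e: "(e \<longlongrightarrow> 1 / (\<alpha> + 1 - 1 + \<gamma>)) ?F"
    unfolding e_def using N by (intro tendsto_intros id) auto
  have R: "(R \<longlongrightarrow> R (\<alpha> + 1)) ?F"
    unfolding R_def using N a0 f_pos[of z]
    by (intro tendsto_intros id) (auto simp: less_imp_neq[symmetric])
  have Rpos: "0 < R (\<alpha> + 1)" unfolding R_def using a0 f_pos[of z] by (auto simp: less_imp_neq[symmetric])
  have "((\<lambda>r. \<alpha> + 1 - r) \<longlongrightarrow> \<alpha> + 1 - (\<alpha> + 1)) ?F" by (intro tendsto_intros id)
  then have "filterlim ?c at_top ?F"
    using left N by (intro LIM_at_top_divide[OF tendsto_const]) (auto elim: eventually_mono)
  then have lnc: "filterlim (\<lambda>r. ln (?c r)) at_top ?F" by (rule filterlim_compose[OF ln_at_top])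
  have "filterlim (\<lambda>r. exp (e r * ln (?c r))) at_top ?F"
    by (rule filterlim_compose[OF exp_at_top filterlim_tendsto_pos_mult_at_top[OF e _ lnc]]) (use N in simp)
  then have lim: "filterlim (\<lambda>r. R r * exp (e r * ln (?c r))) at_top ?F"
    by (rule filterlim_tendsto_pos_mult_at_top[OF R Rpos])
  have "\<forall>\<^sub>F r in ?F. p < r" using order_tendstoD(1)[OF id] exps by auto
  with left l have "\<forall>\<^sub>F r in ?F. R r * exp (e r * ln (?c r)) \<le> X_lam \<mu>0 a0 g \<gamma> \<alpha> r (l r)"
  proof eventually_elim
    case (elim r)
    have f: "vmeas G z powr ((r - 1 + \<gamma>) / r) * f z \<le> L_norm G (r / (r - 1 + \<gamma>)) f"
      using elim by (intro L_norm_f_ge) simp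
    have f0: "0 < vmeas G z powr ((r - 1 + \<gamma>) / r) * f z" using f_pos[of z] by (simp add: less_imp_neq[symmetric])
    have "R r * exp (e r * ln (?c r)) = ?c r powr (1 / (r - 1 + \<gamma>)) * R r"
      using elim N by (simp add: powr_def e_def)
    also have "\<dots> \<le> X_0 G a0 f \<gamma> \<alpha> r"
      unfolding R_def X_0_def mult.assoc using f f0 elim exps p_gt_1
      by (intro mult_left_mono powr_mono2) auto
    also have "\<dots> \<le> X_lam \<mu>0 a0 g \<gamma> \<alpha> r (l r)"
      by (intro less_imp_le Lambda_star_threshold(1))
        (use elim exps p_gt_1 mu0 a0 Linf_norm_g_pos f f0 in auto)
    finally show ?case .
  qed
  with lim show ?thesis by (rule filterlim_at_top_mono)
qed

end

theorem theorem1p1: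
  fixes G :: "'v wgraph"
    and \<mu>0 C \<gamma> p q \<alpha> a0 b0 lam :: real
    and f g a b :: "'v \<Rightarrow> real"
  assumes "weighted_graph G" and "locally_finite G" and "connected_graph G"
    and "\<mu>0 > 0" and "\<And>x. vmeas G x \<ge> \<mu>0"
    and "C > 0" and "\<And>x. (\<Sum>y\<in>nbrs G x. weight G x y) < C"
    and "0 < \<gamma>" and "\<gamma> < 1" and "1 < q" and "q \<le> p" and "p < \<alpha> + 1"
    and "\<And>x. f x > 0"
    and "\<And>x. g x \<ge> 0" and "\<exists>x. g x \<noteq> 0"
    and "f \<in> L_space G 1 \<inter> L_space G (p / (p - 1 + \<gamma>)) \<inter> L_space G (q / (q - 1 + \<gamma>))"
    and "g \<in> L_space G 1 \<inter> Linf_space"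
    and "a0 > 0" and "\<And>x. a x \<ge> a0"
    and "b0 > 0" and "\<And>x. b x \<ge> b0"
    and "0 < lam" and "lam < Lambda_star G \<mu>0 a0 f g \<gamma> \<alpha> p"
  shows "(\<exists>u v. u \<noteq> v
            \<and> positive_solution G p q a b f g \<gamma> \<alpha> lam u
            \<and> positive_solution G p q a b f g \<gamma> \<alpha> lam v
            \<and> u \<in> nehari_plus G p q a b f g \<gamma> \<alpha> lam
            \<and> v \<in> nehari_minus G p q a b f g \<gamma> \<alpha> lam
            \<and> W1_norm G p a v > X_lam \<mu>0 a0 g \<gamma> \<alpha> p lam
            \<and> X_lam \<mu>0 a0 g \<gamma> \<alpha> p lam > X_0 G a0 f \<gamma> \<alpha> p
            \<and> X_0 G a0 f \<gamma> \<alpha> p > W1_norm G p a u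
            \<and> u \<in> L_space G (\<alpha> + 1) \<and> v \<in> L_space G (\<alpha> + 1)
            \<and> L_norm G (\<alpha> + 1) v > S_lam \<mu>0 a0 g \<gamma> \<alpha> p lam
            \<and> S_lam \<mu>0 a0 g \<gamma> \<alpha> p lam > S_0 G \<mu>0 a0 f \<gamma> \<alpha> p
            \<and> S_0 G \<mu>0 a0 f \<gamma> \<alpha> p > L_norm G (\<alpha> + 1) u
            \<and> W_norm G p q a b v > W1_norm G p a v)
       \<and> (\<forall>l :: real \<Rightarrow> real.
            (\<forall>\<^sub>F r in at_left (\<alpha> + 1). 0 < l r \<and> l r < Lambda_star G \<mu>0 a0 f g \<gamma> \<alpha> r) \<longrightarrow>
            filterlim (\<lambda>r. X_lam \<mu>0 a0 g \<gamma> \<alpha> r (l r)) at_top (at_left (\<alpha> + 1)))"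
proof -
  interpret singular_problem G \<mu>0 \<gamma> p q \<alpha> a0 b0 lam f g a b
    using assms by unfold_locales auto
  show ?thesis
    using two_solutions X_lam_tendsto_at_top by blast
qed

end
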